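(* Let $Q_0$ and $Q_1$ be two mutually absolutely continuous probability measures, and consider the noisy cascade observation model on the $d$-dimensional lattice with source $v_0$ uniform on $V_n$. There exist constants $0<\Delta_1\le\Delta_2$ depending only on $Q_0,Q_1$ and the lattice dimension $d$ such that $$\lim_{n\to\infty}\ \min_{v\in V_n}\ \mathbb{P}_v\big(H(\Delta_1\log n)\le T^n_{opt}\le H(\Delta_2\log n)\big)=1.$$ Furthermore, the same holds with $T^n_{opt}$ replaced by $T^n_+$.
   Context: Lattice: $G$ is the graph with vertex set $V=\mathbb{Z}^d\subset\mathbb{R}^d$, two vertices being adjacent iff their $\ell_1$ distance is $1$; its shortest-path distance is $d(u,v)=\|u-v\|_1$. $\mathcal{N}_v(t)=\{u: d(u,v)\le t\}$ and $\partial\mathcal{N}_v(t)=\{u: d(u,v)=t\}$; their sizes do not depend on $v$ and are written $|\mathcal{N}(t)|$, $|\partial\mathcal{N}(t)|$. The neighborhood growth function is $h(t)=\sum_{s=0}^t|\mathcal{N}(s)|$, and $H=h^{-1}$ is its inverse (so for an integer time $t$, $t\le H(z)$ means $h(t)\le z$ and $t\ge H(z)$ means $h(t)\ge z$). $V_n=\mathcal{N}_0(n^{1/d})$ is the ball around the origin, where $n^{1/d}$ is assumed to be an integer; $|V_n|$ is of order $n$. Model: time is $t=0,1,2,\dots$. The source $v_0$ is uniform on $V_n$; $\mathbb{P}_v=\mathbb{P}(\cdot\mid v_0=v)$. Conditionally on $v_0$, the signals $y_u(t)$ ($u\in V$, $t\ge0$) are independent over time and vertices, with $y_u(t)\sim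 Q_1$ if $d(u,v_0)\le t$ and $y_u(t)\sim Q_0$ if $d(u,v_0)>t$. $\mathcal{F}_t=\sigma(y_u(s):u\in V,\,0\le s\le t)$ and $\hat v(t)=\mathbb{E}[v_0\mid\mathcal{F}_t]\in\mathbb{R}^d$. Stopping times: for $s\ge0$ let $\mathcal{T}_s$ be the set of $\{\mathcal{F}_t\}$-stopping times $T$ with $T\ge s$ a.s., and for $T\in\mathcal{T}_s$ let $f_s(T)=\|\hat v(T)-\hat v(s)\|_2^2-(|\mathcal{N}(T)|-|\mathcal{N}(s)|)$. With the prior distribution of $v_0$ being uniform on $V_n$, $$T^n_{opt}=\min\Big\{s\ge0:\sup_{T\in\mathcal{T}_s}\mathbb{E}[f_s(T)\mid\mathcal{F}_s]=0\Big\},$$ $$T^n_+=\min\big\{s\ge0:\mathbb{E}[\|v_0-\hat v(s)\|_2^2\mid\mathcal{F}_s]\le|\partial\mathcal{N}(s)|\big\},$$ where the supremum of conditional expectations is understood as an essential supremum.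
   Formalization: The formal theorem assumes in addition that Q_0 ≠ Q_1 and that the divergence D(Q_1||Q_0) is finite; the stated lower bound is false when Q_0 = Q_1 and whenever D(Q_1||Q_0) is infinite. *)

theory Defs
  imports "HOL-Probability.Probability" "HOL-Library.Extended_Nat"
begin

section \<open>The lattice\<close>

text \<open>The lattice of dimension \<open>d = CARD('d)\<close> is the type \<open>int ^ 'd\<close>.\<close>

definition ldist :: "int ^ 'd \<Rightarrow> int ^ 'd \<Rightarrow> nat"
  where "ldist u v = nat (\<Sum>i\<in>UNIV. \<bar>u $ i - v $ i\<bar>)"

definition nball :: "int ^ 'd \<Rightarrow> real \<Rightarrow> (int ^ 'd) set"
  where "nball v r = {u. real (ldist u v) \<le> r}"

definition nsphere :: "int ^ 'd \<Rightarrow> real \<Rightarrow> (int ^ 'd) set"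
  where "nsphere v r = {u. real (ldist u v) = r}"

definition ball_size :: "'d::finite itself \<Rightarrow> nat \<Rightarrow> nat"
  where "ball_size _ t = card (nball (0 :: int ^ 'd) (real t))"

definition sphere_size :: "'d::finite itself \<Rightarrow> nat \<Rightarrow> nat"
  where "sphere_size _ t = card (nsphere (0 :: int ^ 'd) (real t))"

definition growth :: "'d::finite itself \<Rightarrow> nat \<Rightarrow> nat"
  where "growth D t = (\<Sum>s\<le>t. ball_size D s)"

text \<open>
  \<open>H(z\<^sub>1) \<le> T \<le> H(z\<^sub>2)\<close> for \<open>H\<close> the inverse of \<open>growth\<close>: for an integer time \<open>t\<close>,
  \<open>t \<ge> H(z)\<close> means \<open>growth t \<ge> z\<close> and \<open>t \<le> H(z)\<close> means \<open>growth t \<le> z\<close>.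
  An infinite time is never below \<open>H(z\<^sub>2)\<close>.
\<close>
definition between_H :: "'d::finite itself \<Rightarrow> real \<Rightarrow> real \<Rightarrow> enat \<Rightarrow> bool"
  where "between_H D z\<^sub>1 z\<^sub>2 T \<longleftrightarrow>
    (\<exists>t. T = enat t \<and> z\<^sub>1 \<le> real (growth D t) \<and> real (growth D t) \<le> z\<^sub>2)"

definition sources :: "nat \<Rightarrow> (int ^ 'd::finite) set"
  where "sources n = nball 0 (root CARD('d) (real n))"

definition embed :: "int ^ 'd \<Rightarrow> real ^ 'd"
  where "embed v = (\<chi> i. real_of_int (v $ i))"

section \<open>The observation model\<close>

text \<open>
  An outcome is a pair \<open>(v\<^sub>0, y)\<close> of a source and a field of signals, \<open>y (u, t)\<close> being the
  signal of vertex \<open>u\<close> at time \<open>t\<close>.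
\<close>
type_synonym ('d, 'b) outcome = "(int ^ 'd) \<times> ((int ^ 'd) \<times> nat \<Rightarrow> 'b)"

definition signal_law ::
    "'b measure \<Rightarrow> 'b measure \<Rightarrow> int ^ 'd::finite \<Rightarrow> ((int ^ 'd) \<times> nat \<Rightarrow> 'b) measure"
  where "signal_law Q\<^sub>0 Q\<^sub>1 v = PiM UNIV (\<lambda>(u, t). if ldist u v \<le> t then Q\<^sub>1 else Q\<^sub>0)"

definition cascade :: "'b measure \<Rightarrow> 'b measure \<Rightarrow> nat \<Rightarrow> ('d::finite, 'b) outcome measure"
  where "cascade Q\<^sub>0 Q\<^sub>1 n =
    measure_pmf (pmf_of_set (sources n)) \<bind>
      (\<lambda>v. distr (signal_law Q\<^sub>0 Q\<^sub>1 v) (count_space UNIV \<Otimes>\<^sub>M PiM UNIV (\<lambda>_. Q\<^sub>0)) (Pair v))"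

definition obs_filtration ::
    "'b measure \<Rightarrow> 'b measure \<Rightarrow> nat \<Rightarrow> nat \<Rightarrow> ('d::finite, 'b) outcome measure"
  where "obs_filtration Q\<^sub>0 Q\<^sub>1 n t =
    sigma (space (cascade Q\<^sub>0 Q\<^sub>1 n))
      {(\<lambda>(v, y). y (u, s)) -` A \<inter> space (cascade Q\<^sub>0 Q\<^sub>1 n) | u s A. s \<le> t \<and> A \<in> sets Q\<^sub>0}"

definition vhat ::
    "'b measure \<Rightarrow> 'b measure \<Rightarrow> nat \<Rightarrow> nat \<Rightarrow> ('d::finite, 'b) outcome \<Rightarrow> real ^ 'd"
  where "vhat Q\<^sub>0 Q\<^sub>1 n t \<omega> =
    (\<chi> i. real_cond_exp (cascade Q\<^sub>0 Q\<^sub>1 n) (obs_filtration Q\<^sub>0 Q\<^sub>1 n t)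
            (\<lambda>(v, y). embed v $ i) \<omega>)"

section \<open>Stopping times\<close>

text \<open>
  The conditional expectation with values in the extended reals. It is needed because
  \<open>real_cond_exp\<close> replaces an infinite conditional expectation by \<open>0\<close>, whereas the cost
  \<open>|N(T)|\<close> of a stopping time need not be integrable. It is only used for functions with
  bounded positive part, so that \<open>\<infinity> - \<infinity>\<close> does not occur (almost surely).
\<close>
definition ereal_cond_exp :: "'a measure \<Rightarrow> 'a measure \<Rightarrow> ('a \<Rightarrow> real) \<Rightarrow> 'a \<Rightarrow> ereal"
  where "ereal_cond_exp M F f \<omega> =
    enn2ereal (nn_cond_exp M F (\<lambda>\<omega>. ennreal (f \<omega>)) \<omega>)
      - enn2ereal (nn_cond_exp M F (\<lambda>\<omega>. ennreal (- f \<omega>)) \<omega>)"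

text \<open>The essential supremum of a family of random variables, unique up to null sets.\<close>
definition is_ess_sup :: "'a measure \<Rightarrow> ('a \<Rightarrow> ereal) set \<Rightarrow> ('a \<Rightarrow> ereal) \<Rightarrow> bool"
  where "is_ess_sup M \<X> Z \<longleftrightarrow>
    Z \<in> borel_measurable M \<and> (\<forall>X\<in>\<X>. AE \<omega> in M. X \<omega> \<le> Z \<omega>) \<and>
    (\<forall>Z'\<in>borel_measurable M. (\<forall>X\<in>\<X>. AE \<omega> in M. X \<omega> \<le> Z' \<omega>) \<longrightarrow> (AE \<omega> in M. Z \<omega> \<le> Z' \<omega>))"

definition ess_sup :: "'a measure \<Rightarrow> ('a \<Rightarrow> ereal) set \<Rightarrow> 'a \<Rightarrow> ereal"
  where "ess_sup M \<X> = (SOME Z. is_ess_sup M \<X> Z)"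

definition stopping_times ::
    "'b measure \<Rightarrow> 'b measure \<Rightarrow> nat \<Rightarrow> nat \<Rightarrow> (('d::finite, 'b) outcome \<Rightarrow> nat) set"
  where "stopping_times Q\<^sub>0 Q\<^sub>1 n s =
    {T. stopping_time (obs_filtration Q\<^sub>0 Q\<^sub>1 n) T \<and> (AE \<omega> in cascade Q\<^sub>0 Q\<^sub>1 n. s \<le> T \<omega>)}"

definition stop_gain ::
    "'b measure \<Rightarrow> 'b measure \<Rightarrow> nat \<Rightarrow> nat \<Rightarrow> (('d::finite, 'b) outcome \<Rightarrow> nat)
      \<Rightarrow> ('d, 'b) outcome \<Rightarrow> real"
  where "stop_gain Q\<^sub>0 Q\<^sub>1 n s T \<omega> =
    (norm (vhat Q\<^sub>0 Q\<^sub>1 n (T \<omega>) \<omega> - vhat Q\<^sub>0 Q\<^sub>1 n s \<omega>))\<^sup>2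
      - (real (ball_size TYPE('d) (T \<omega>)) - real (ball_size TYPE('d) s))"

text \<open>The minimum of an empty set of times is \<open>\<infinity>\<close>.\<close>

definition T_opt :: "'b measure \<Rightarrow> 'b measure \<Rightarrow> nat \<Rightarrow> ('d::finite, 'b) outcome \<Rightarrow> enat"
  where "T_opt Q\<^sub>0 Q\<^sub>1 n \<omega> =
    Inf {enat s | s.
      ess_sup (cascade Q\<^sub>0 Q\<^sub>1 n)
        {ereal_cond_exp (cascade Q\<^sub>0 Q\<^sub>1 n) (obs_filtration Q\<^sub>0 Q\<^sub>1 n s) (stop_gain Q\<^sub>0 Q\<^sub>1 n s T)
          | T. T \<in> stopping_times Q\<^sub>0 Q\<^sub>1 n s} \<omega> = 0}"

definition T_plus :: "'b measure \<Rightarrow> 'b measure \<Rightarrow> nat \<Rightarrow> ('d::finite, 'b) outcome \<Rightarrow> enat"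
  where "T_plus Q\<^sub>0 Q\<^sub>1 n \<omega> =
    Inf {enat s | s.
      real_cond_exp (cascade Q\<^sub>0 Q\<^sub>1 n) (obs_filtration Q\<^sub>0 Q\<^sub>1 n s)
        (\<lambda>(v, y). (norm (embed v - vhat Q\<^sub>0 Q\<^sub>1 n s (v, y)))\<^sup>2) \<omega>
      \<le> real (sphere_size TYPE('d) s)}"

definition source_prob ::
    "'b measure \<Rightarrow> 'b measure \<Rightarrow> nat \<Rightarrow> int ^ 'd::finite \<Rightarrow> (('d, 'b) outcome \<Rightarrow> bool) \<Rightarrow> real"
  where "source_prob Q\<^sub>0 Q\<^sub>1 n v E = \<P>(\<omega> in cascade Q\<^sub>0 Q\<^sub>1 n. E \<omega> \<bar> fst \<omega> = v)"

text \<open>The limit \<open>n \<rightarrow> \<infinity>\<close> along those \<open>n\<close> for which the \<open>d\<close>-th root of \<open>n\<close> is an integer.\<close>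
definition sizes_at_top :: "'d::finite itself \<Rightarrow> nat filter"
  where "sizes_at_top _ = inf at_top (principal {n. root CARD('d) (real n) \<in> \<nat>})"

end

theory Submission
  imports Defs
begin

text \<open>
  Let \<open>q = dQ\<^sub>1/dQ\<^sub>0\<close>. The posterior weight of \<open>u\<close> at time \<open>t\<close> is proportional to the product \<open>lik q t u\<close>
  of \<open>q\<close> over the signals in the space-time cone of \<open>u\<close>, which has \<open>growth t\<close> points; let \<open>pvar\<close> be the
  posterior variance. A martingale estimate shows that no stopping time gains anything once
  \<open>pvar\<close> is below the sphere size, so \<open>T_opt \<le> T_plus\<close> almost surely. It remains to bound \<open>T_plus\<close> from
  above and \<open>T_opt\<close> from below.

  Upper bound: under source \<open>v\<close> the expected square root of \<open>lik u / lik v\<close> is at most \<open>\<rho>\<close> to the number of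
  points in the cone of \<open>u\<close> but not of \<open>v\<close>, where \<open>\<rho> < 1\<close> is the Hellinger affinity of \<open>Q\<^sub>0\<close> and \<open>Q\<^sub>1\<close>.
  This number is at least \<open>t\<close> for every \<open>u \<noteq> v\<close> and of order \<open>growth t\<close> for distant \<open>u\<close>, so \<open>pvar \<le> 1\<close>
  as soon as \<open>growth t\<close> is a large multiple of \<open>ln n\<close>.

  Lower bound: while \<open>growth s\<close> is a small multiple of \<open>ln n\<close>, waiting for the deterministic time
  \<open>t = C ln n\<close> pays off: its cost is polylogarithmic and \<open>pvar\<close> becomes negligible, whereas
  \<open>pvar\<close> at time \<open>s\<close> is a power of \<open>n\<close>. Indeed two opposite boxes of side of order \<open>n\<^bsup>1/d\<^esup>\<close> contain many
  vertices all of whose signals have \<open>q \<ge> 1\<close>, and the finite divergence of \<open>Q\<^sub>1\<close> from \<open>Q\<^sub>0\<close> bounds the total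
  likelihood by \<open>n\<^bsup>1 + \<epsilon>\<^esup>\<close>, so both boxes have posterior mass at least a small negative power of \<open>n\<close>.
\<close>

section \<open>The lattice\<close>

text \<open>Two obstacles shape the argument. The claim concerns each fixed source, while the
  estimator, the conditional expectations and the essential supremum belong to the mixture over
  sources and are fixed only up to null sets. Each source has positive prior mass, so null sets
  survive the passage, but a probability bound loses a factor of order n. This is why the
  deterministic waiting time is a multiple of \<open>ln n\<close> itself: at the much shorter times
  where \<open>growth t\<close> is of order \<open>ln n\<close>, that is t of order
  \<open>(ln n)^(1/(d+1))\<close>, the bound on the expected posterior variance is not a negative
  power of n. At these short times \<rho> to the power t does not beat the number of sources either,
  so the upper bound works on two scales: a nearby rival is separated from the source by few
  signals, but such rivals are few and confusion with one of them costs little; a distant rival is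
  separated by a full cone. The assumption \<open>Q\<^sub>0 \<noteq> Q\<^sub>1\<close> enters
  through \<rho> < 1; the integrable entropy density controls large likelihoods in the lower
  bound.\<close>

lemma int_ldist: "int (ldist u v) = (\<Sum>i\<in>UNIV. \<bar>u $ i - v $ i\<bar>)"
  unfolding ldist_def by (simp add: sum_nonneg)

lemma ldist_self [simp]: "ldist u u = 0"
  by (simp add: ldist_def)

lemma ldist_commute: "ldist u v = ldist v u"
  by (simp add: ldist_def abs_minus_commute)

lemma ldist_triangle: "ldist u w \<le> ldist u v + ldist v w"
proof -
  have "int (ldist u w) \<le> int (ldist u v) + int (ldist v w)"
    unfolding int_ldist sum.distrib[symmetric]
    by (intro sum_mono) linarith
  then show ?thesis by linarith
qed

lemma ldist_diff: "ldist u v = ldist (u - v) 0"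
  by (simp add: ldist_def)

lemma coord_le_ldist: "\<bar>u $ i - v $ i\<bar> \<le> int (ldist u v)"
  unfolding int_ldist by (rule member_le_sum) auto

lemma ldist_eq_0_iff: "ldist u v = 0 \<longleftrightarrow> u = v"
proof
  assume "ldist u v = 0"
  then have "\<bar>u $ i - v $ i\<bar> \<le> 0" for i using coord_le_ldist[of u i v] by simp
  then show "u = v" by (simp add: vec_eq_iff)
qed simp

lemma norm_embed_diff_le: "norm (embed u - embed v) \<le> real (ldist u v)"
proof -
  have "norm (embed u - embed v) \<le> (\<Sum>i\<in>UNIV. \<bar>(embed u - embed v) $ i\<bar>)"
    by (rule norm_le_l1_cart)
  also have "\<dots> = real_of_int (int (ldist u v))"
    unfolding int_ldist by (simp add: embed_def)
  finally show ?thesis by simp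
qed

text \<open>\<open>vec_lambda\<close> identifies a coordinatewise box with the function space
  \<open>PiE UNIV A\<close>, whose cardinality is a product.\<close>

lemma card_vec_box:
  fixes A :: "'d::finite \<Rightarrow> 'a set"
  assumes "\<And>i. finite (A i)"
  shows "finite {w :: 'a ^ 'd. \<forall>i. w $ i \<in> A i}"
    and "card {w :: 'a ^ 'd. \<forall>i. w $ i \<in> A i} = (\<Prod>i\<in>UNIV. card (A i))"
proof -
  have bij: "bij_betw vec_lambda (PiE UNIV A) {w :: 'a ^ 'd. \<forall>i. w $ i \<in> A i}"
    by (rule bij_betw_byWitness[where f' = vec_nth]) (auto simp: PiE_UNIV_domain)
  show "finite {w :: 'a ^ 'd. \<forall>i. w $ i \<in> A i}"
    using bij_betw_finite[OF bij] assms by (simp add: finite_PiE)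
  show "card {w :: 'a ^ 'd. \<forall>i. w $ i \<in> A i} = (\<Prod>i\<in>UNIV. card (A i))"
    using bij_betw_same_card[OF bij] by (simp add: card_PiE)
qed

section \<open>Sizes of balls and spheres, and their growth\<close>

lemma nball_nat: "nball v (real t) = {u. ldist u v \<le> t}"
  by (simp add: nball_def)

lemma nball_subset_box: "{u. ldist u v \<le> t} \<subseteq> {w. \<forall>i. w $ i \<in> {v $ i - int t .. v $ i + int t}}"
proof clarify
  fix u i assume "ldist u v \<le> t"
  with coord_le_ldist[of u i v] have "\<bar>u $ i - v $ i\<bar> \<le> int t" by linarith
  then show "u $ i \<in> {v $ i - int t .. v $ i + int t}" by auto
qed

lemma finite_ldist_ball [simp]: "finite {u :: int ^ 'd::finite. ldist u v \<le> t}"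
  by (rule finite_subset[OF nball_subset_box]) (rule card_vec_box, simp)

lemma card_ldist_ball:
  "card {u :: int ^ 'd::finite. ldist u v \<le> t} = ball_size TYPE('d) t"
proof -
  have "bij_betw (\<lambda>u. u + v) {u. ldist u 0 \<le> t} {u :: int ^ 'd. ldist u v \<le> t}"
    by (rule bij_betw_byWitness[where f' = "\<lambda>u. u - v"])
       (auto simp: ldist_diff[of _ v])
  from bij_betw_same_card[OF this] show ?thesis
    by (simp add: ball_size_def nball_nat)
qed

lemma ball_size_le: "ball_size TYPE('d::finite) t \<le> (2 * t + 1) ^ CARD('d)"
proof -
  have "card {u :: int ^ 'd. ldist u 0 \<le> t}
      \<le> card {w :: int ^ 'd. \<forall>i. w $ i \<in> {(0 :: int ^ 'd) $ i - int t .. (0 :: int ^ 'd) $ i + int t}}"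
    by (intro card_mono nball_subset_box card_vec_box) simp
  also have "\<dots> = (2 * t + 1) ^ CARD('d)"
    by (subst card_vec_box) (simp_all add: nat_add_distrib mult_2 flip: of_nat_add)
  finally show ?thesis by (simp add: card_ldist_ball)
qed

lemma ball_size_ge: "(real (t + 1) / CARD('d)) ^ CARD('d) \<le> real (ball_size TYPE('d::finite) t)"
proof -
  \<comment> \<open>A cube with coordinates from 0 to b lies in the ball because its points have l1
    norm at most d * b, which is at most t.\<close>
  define b where "b = t div CARD('d)"
  let ?B = "{w :: int ^ 'd. \<forall>i. w $ i \<in> {0 .. int b}}"
  have "?B \<subseteq> {u. ldist u 0 \<le> t}"
  proof clarify
    fix w :: "int ^ 'd" assume w: "\<forall>i. w $ i \<in> {0 .. int b}"
    have "int (ldist w 0) \<le> (\<Sum>i\<in>(UNIV :: 'd set). int b)"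
      unfolding int_ldist using w by (intro sum_mono) auto
    also have "\<dots> = int (CARD('d) * b)" by simp
    also have "CARD('d) * b \<le> t" by (simp add: b_def)
    finally show "ldist w 0 \<le> t" by simp
  qed
  then have "card ?B \<le> ball_size TYPE('d) t"
    unfolding card_ldist_ball[of 0, symmetric] by (intro card_mono) simp_all
  moreover have "card ?B = (b + 1) ^ CARD('d)"
    by (subst card_vec_box) (simp_all add: nat_add_distrib)
  moreover have "real (t + 1) / CARD('d) \<le> real (b + 1)"
  proof -
    have "t < (b + 1) * CARD('d)"
      unfolding b_def by (metis add.commute dividend_less_div_times plus_1_eq_Suc times_nat.simps(2) zero_less_card_finite)
    then have "real (t + 1) \<le> real ((b + 1) * CARD('d))" by (subst of_nat_le_iff) linarith
    then show ?thesis by (simp add: divide_le_eq algebra_simps)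
  qed
  ultimately have "(real (t + 1) / CARD('d)) ^ CARD('d) \<le> real (b + 1) ^ CARD('d)"
    and "(b + 1) ^ CARD('d) \<le> ball_size TYPE('d) t"
    by (auto intro!: power_mono simp del: of_nat_add)
  moreover from this(2) have "real ((b + 1) ^ CARD('d)) \<le> real (ball_size TYPE('d) t)"
    by (subst of_nat_le_iff)
  ultimately show ?thesis by (simp only: of_nat_power)
qed

lemma ball_size_mono: "s \<le> t \<Longrightarrow> ball_size TYPE('d::finite) s \<le> ball_size TYPE('d) t"
  unfolding card_ldist_ball[of 0, symmetric] by (rule card_mono) auto

lemma ball_size_pos: "0 < ball_size TYPE('d::finite) t"
  unfolding card_ldist_ball[of 0, symmetric] by (subst card_gt_0_iff) (auto intro!: exI[of _ 0])

lemma growth_Suc: "growth D (Suc t) = growth D t + ball_size D (Suc t)"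
  by (simp add: growth_def)

lemma growth_mono: "s \<le> t \<Longrightarrow> growth D s \<le> growth D t"
  unfolding growth_def by (rule sum_mono2) auto

text \<open>Every ball contains its centre. This linear bound shows that the growth reaches every
  level, and it bounds the number of times up to a given growth.\<close>

lemma growth_ge_Suc: "Suc t \<le> growth TYPE('d::finite) t"
proof (induction t)
  case 0
  show ?case using ball_size_pos[where 'd='d, of 0] by (simp add: growth_def)
next
  case (Suc t)
  then show ?case using ball_size_pos[where 'd='d, of "Suc t"] by (simp add: growth_Suc)
qed

lemma growth_le: "real (growth TYPE('d::finite) t) \<le> (2 * real t + 1) ^ Suc CARD('d)"
proof -
  have "growth TYPE('d) t \<le> (\<Sum>s\<le>t. (2 * t + 1) ^ CARD('d))"
    unfolding growth_def
    by (intro sum_mono order.trans[OF ball_size_le] power_mono) auto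
  also have "\<dots> \<le> (2 * t + 1) * (2 * t + 1) ^ CARD('d)"
    by simp
  finally have "real (growth TYPE('d) t) \<le> real ((2 * t + 1) * (2 * t + 1) ^ CARD('d))"
    by (subst of_nat_le_iff)
  then show ?thesis by (simp add: algebra_simps)
qed

text \<open>A discrete derivative: summing it over x compares a sum of k-th powers with a power of
  exponent k + 1.\<close>

lemma power_Suc_diff_le:
  fixes x :: real assumes "0 \<le> x"
  shows "(x + 1) ^ Suc k - x ^ Suc k \<le> real (Suc k) * (x + 1) ^ k"
proof (induction k)
  case (Suc k)
  have "(x + 1) ^ Suc (Suc k) - x ^ Suc (Suc k) = (x + 1) ^ Suc k + x * ((x + 1) ^ Suc k - x ^ Suc k)"
    by (simp add: algebra_simps)
  also have "\<dots> \<le> (x + 1) ^ Suc k + x * (real (Suc k) * (x + 1) ^ k)"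
    using Suc assms by (intro add_left_mono mult_left_mono)
  also have "\<dots> \<le> (x + 1) ^ Suc k + (x + 1) * (real (Suc k) * (x + 1) ^ k)"
    using assms by (intro add_left_mono mult_right_mono) auto
  also have "\<dots> = real (Suc (Suc k)) * (x + 1) ^ Suc k"
    by (simp add: algebra_simps)
  finally show ?case .
qed simp

text \<open>Discrete integration of \<open>ball_size_ge\<close>: the factor d + 1 comes from summing
  d-th powers, the factor d^d from the cube inscribed in the ball. It turns an upper bound on the
  growth into one on the time.\<close>

lemma growth_ge:
  "(real t + 1) ^ Suc CARD('d) / (real (Suc CARD('d)) * real CARD('d) ^ CARD('d))
    \<le> real (growth TYPE('d::finite) t)"
proof -
  let ?d = "CARD('d)"
  have "(real t + 1) ^ Suc ?d / real (Suc ?d) \<le> real ?d ^ ?d * real (growth TYPE('d) t)"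
  proof (induction t)
    case 0
    have "1 / real (Suc ?d) \<le> 1" by simp
    also have "1 \<le> real ?d ^ ?d * real (growth TYPE('d) 0)"
    proof -
      have "1 \<le> CARD('d) ^ CARD('d) * growth TYPE('d) 0"
        using growth_ge_Suc[where 'd='d, of 0] by (simp add: Suc_le_eq)
      then have "real 1 \<le> real (CARD('d) ^ CARD('d) * growth TYPE('d) 0)"
        by (subst of_nat_le_iff)
      then show ?thesis by simp
    qed
    finally show ?case by simp
  next
    case (Suc t)
    have "(real (Suc t) + 1) ^ Suc ?d / real (Suc ?d)
        \<le> ((real (Suc t)) ^ Suc ?d + real (Suc ?d) * (real (Suc t) + 1) ^ ?d) / real (Suc ?d)"
      using power_Suc_diff_le[of "real (Suc t)" ?d] by (intro divide_right_mono) auto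
    also have "\<dots> = (real t + 1) ^ Suc ?d / real (Suc ?d) + (real (Suc t) + 1) ^ ?d"
      by (simp add: add_divide_distrib add.commute del: power_Suc)
    also have "\<dots> \<le> real ?d ^ ?d * real (growth TYPE('d) t)
        + real ?d ^ ?d * real (ball_size TYPE('d) (Suc t))"
      using ball_size_ge[where 'd='d, of "Suc t"]
      by (intro add_mono Suc) (simp add: power_divide divide_le_eq mult.commute)
    finally show ?case by (simp add: growth_Suc algebra_simps)
  qed
  then have "(real t + 1) ^ Suc ?d / real (Suc ?d) / real ?d ^ ?d \<le> real (growth TYPE('d) t)"
    by (subst pos_divide_le_eq) (simp_all add: mult.commute del: power_Suc)
  then show ?thesis by (simp only: divide_divide_eq_left)
qed

lemma ball_size_Suc: "ball_size TYPE('d::finite) (Suc t) = ball_size TYPE('d) t + sphere_size TYPE('d) (Suc t)"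
proof -
  have "{u :: int ^ 'd. ldist u 0 \<le> Suc t} = {u. ldist u 0 \<le> t} \<union> {u. ldist u 0 = Suc t}" by auto
  then have "card {u :: int ^ 'd. ldist u 0 \<le> Suc t} = card {u :: int ^ 'd. ldist u 0 \<le> t} + card {u :: int ^ 'd. ldist u 0 = Suc t}"
    by (simp, subst card_Un_disjoint) (auto intro: finite_subset[OF _ finite_ldist_ball[of 0 "Suc t"]])
  moreover have "nsphere (0 :: int ^ 'd) (real (Suc t)) = {u. ldist u 0 = Suc t}"
    by (simp only: nsphere_def of_nat_eq_iff)
  ultimately show ?thesis
    by (simp add: card_ldist_ball sphere_size_def del: of_nat_Suc)
qed

text \<open>A push by one unit along a fixed axis, away from the origin, maps each sphere into the
  next one. Vertices with coordinate 0 are all pushed to the positive side, so the map stays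
  injective.\<close>

lemma ldist_axis_push:
  fixes u :: "int ^ 'd::finite"
  defines "f \<equiv> \<lambda>i (u :: int ^ 'd). \<chi> j. if j = i then (if u $ i \<ge> 0 then u $ i + 1 else u $ i - 1) else u $ j"
  shows "ldist (f i u) 0 = Suc (ldist u 0)" and "inj (f i)"
proof -
  have "int (ldist (f i u) 0) = (\<Sum>j\<in>UNIV. \<bar>u $ j\<bar> + (if j = i then 1 else 0))"
    unfolding int_ldist f_def by (intro sum.cong) auto
  also have "\<dots> = int (ldist u 0) + 1" by (simp add: sum.distrib int_ldist)
  finally show "ldist (f i u) 0 = Suc (ldist u 0)" by simp
  show "inj (f i)"
  proof (rule injI)
    fix u v assume eq: "f i u = f i v"
    show "u = v" unfolding vec_eq_iff
    proof
      fix j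
      have "f i u $ j = f i v $ j" using eq by simp
      then show "u $ j = v $ j" by (auto simp: f_def split: if_splits)
    qed
  qed
qed

text \<open>The rule \<open>T_plus\<close> compares the variance with the sphere of the current
  radius, whereas one more step of waiting costs the sphere of the next radius; monotonicity bridges
  the two.\<close>

lemma sphere_size_mono_Suc: "sphere_size TYPE('d::finite) t \<le> sphere_size TYPE('d) (Suc t)"
proof -
  fix i :: 'd
  let ?f = "\<lambda>(u :: int ^ 'd). (\<chi> j. if j = i then (if u $ i \<ge> 0 then u $ i + 1 else u $ i - 1) else u $ j) :: int ^ 'd"
  have eq: "nsphere (0 :: int ^ 'd) (real t) = {u. ldist u 0 = t}" for t
    by (simp add: nsphere_def)
  show ?thesis unfolding sphere_size_def eq
    using ldist_axis_push[of i]
    by (intro card_inj_on_le[where f = ?f])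
       (auto intro: finite_subset[OF _ finite_ldist_ball[of 0 "Suc t"]] inj_on_subset)
qed

text \<open>Hence a posterior variance of at most 1 meets the threshold of \<open>T_plus\<close> at
  any time.\<close>

lemma sphere_size_ge_1: "1 \<le> sphere_size TYPE('d::finite) t"
proof (induction t)
  case 0
  have "nsphere (0 :: int ^ 'd) (real 0) = {0}"
    by (auto simp: nsphere_def ldist_eq_0_iff)
  then show ?case by (simp add: sphere_size_def)
next
  case (Suc t)
  then show ?case using sphere_size_mono_Suc[where 'd='d, of t] by linarith
qed

section \<open>Space-time cones and their differences\<close>

text \<open>The points up to time t whose signals have law \<open>Q\<^sub>1\<close> when v is the
  source.\<close>

definition cone :: "int ^ 'd \<Rightarrow> nat \<Rightarrow> ((int ^ 'd) \<times> nat) set"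
  where "cone v t = {(u, s). s \<le> t \<and> ldist u v \<le> s}"

lemma cone_eq_Sigma: "cone v t = (\<lambda>(s, u). (u, s)) ` (SIGMA s:{..t}. {u. ldist u v \<le> s})"
  by (force simp: cone_def)

lemma finite_cone [simp]: "finite (cone (v :: int ^ 'd::finite) t)"
  unfolding cone_eq_Sigma by (intro finite_imageI finite_SigmaI) auto

lemma card_cone: "card (cone (v :: int ^ 'd::finite) t) = growth TYPE('d) t"
  unfolding cone_eq_Sigma
  by (subst card_image) (auto simp: inj_on_def card_ldist_ball growth_def)

lemma cone_mono: "s \<le> t \<Longrightarrow> cone v s \<subseteq> cone v t"
  by (auto simp: cone_def)

text \<open>The first cone alone limits the time of a common point to t, so that both centres would
  be within t of its vertex; the height s of the second cone can be arbitrary.\<close>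

lemma cone_disjoint: "2 * t < ldist u v \<Longrightarrow> cone u t \<inter> cone v s = {}"
proof -
  assume *: "2 * t < ldist u v"
  have False if "ldist w u \<le> \<tau>" "ldist w v \<le> \<tau>" "\<tau> \<le> t" for w \<tau>
    using * that ldist_triangle[of u v w] by (simp add: ldist_commute)
  then show ?thesis by (auto simp: cone_def)
qed

text \<open>Walk from u along a coordinate in which u and v differ, in the direction leading away
  from v.\<close>

lemma ldist_push_away:
  fixes u v :: "int ^ 'd::finite"
  assumes "u \<noteq> v"
  obtains w where "ldist w u = t" "t < ldist w v"
proof -
  from assms obtain i where i: "u $ i \<noteq> v $ i" by (auto simp: vec_eq_iff)
  define e where "e = sgn (u $ i - v $ i)"
  define w where "w = (\<chi> j. if j = i then u $ i + e * int t else u $ j)"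
  have "int (ldist w u) = (\<Sum>j\<in>UNIV. if j = i then int t else 0)"
    unfolding int_ldist using i by (intro sum.cong) (auto simp: w_def e_def sgn_if)
  then have 1: "ldist w u = t" by simp
  have "int (ldist w v) = (\<Sum>j\<in>UNIV. \<bar>u $ j - v $ j\<bar> + (if j = i then int t else 0))"
    unfolding int_ldist using i by (intro sum.cong) (auto simp: w_def e_def sgn_if)
  also have "\<dots> = int (ldist u v + t)" by (simp add: sum.distrib int_ldist)
  finally have "ldist w v = ldist u v + t" by linarith
  moreover have "ldist u v > 0" using assms ldist_eq_0_iff[of u v] by auto
  ultimately show ?thesis using 1 that[of w] by simp
qed

text \<open>Each time slice contributes at least one boundary point. The bound holds for neighbours
  too, whose cones overlap almost entirely.\<close>

lemma card_cone_diff_ge: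
  fixes u v :: "int ^ 'd::finite"
  assumes "u \<noteq> v"
  shows "Suc t \<le> card (cone u t - cone v t)"
proof -
  have "\<forall>s. \<exists>w. ldist w u = s \<and> s < ldist w v"
    using ldist_push_away[OF assms] by metis
  then obtain w where w: "\<And>s. ldist (w s) u = s \<and> s < ldist (w s) v" by metis
  have "card ((\<lambda>s. (w s, s)) ` {..t}) \<le> card (cone u t - cone v t)"
  proof (rule card_mono)
    show "(\<lambda>s. (w s, s)) ` {..t} \<subseteq> cone u t - cone v t"
    proof clarify
      fix s assume "s \<le> t"
      then show "(w s, s) \<in> cone u t - cone v t"
        using w[of s] by (auto simp: cone_def)
    qed
  qed simp
  also have "card ((\<lambda>s. (w s, s)) ` {..t}) = Suc t"
    by (subst card_image) (auto simp: inj_on_def)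
  finally show ?thesis .
qed

text \<open>The sub-cone of u of height r is short enough to miss the cone of v altogether.\<close>

lemma card_cone_diff_ge_growth:
  fixes u v :: "int ^ 'd::finite"
  assumes "2 * r < ldist u v" "r \<le> t"
  shows "growth TYPE('d) r \<le> card (cone u t - cone v t)"
proof -
  have "card (cone u r) \<le> card (cone u t - cone v t)"
    using cone_disjoint[OF assms(1)] cone_mono[OF assms(2), of u]
    by (intro card_mono) auto
  then show ?thesis by (simp add: card_cone)
qed

section \<open>The set of possible sources\<close>

lemma finite_sources [simp]: "finite (sources n :: (int ^ 'd::finite) set)"
proof -
  have "(sources n :: (int ^ 'd) set) \<subseteq> {u. ldist u 0 \<le> nat \<lfloor>root CARD('d) (real n)\<rfloor>}"
    by (auto simp: sources_def nball_def le_nat_floor)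
  then show ?thesis by (rule finite_subset) simp
qed

lemma zero_in_sources: "0 \<in> (sources n :: (int ^ 'd::finite) set)"
  by (simp add: sources_def nball_def)

lemma sources_nonempty [simp]: "(sources n :: (int ^ 'd::finite) set) \<noteq> {}"
  using zero_in_sources by blast

lemma root_card_le: "1 \<le> n \<Longrightarrow> root CARD('d::finite) (real n) \<le> real n"
proof -
  assume "1 \<le> n"
  then have "real n \<le> real n ^ CARD('d)" by (intro self_le_power) auto
  then have "root CARD('d) (real n) \<le> root CARD('d) (real n ^ CARD('d))" by simp
  then show ?thesis by (simp add: real_root_power_cancel)
qed

lemma card_sources_le:
  assumes "1 \<le> n"
  shows "real (card (sources n :: (int ^ 'd::finite) set)) \<le> 3 ^ CARD('d) * real n"
proof -
  let ?r = "root CARD('d) (real n)"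
  have r1: "1 \<le> ?r" using assms by simp
  have "(sources n :: (int ^ 'd) set) \<subseteq> {u. ldist u 0 \<le> nat \<lfloor>?r\<rfloor>}"
    by (auto simp: sources_def nball_def le_nat_floor)
  then have "card (sources n :: (int ^ 'd) set) \<le> ball_size TYPE('d) (nat \<lfloor>?r\<rfloor>)"
    unfolding card_ldist_ball[of 0, symmetric] by (intro card_mono) auto
  also have "\<dots> \<le> (2 * nat \<lfloor>?r\<rfloor> + 1) ^ CARD('d)" by (rule ball_size_le)
  finally have "real (card (sources n :: (int ^ 'd) set)) \<le> real ((2 * nat \<lfloor>?r\<rfloor> + 1) ^ CARD('d))"
    by (subst of_nat_le_iff)
  also have "\<dots> = (2 * real (nat \<lfloor>?r\<rfloor>) + 1) ^ CARD('d)" by (simp add: add.commute)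
  also have "\<dots> \<le> (3 * ?r) ^ CARD('d)"
    using r1 by (intro power_mono) linarith+
  also have "\<dots> = 3 ^ CARD('d) * real n"
    by (simp add: power_mult_distrib)
  finally show ?thesis .
qed

text \<open>Replacing the root of n by n is harmless: any power of n will do, since the powers of
  \<rho> that must beat it are chosen afterwards.\<close>

lemma norm_embed_diff_sources:
  fixes u v :: "int ^ 'd::finite"
  assumes "u \<in> sources n" "v \<in> sources n" "1 \<le> n"
  shows "norm (embed u - embed v) \<le> 2 * real n"
proof -
  have "norm (embed u - embed v) \<le> real (ldist u 0 + ldist 0 v)"
    using norm_embed_diff_le[of u v] ldist_triangle[of u v 0] by linarith
  also have "\<dots> \<le> 2 * root CARD('d) (real n)"
    using assms by (simp add: sources_def nball_def ldist_commute)
  also have "\<dots> \<le> 2 * real n"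
    using root_card_le[where 'd='d, OF assms(3)] by simp
  finally show ?thesis .
qed

section \<open>Essential suprema, product densities and conditional expectations\<close>

text \<open>The classical exhaustion argument: among countable subfamilies, one maximises the
  expectation of a bounded increasing transform of the pointwise supremum, and its supremum is the
  essential one.\<close>

lemma is_ess_sup_exists:
  fixes \<X> :: "('a \<Rightarrow> ereal) set"
  assumes "prob_space M" and meas: "\<And>X. X \<in> \<X> \<Longrightarrow> X \<in> borel_measurable M"
  shows "\<exists>Z. is_ess_sup M \<X> Z"
proof -
  interpret prob_space M by fact
  \<comment> \<open>The arctangent compresses the extended reals into a bounded interval, which
    makes every supremum integrable; that \<phi> is strictly increasing is used to undo the
    compression.\<close>
  define \<phi> :: "ereal \<Rightarrow> real" where
    "\<phi> x = (if x = \<infinity> then pi / 2 else if x = - \<infinity> then - pi / 2 else arctan (real_of_ereal x))" for x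
  have \<phi>_less: "\<phi> x < \<phi> y" if "x < y" for x y
    using that arctan_ubound arctan_lbound by (cases x; cases y) (auto simp: \<phi>_def arctan_less_iff)
  have \<phi>_mono: "\<phi> x \<le> \<phi> y" if "x \<le> y" for x y
    using \<phi>_less[of x y] that by (cases "x = y") (auto simp: order.order_iff_strict)
  have \<phi>_bound: "\<bar>\<phi> x\<bar> \<le> pi / 2" for x
    using arctan_ubound[of "real_of_ereal x"] arctan_lbound[of "real_of_ereal x"] by (auto simp: \<phi>_def abs_le_iff)
  have arctan_meas: "arctan \<in> borel_measurable borel"
    by (intro borel_measurable_continuous_onI continuous_on_arctan continuous_on_id)
  have \<phi>_meas [measurable]: "\<phi> \<in> borel_measurable borel"
    unfolding \<phi>_def by (intro measurable_If measurable_compose[OF _ arctan_meas]) measurable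
  define S where "S C \<omega> = (SUP X\<in>C. X \<omega>)" for C :: "('a \<Rightarrow> ereal) set" and \<omega>
  define J where "J C = (\<integral>\<omega>. \<phi> (S C \<omega>) \<partial>M)" for C
  let ?F = "{C. countable C \<and> C \<subseteq> \<X>}"
  have S_meas: "S C \<in> borel_measurable M" if "C \<in> ?F" for C
    unfolding S_def using that meas by (intro borel_measurable_SUP) auto
  have S_int: "integrable M (\<lambda>\<omega>. \<phi> (S C \<omega>))" if "C \<in> ?F" for C
    using \<phi>_bound S_meas[OF that]
    by (intro integrable_const_bound[of _ "pi / 2"] AE_I2) auto
  have S_mono: "S C \<omega> \<le> S D \<omega>" if "C \<subseteq> D" for C D \<omega>
    unfolding S_def using that by (intro SUP_subset_mono) auto
  have J_mono: "J C \<le> J D" if "C \<in> ?F" "D \<in> ?F" "C \<subseteq> D" for C D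
    unfolding J_def using that by (intro integral_mono S_int \<phi>_mono S_mono)
  have J_le: "J C \<le> pi / 2" if "C \<in> ?F" for C
  proof -
    have "J C \<le> (\<integral>\<omega>. pi / 2 \<partial>M)"
      unfolding J_def using abs_le_D1[OF \<phi>_bound] by (intro integral_mono S_int that) auto
    then show ?thesis by (simp add: prob_space)
  qed
  then have bdd: "bdd_above (J ` ?F)" by (rule bdd_aboveI2)
  define \<alpha> where "\<alpha> = Sup (J ` ?F)"
  have "\<exists>C\<in>?F. \<alpha> - 1 / real (Suc k) < J C" for k
    using less_cSup_iff[of "J ` ?F" "\<alpha> - 1 / real (Suc k)"] bdd unfolding \<alpha>_def[symmetric] by auto
  then obtain C where C: "\<And>k. C k \<in> ?F" "\<And>k. \<alpha> - 1 / real (Suc k) < J (C k)" by metis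
  \<comment> \<open>The union of near-optimal countable families is countable and attains
    \<alpha>.\<close>
  define D where "D = (\<Union>k. C k)"
  have D: "D \<in> ?F" using C(1) by (auto simp: D_def)
  have "\<alpha> - 1 / real (Suc k) \<le> J D" for k
  proof -
    have "C k \<subseteq> D" by (auto simp: D_def)
    from J_mono[OF C(1) D this] C(2)[of k] show ?thesis by linarith
  qed
  note approx = this
  have "\<alpha> \<le> J D"
  proof (rule field_le_epsilon)
    fix e :: real assume "0 < e"
    then obtain k where "1 / real (Suc k) < e" by (rule nat_approx_posE)
    with approx[of k] show "\<alpha> \<le> J D + e" by linarith
  qed
  have ge: "AE \<omega> in M. X \<omega> \<le> S D \<omega>" if "X \<in> \<X>" for X
  proof -
    \<comment> \<open>Enlarging D by X cannot raise the maximum. Ordered functions with equal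
      integrals agree almost everywhere, so X exceeds the supremum over D only on a null
      set.\<close>
    have ins: "insert X D \<in> ?F" using D that by auto
    then have "J (insert X D) \<le> \<alpha>" unfolding \<alpha>_def by (intro cSup_upper bdd) auto
    with \<open>\<alpha> \<le> J D\<close> J_mono[OF D ins subset_insertI] have eq: "J D = J (insert X D)" by auto
    have "AE \<omega> in M. \<phi> (S D \<omega>) = \<phi> (S (insert X D) \<omega>)"
      using eq unfolding J_def
      by (intro integral_ineq_eq_0_then_AE S_int D ins AE_I2 \<phi>_mono S_mono) auto
    then show ?thesis
    proof eventually_elim
      case (elim \<omega>)
      have "X \<omega> \<le> S (insert X D) \<omega>" unfolding S_def by (rule SUP_upper) simp
      also have "\<dots> \<le> S D \<omega>" 
      proof (rule ccontr)
        assume "\<not> ?thesis"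
        then have "\<phi> (S D \<omega>) < \<phi> (S (insert X D) \<omega>)" by (intro \<phi>_less) simp
        with elim show False by simp
      qed
      finally show ?case .
    qed
  qed
  have "AE \<omega> in M. S D \<omega> \<le> Z' \<omega>"
    if "\<forall>X\<in>\<X>. AE \<omega> in M. X \<omega> \<le> Z' \<omega>" for Z' :: "'a \<Rightarrow> ereal"
  proof -
    have "AE \<omega> in M. \<forall>X\<in>D. X \<omega> \<le> Z' \<omega>"
      using D that by (subst AE_ball_countable) auto
    then show ?thesis by eventually_elim (auto simp: S_def intro: SUP_least)
  qed
  then show ?thesis using S_meas[OF D] ge unfolding is_ess_sup_def by blast
qed

lemma is_ess_sup_ess_sup:
  assumes "prob_space M" "\<And>X. X \<in> \<X> \<Longrightarrow> X \<in> borel_measurable M"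
  shows "is_ess_sup M \<X> (ess_sup M \<X>)"
  unfolding ess_sup_def using is_ess_sup_exists[OF assms] by (rule someI_ex)

section \<open>Infinite products with finitely many modified factors\<close>

lemma nn_integral_PiM_prod:
  assumes "\<And>i. prob_space (M i)" "finite J" "J \<subseteq> I"
    and [measurable]: "\<And>i. i \<in> J \<Longrightarrow> f i \<in> borel_measurable (M i)"
  shows "(\<integral>\<^sup>+ y. (\<Prod>i\<in>J. f i (y i)) \<partial>PiM I M) = (\<Prod>i\<in>J. \<integral>\<^sup>+ x. f i x \<partial>M i)"
proof -
  interpret P: product_prob_space M I
    by (intro product_prob_spaceI assms)
  have "(\<Prod>i\<in>J. \<integral>\<^sup>+ x. f i x \<partial>M i) = (\<integral>\<^sup>+ y. (\<Prod>i\<in>J. f i (y i)) \<partial>PiM J M)"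
    by (rule P.product_nn_integral_prod[symmetric]) (use assms in auto)
  also have "\<dots> = (\<integral>\<^sup>+ y. (\<Prod>i\<in>J. f i (y i)) \<partial>distr (PiM I M) (PiM J M) (\<lambda>x. restrict x J))"
    by (subst P.distr_PiM_restrict_finite) (use assms in auto)
  also have "\<dots> = (\<integral>\<^sup>+ y. (\<Prod>i\<in>J. f i (restrict y J i)) \<partial>PiM I M)"
    using assms by (subst nn_integral_distr) (auto intro!: measurable_restrict_subset)
  finally show ?thesis by simp
qed

text \<open>The product measure is determined by finite cylinders. On a cylinder over J the integral
  involves only the finitely many coordinates in \<open>S \<union> J\<close> and factorises.\<close>

lemma PiM_density:
  assumes M: "\<And>i. prob_space (M i)" and S: "finite S" "S \<subseteq> I"
    and g [measurable]: "\<And>i. g i \<in> borel_measurable (M i)"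
    and dens: "\<And>i. prob_space (density (M i) (g i))"
  shows "PiM I (\<lambda>i. if i \<in> S then density (M i) (g i) else M i) = density (PiM I M) (\<lambda>y. \<Prod>i\<in>S. g i (y i))"
proof -
  let ?N = "\<lambda>i. if i \<in> S then density (M i) (g i) else M i"
  interpret N: product_prob_space ?N I
    by (intro product_prob_spaceI) (use M dens in auto)
  have sets_eq: "sets (PiM I ?N) = sets (PiM I M)"
    by (intro sets_PiM_cong) auto
  have sets_i: "sets (?N i) = sets (M i)" for i by simp
  have space_i: "space (?N i) = space (M i)" for i by simp
  have gS [measurable]: "(\<lambda>y. \<Prod>i\<in>S. g i (y i)) \<in> borel_measurable (PiM I M)"
    using S by (intro borel_measurable_prod_ennreal measurable_compose[OF measurable_component_singleton[of _ I M] g]) auto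
  have "density (PiM I M) (\<lambda>y. \<Prod>i\<in>S. g i (y i)) = PiM I ?N"
  proof (rule N.PiM_eq)
    fix J F assume J: "finite J" "J \<subseteq> I" and F: "\<And>j. j \<in> J \<Longrightarrow> F j \<in> sets (?N j)"
    have F' [measurable]: "F j \<in> sets (M j)" if "j \<in> J" for j using F[OF that] sets_i by simp
    let ?A = "prod_emb I M J (Pi\<^sub>E J F)"
    have emb: "prod_emb I ?N J (Pi\<^sub>E J F) = ?A" by (simp add: prod_emb_def space_i cong: PiE_cong)
    have A: "?A \<in> sets (PiM I M)" using J F' by (intro sets_PiM_I) auto
    \<comment> \<open>Density and cylinder constraint are merged into one factor per coordinate,
      equal to 1 where neither applies.\<close>
    define h where "h i x = (if i \<in> S then g i x else 1) * (if i \<in> J then indicator (F i) x else 1)" for i x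
    have h_meas: "h i \<in> borel_measurable (M i)" for i unfolding h_def by (cases "i \<in> J"; cases "i \<in> S") auto
    have "emeasure (density (PiM I M) (\<lambda>y. \<Prod>i\<in>S. g i (y i))) ?A
        = (\<integral>\<^sup>+ y. (\<Prod>i\<in>S. g i (y i)) * indicator ?A y \<partial>PiM I M)"
      by (rule emeasure_density[OF gS A])
    also have "\<dots> = (\<integral>\<^sup>+ y. (\<Prod>i\<in>S \<union> J. h i (y i)) \<partial>PiM I M)"
    proof (rule nn_integral_cong)
      fix y assume y: "y \<in> space (PiM I M)"
      have "indicator ?A y = (\<Prod>i\<in>J. indicator (F i) (y i) :: ennreal)"
      proof (cases "\<forall>i\<in>J. y i \<in> F i")
        case True
        then show ?thesis using y J by (auto simp: prod_emb_def space_PiM PiE_iff)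
      next
        case False
        then obtain j where "j \<in> J" "y j \<notin> F j" by auto
        then have "(\<Prod>i\<in>J. indicator (F i) (y i) :: ennreal) = 0"
          using J by (intro prod_zero bexI[of _ j]) auto
        moreover have "y \<notin> ?A" using \<open>j \<in> J\<close> \<open>y j \<notin> F j\<close> by (auto simp: prod_emb_def PiE_iff)
        ultimately show ?thesis by simp
      qed
      moreover have "(\<Prod>i\<in>S \<union> J. (if i \<in> S then g i (y i) else 1)) = (\<Prod>i\<in>S. g i (y i))"
        using S J by (intro prod.mono_neutral_cong_right) auto
      moreover have "(\<Prod>i\<in>S \<union> J. (if i \<in> J then indicator (F i) (y i) else 1 :: ennreal)) = (\<Prod>i\<in>J. indicator (F i) (y i))"
        using S J by (intro prod.mono_neutral_cong_right) auto
      ultimately show "(\<Prod>i\<in>S. g i (y i)) * indicator ?A y = (\<Prod>i\<in>S \<union> J. h i (y i))"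
        by (simp add: h_def prod.distrib)
    qed
    also have "\<dots> = (\<Prod>i\<in>S \<union> J. \<integral>\<^sup>+ x. h i x \<partial>M i)"
      using S J by (intro nn_integral_PiM_prod M h_meas) auto
    also have "\<dots> = (\<Prod>i\<in>S \<union> J. if i \<in> J then emeasure (?N i) (F i) else 1)"
    proof (intro prod.cong refl)
      fix i assume i: "i \<in> S \<union> J"
      show "(\<integral>\<^sup>+ x. h i x \<partial>M i) = (if i \<in> J then emeasure (?N i) (F i) else 1)"
      proof (cases "i \<in> J")
        case True
        then show ?thesis unfolding h_def by (auto simp: emeasure_density F')
      next
        case False
        with i have "i \<in> S" by simp
        with False prob_space.emeasure_space_1[OF dens[of i]] show ?thesis unfolding h_def
          by (simp add: emeasure_density nn_set_integral_space)
      qed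
    qed
    also have "\<dots> = (\<Prod>j\<in>J. emeasure (?N j) (F j))"
      using S J by (intro prod.mono_neutral_cong_right) auto
    finally show "emeasure (density (PiM I M) (\<lambda>y. \<Prod>i\<in>S. g i (y i))) (prod_emb I ?N J (Pi\<^sub>E J F))
        = (\<Prod>j\<in>J. emeasure (?N j) (F j))"
      unfolding emb .
  qed (simp add: sets_eq)
  then show ?thesis by simp
qed

section \<open>Conditional expectations\<close>

context finite_measure_subalgebra
begin

lemma nn_cond_exp_finite:
  assumes "f \<in> borel_measurable M" "(\<integral>\<^sup>+ x. f x \<partial>M) < \<infinity>"
  shows "AE x in M. nn_cond_exp M F f x < \<infinity>"
proof -
  have "(\<integral>\<^sup>+ x. nn_cond_exp M F f x \<partial>M) = (\<integral>\<^sup>+ x. f x \<partial>M)"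
    using nn_cond_exp_intg[of "\<lambda>_. 1" f] assms by simp
  then have "AE x in M. nn_cond_exp M F f x \<noteq> \<infinity>"
    using assms by (intro nn_integral_PInf_AE) auto
  then show ?thesis by (simp add: less_top)
qed

lemma nn_cond_exp_parts_finite:
  assumes "integrable M f"
  shows "AE x in M. nn_cond_exp M F (\<lambda>x. ennreal (f x)) x < \<infinity> \<and> nn_cond_exp M F (\<lambda>x. ennreal (- f x)) x < \<infinity>"
proof -
  have [measurable]: "f \<in> borel_measurable M" using assms by auto
  have *: "integrable M (\<lambda>x. \<bar>f x\<bar>)" using assms by auto
  have "(\<integral>\<^sup>+ x. ennreal (f x) \<partial>M) \<le> (\<integral>\<^sup>+ x. ennreal \<bar>f x\<bar> \<partial>M)"
    "(\<integral>\<^sup>+ x. ennreal (- f x) \<partial>M) \<le> (\<integral>\<^sup>+ x. ennreal \<bar>f x\<bar> \<partial>M)"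
    by (intro nn_integral_mono ennreal_leI, simp)+
  moreover have "(\<integral>\<^sup>+ x. ennreal \<bar>f x\<bar> \<partial>M) < \<infinity>"
    using * by (simp add: nn_integral_eq_integral)
  ultimately show ?thesis
    by (intro AE_conjI nn_cond_exp_finite) auto
qed

lemma ereal_cond_exp_eq_real:
  assumes "integrable M f"
  shows "AE x in M. ereal_cond_exp M F f x = ereal (real_cond_exp M F f x)"
  using nn_cond_exp_parts_finite[OF assms]
proof eventually_elim
  case (elim x)
  then obtain a b where "nn_cond_exp M F (\<lambda>x. ennreal (f x)) x = ennreal a" "a \<ge> 0"
      "nn_cond_exp M F (\<lambda>x. ennreal (- f x)) x = ennreal b" "b \<ge> 0"
    by (metis ennreal_cases infinity_ennreal_def less_irrefl)
  then show ?case by (simp add: ereal_cond_exp_def real_cond_exp_def enn2ereal_ennreal)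
qed

text \<open>The hypothesis is tested on the event that the conditional expectation is
  positive.\<close>

lemma real_cond_exp_nonpos:
  assumes f: "integrable M f" and "\<And>C. C \<in> sets F \<Longrightarrow> (\<integral>x\<in>C. f x \<partial>M) \<le> 0"
  shows "AE x in M. real_cond_exp M F f x \<le> 0"
proof -
  let ?g = "real_cond_exp M F f"
  define C where "C = {x \<in> space F. ?g x > 0}"
  have C: "C \<in> sets F" unfolding C_def by measurable
  have CM [measurable]: "C \<in> sets M" using C subalg by (auto simp: subalgebra_def)
  have gint: "integrable M ?g" by (rule real_cond_exp_int[OF f])
  have int: "integrable M (\<lambda>x. indicator C x * ?g x)"
    using integrable_mult_indicator[OF CM gint] by simp
  have "(\<integral>x\<in>C. ?g x \<partial>M) \<le> 0"
    using real_cond_exp_intA[OF f C] assms(2)[OF C] by simp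
  then have "(\<integral>x. indicator C x * ?g x \<partial>M) \<le> 0" by (simp add: set_lebesgue_integral_def)
  moreover have nonneg: "0 \<le> indicator C x * ?g x" for x
    by (auto simp: C_def indicator_def)
  ultimately have "(\<integral>x. indicator C x * ?g x \<partial>M) = 0"
    by (intro antisym integral_nonneg_AE) auto
  then have "AE x in M. indicator C x * ?g x = 0"
    using integral_nonneg_eq_0_iff_AE[OF int] nonneg by auto
  then show ?thesis
    by (rule AE_mp) (use subalg in \<open>auto simp: C_def indicator_def subalgebra_def not_less split: if_splits intro!: AE_I2\<close>)
qed

text \<open>Here f may fail to be integrable, as the cost of a stopping time may have infinite mean.
  It suffices that an integrable majorant on A has nonpositive integrals; positive and negative
  parts are compared separately after multiplication by the indicator of A.\<close>

lemma ereal_cond_exp_nonpos: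
  assumes A: "A \<in> sets F" and f [measurable]: "f \<in> borel_measurable M" and f': "integrable M f'"
    and le: "AE x in M. x \<in> A \<longrightarrow> f x \<le> f' x"
    and int: "\<And>C. C \<in> sets F \<Longrightarrow> C \<subseteq> A \<Longrightarrow> (\<integral>x\<in>C. f' x \<partial>M) \<le> 0"
  shows "AE x in M. x \<in> A \<longrightarrow> ereal_cond_exp M F f x \<le> 0"
proof -
  let ?h = "\<lambda>x. indicator A x * f' x"
  have AM [measurable]: "A \<in> sets M" using A subalg by (auto simp: subalgebra_def)
  have [measurable]: "A \<in> sets F" by (rule A)
  have [measurable]: "f' \<in> borel_measurable M" using f' by auto
  have h: "integrable M ?h" using integrable_mult_indicator[OF AM f'] by simp
  have "(\<integral>x\<in>C. ?h x \<partial>M) \<le> 0" if "C \<in> sets F" for C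
  proof -
    have "(\<integral>x\<in>C. ?h x \<partial>M) = (\<integral>x\<in>C \<inter> A. f' x \<partial>M)"
      unfolding set_lebesgue_integral_def by (intro Bochner_Integration.integral_cong) (auto simp: indicator_def)
    also have "\<dots> \<le> 0" using int[of "C \<inter> A"] that A by auto
    finally show ?thesis .
  qed
  from real_cond_exp_nonpos[OF h this] have 1: "AE x in M. real_cond_exp M F ?h x \<le> 0" .
  have 2: "AE x in M. nn_cond_exp M F (\<lambda>x. ennreal (?h x)) x < \<infinity> \<and> nn_cond_exp M F (\<lambda>x. ennreal (- ?h x)) x < \<infinity>"
    by (rule nn_cond_exp_parts_finite[OF h])
  have 3: "AE x in M. indicator A x * nn_cond_exp M F (\<lambda>x. ennreal (f x)) x = nn_cond_exp M F (\<lambda>x. indicator A x * ennreal (f x)) x"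
    by (rule nn_cond_exp_prod) auto
  have 4: "AE x in M. indicator A x * nn_cond_exp M F (\<lambda>x. ennreal (- f x)) x = nn_cond_exp M F (\<lambda>x. indicator A x * ennreal (- f x)) x"
    by (rule nn_cond_exp_prod) auto
  have 5: "AE x in M. nn_cond_exp M F (\<lambda>x. indicator A x * ennreal (f x)) x \<le> nn_cond_exp M F (\<lambda>x. ennreal (?h x)) x"
  proof (rule nn_cond_exp_mono)
    show "AE x in M. indicator A x * ennreal (f x) \<le> ennreal (?h x)"
      using le by eventually_elim (auto simp: indicator_def intro: ennreal_leI)
  qed auto
  have 6: "AE x in M. nn_cond_exp M F (\<lambda>x. ennreal (- ?h x)) x \<le> nn_cond_exp M F (\<lambda>x. indicator A x * ennreal (- f x)) x"
  proof (rule nn_cond_exp_mono)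
    show "AE x in M. ennreal (- ?h x) \<le> indicator A x * ennreal (- f x)"
      using le by eventually_elim (auto simp: indicator_def intro: ennreal_leI)
  qed auto
  from 1 2 3 4 5 6 show ?thesis
  proof eventually_elim
    case (elim x)
    show ?case
    proof
      assume "x \<in> A"
      let ?p = "nn_cond_exp M F (\<lambda>x. ennreal (f x)) x" and ?n = "nn_cond_exp M F (\<lambda>x. ennreal (- f x)) x"
      let ?a = "nn_cond_exp M F (\<lambda>x. ennreal (?h x)) x" and ?b = "nn_cond_exp M F (\<lambda>x. ennreal (- ?h x)) x"
      have "?a \<le> ?b"
        using elim(1,2) by (simp add: real_cond_exp_def enn2real_le_iff less_top[symmetric] ennreal_enn2real_if)
           (metis enn2real_nonneg ennreal_enn2real ennreal_leI less_top)
      \<comment> \<open>On A the positive part lies below \<open>?a\<close> and the negative part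
        above \<open>?b\<close>. Finiteness of the positive part excludes the difference of two
        infinities.\<close>
      with elim \<open>x \<in> A\<close> have "?p \<le> ?n" "?p < \<infinity>" by auto
      then show "ereal_cond_exp M F f x \<le> 0"
        unfolding ereal_cond_exp_def
        by (cases ?p; cases ?n) (auto simp: enn2ereal_ennreal ennreal_le_iff)
    qed
  qed
qed

end

section \<open>The posterior distribution of the source\<close>

text \<open>The likelihood ratio of the source u against pure noise, given the signals up to time
  t.\<close>

definition lik :: "('b \<Rightarrow> real) \<Rightarrow> nat \<Rightarrow> int ^ 'd \<Rightarrow> ((int ^ 'd) \<times> nat \<Rightarrow> 'b) \<Rightarrow> real"
  where "lik q t u y = (\<Prod>i\<in>cone u t. q (y i))"

definition post :: "('b \<Rightarrow> real) \<Rightarrow> nat \<Rightarrow> nat \<Rightarrow> int ^ 'd::finite \<Rightarrow> ((int ^ 'd) \<times> nat \<Rightarrow> 'b) \<Rightarrow> real"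
  where "post q n t u y = lik q t u y / (\<Sum>u'\<in>sources n. lik q t u' y)"

definition pmean :: "('b \<Rightarrow> real) \<Rightarrow> nat \<Rightarrow> nat \<Rightarrow> ((int ^ 'd::finite) \<times> nat \<Rightarrow> 'b) \<Rightarrow> real ^ 'd"
  where "pmean q n t y = (\<Sum>u\<in>sources n. post q n t u y *\<^sub>R embed u)"

definition pvar :: "('b \<Rightarrow> real) \<Rightarrow> nat \<Rightarrow> nat \<Rightarrow> ((int ^ 'd::finite) \<times> nat \<Rightarrow> 'b) \<Rightarrow> real"
  where "pvar q n t y = (\<Sum>u\<in>sources n. post q n t u y * (norm (embed u - pmean q n t y))\<^sup>2)"

text \<open>The density is positive everywhere and not just almost everywhere, so likelihood
  quotients and posterior weights make sense at every outcome.\<close>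

locale signal_model =
  fixes Q\<^sub>0 Q\<^sub>1 :: "'b measure" and q :: "'b \<Rightarrow> real"
  assumes Q0: "prob_space Q\<^sub>0" and Q1: "prob_space Q\<^sub>1"
    and q_meas [measurable]: "q \<in> borel_measurable Q\<^sub>0"
    and q_pos: "\<And>x. 0 < q x"
    and Q1_eq: "Q\<^sub>1 = density Q\<^sub>0 (\<lambda>x. ennreal (q x))"
begin

abbreviation "fields \<equiv> PiM UNIV (\<lambda>_. Q\<^sub>0)"
abbreviation "law \<equiv> signal_law Q\<^sub>0 Q\<^sub>1"
abbreviation "joint \<equiv> cascade Q\<^sub>0 Q\<^sub>1"
abbreviation "obs \<equiv> obs_filtration Q\<^sub>0 Q\<^sub>1"

lemma sets_Q1 [measurable_cong]: "sets Q\<^sub>1 = sets Q\<^sub>0"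
  by (subst Q1_eq) simp

lemma prob_space_signal: "prob_space (law v)"
  unfolding signal_law_def by (intro prob_space_PiM) (auto simp: Q0 Q1)

lemma sets_signal [measurable_cong]: "sets (law v) = sets fields"
  unfolding signal_law_def by (intro sets_PiM_cong) (simp_all add: sets_Q1 split: prod.split)

lemma space_signal: "space (law v) = space fields"
  using sets_signal by (rule sets_eq_imp_space_eq)

lemma sets_cascade [measurable_cong]:
  "sets (joint n) = sets (count_space UNIV \<Otimes>\<^sub>M fields)"
  unfolding cascade_def by (subst sets_bind[where N = "count_space UNIV \<Otimes>\<^sub>M fields"]) auto

lemma space_cascade: "space (joint n) = UNIV \<times> space fields"
  using sets_eq_imp_space_eq[OF sets_cascade[of n]] by (simp add: space_pair_measure)

lemma measurable_Pair_signal [measurable]: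
  "Pair v \<in> law w \<rightarrow>\<^sub>M count_space UNIV \<Otimes>\<^sub>M fields"
  by measurable

lemma kernel_measurable:
  "(\<lambda>v. distr (law v) (count_space UNIV \<Otimes>\<^sub>M fields) (Pair v))
    \<in> measure_pmf p \<rightarrow>\<^sub>M subprob_algebra (count_space UNIV \<Otimes>\<^sub>M fields)"
  by (rule measurableI)
     (simp_all add: space_subprob_algebra prob_space_imp_subprob_space prob_space.prob_space_distr prob_space_signal)

lemma nn_integral_cascade:
  fixes f :: "('d::finite, 'b) outcome \<Rightarrow> ennreal"
  assumes [measurable]: "f \<in> borel_measurable (joint n)"
  shows "(\<integral>\<^sup>+ \<omega>. f \<omega> \<partial>joint n)
    = (\<Sum>v\<in>sources n. \<integral>\<^sup>+ y. f (v, y) \<partial>law v) / of_nat (card (sources n :: (int ^ 'd) set))"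
proof -
  have f [measurable]: "f \<in> borel_measurable (count_space UNIV \<Otimes>\<^sub>M fields)"
    using assms measurable_cong_sets[OF sets_cascade refl] by blast
  have "(\<integral>\<^sup>+ \<omega>. f \<omega> \<partial>joint n)
      = (\<integral>\<^sup>+ v. (\<integral>\<^sup>+ \<omega>. f \<omega> \<partial>distr (law v) (count_space UNIV \<Otimes>\<^sub>M fields) (Pair v))
          \<partial>measure_pmf (pmf_of_set (sources n)))"
    unfolding cascade_def by (rule nn_integral_bind[OF f kernel_measurable])
  also have "\<dots> = (\<integral>\<^sup>+ v. (\<integral>\<^sup>+ y. f (v, y) \<partial>law v) \<partial>measure_pmf (pmf_of_set (sources n)))"
    by (intro nn_integral_cong nn_integral_distr) measurable
  finally show ?thesis by (simp add: nn_integral_pmf_of_set)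
qed

lemma prob_space_cascade: "prob_space (joint n)"
  unfolding cascade_def
  by (intro measure_pmf.prob_space_bind[OF _ kernel_measurable] AE_I2 prob_space.prob_space_distr prob_space_signal)
     measurable

lemma card_sources_pos: "0 < card (sources n :: (int ^ 'd::finite) set)"
  by (simp add: card_gt_0_iff)

lemma emeasure_cascade_source:
  fixes v :: "int ^ 'd::finite"
  assumes v: "v \<in> sources n" and A [measurable]: "A \<in> sets (joint n)"
  shows "emeasure (joint n) {\<omega> \<in> A. fst \<omega> = v}
    = emeasure (law v) {y \<in> space fields. (v, y) \<in> A} / of_nat (card (sources n :: (int ^ 'd) set))"
proof -
  have A' [measurable]: "A \<in> sets (count_space UNIV \<Otimes>\<^sub>M fields)" using A sets_cascade by blast
  have ms: "{\<omega> \<in> A. fst \<omega> = v} \<in> sets (joint n)"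
  proof -
    have "{\<omega> \<in> A. fst \<omega> = v} = A \<inter> {\<omega> \<in> space (joint n). fst \<omega> \<in> {v}}"
      using sets.sets_into_space[OF A] by auto
    also have "\<dots> \<in> sets (joint n)" by measurable
    finally show ?thesis .
  qed
  have ys: "{y \<in> space fields. (v, y) \<in> A} \<in> sets (law v)"
    by measurable
  have "emeasure (joint n) {\<omega> \<in> A. fst \<omega> = v}
      = (\<integral>\<^sup>+ \<omega>. indicator {\<omega> \<in> A. fst \<omega> = v} \<omega> \<partial>joint n)"
    using ms by simp
  also have "\<dots> = (\<Sum>w\<in>sources n. \<integral>\<^sup>+ y. indicator {\<omega> \<in> A. fst \<omega> = v} (w, y) \<partial>law w)
      / of_nat (card (sources n :: (int ^ 'd) set))"
    using ms by (intro nn_integral_cascade) simp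
  also have "(\<Sum>w\<in>sources n. \<integral>\<^sup>+ y. indicator {\<omega> \<in> A. fst \<omega> = v} (w, y) \<partial>law w)
      = (\<Sum>w\<in>sources n. if w = v then emeasure (law v) {y \<in> space fields. (v, y) \<in> A} else 0)"
  proof (intro sum.cong refl)
    fix w
    show "(\<integral>\<^sup>+ y. indicator {\<omega> \<in> A. fst \<omega> = v} (w, y) \<partial>law w)
      = (if w = v then emeasure (law v) {y \<in> space fields. (v, y) \<in> A} else 0)"
    proof (cases "w = v")
      case True
      then have "(\<integral>\<^sup>+ y. indicator {\<omega> \<in> A. fst \<omega> = v} (w, y) \<partial>law w)
        = (\<integral>\<^sup>+ y. indicator {y \<in> space fields. (v, y) \<in> A} y \<partial>law v)"
        by (auto intro!: nn_integral_cong simp: indicator_def space_signal)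
      with True ys show ?thesis by simp
    next
      case False
      then show ?thesis by (simp add: indicator_def)
    qed
  qed
  also have "\<dots> = emeasure (law v) {y \<in> space fields. (v, y) \<in> A}"
    using v by simp
  finally show ?thesis .
qed

lemma measure_cascade_source:
  fixes v :: "int ^ 'd::finite"
  assumes v: "v \<in> sources n" and A: "A \<in> sets (joint n)"
  shows "measure (joint n) {\<omega> \<in> A. fst \<omega> = v}
    = measure (law v) {y \<in> space fields. (v, y) \<in> A} / real (card (sources n :: (int ^ 'd) set))"
proof -
  interpret K: prob_space "law v" by (rule prob_space_signal)
  have "emeasure (joint n) {\<omega> \<in> A. fst \<omega> = v} = ennreal
    (measure (law v) {y \<in> space fields. (v, y) \<in> A} / real (card (sources n :: (int ^ 'd) set)))"
    unfolding emeasure_cascade_source[OF assms] K.emeasure_eq_measure ennreal_of_nat_eq_real_of_nat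
    using card_sources_pos[where 'd='d, of n] by (intro divide_ennreal) auto
  then show ?thesis by (simp add: measure_def)
qed

text \<open>The conditioning event has probability one over the number of sources, so the elementary
  quotient applies and reduces the claim to the product law of v.\<close>

lemma source_prob_eq:
  fixes v :: "int ^ 'd::finite"
  assumes v: "v \<in> sources n" and E: "{\<omega> \<in> space (joint n). E \<omega>} \<in> sets (joint n)"
  shows "source_prob Q\<^sub>0 Q\<^sub>1 n v E = measure (law v) {y \<in> space fields. E (v, y)}"
proof -
  interpret K: prob_space "law v" by (rule prob_space_signal)
  let ?M = "joint n"
  have 1: "{\<omega> \<in> space ?M. E \<omega> \<and> fst \<omega> = v} = {\<omega> \<in> {\<omega> \<in> space ?M. E \<omega>}. fst \<omega> = v}" by auto
  have "measure ?M {\<omega> \<in> space ?M. fst \<omega> = v} = 1 / real (card (sources n :: (int ^ 'd) set))"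
    using measure_cascade_source[OF v sets.top] K.prob_space
    by (simp add: space_cascade space_signal)
  moreover have "measure ?M {\<omega> \<in> space ?M. E \<omega> \<and> fst \<omega> = v}
      = measure (law v) {y \<in> space fields. E (v, y)} / real (card (sources n :: (int ^ 'd) set))"
    unfolding 1 by (subst measure_cascade_source[OF v E]) (simp add: space_cascade)
  ultimately show ?thesis
    using card_sources_pos[where 'd='d, of n] by (simp add: source_prob_def cond_prob_def)
qed

text \<open>Each source carries positive prior mass, so a null set of the mixture has null sections.
  All almost sure facts about estimators and stopping times reach a fixed source this way.\<close>

lemma AE_cascade_source:
  fixes v :: "int ^ 'd::finite"
  assumes v: "v \<in> sources n" and P: "AE \<omega> in joint n. P \<omega>"
  shows "AE y in law v. P (v, y)"
proof -
  from P obtain N where N: "{\<omega> \<in> space (joint n). \<not> P \<omega>} \<subseteq> N"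
      "emeasure (joint n) N = 0" "N \<in> sets (joint n)"
    by (rule AE_E)
  have [measurable]: "N \<in> sets (count_space UNIV \<Otimes>\<^sub>M fields)" using N(3) sets_cascade by blast
  have "emeasure (joint n) {\<omega> \<in> N. fst \<omega> = v} \<le> emeasure (joint n) N"
    using N(3) by (intro emeasure_mono) auto
  then have "emeasure (law v) {y \<in> space fields. (v, y) \<in> N} = 0"
    using N(2) emeasure_cascade_source[OF v N(3)] by (simp add: ennreal_divide_eq_0_iff)
  moreover have "{y \<in> space fields. (v, y) \<in> N} \<in> sets (law v)" by measurable
  ultimately show ?thesis
    using N(1) by (intro AE_I[where N = "{y \<in> space fields. (v, y) \<in> N}"]) (auto simp: space_signal space_cascade)
qed

lemma AE_fst_sources: "AE \<omega> in joint n. fst \<omega> \<in> (sources n :: (int ^ 'd::finite) set)"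
proof -
  let ?N = "{\<omega> \<in> space (joint n). fst \<omega> \<in> - (sources n :: (int ^ 'd) set)}"
  have N [measurable]: "?N \<in> sets (joint n)" by measurable
  have "emeasure (joint n) ?N = (\<integral>\<^sup>+ \<omega>. indicator ?N \<omega> \<partial>joint n)" by simp
  also have "\<dots> = 0" by (subst nn_integral_cascade) (auto simp: indicator_def)
  finally show ?thesis by (intro AE_I[where N = ?N]) (auto simp: N)
qed

section \<open>Observable events and Bayes' formula\<close>

definition seen :: "nat \<Rightarrow> ('i \<times> nat) set" where "seen t = {i. snd i \<le> t}"

abbreviation "seen_fields t \<equiv> PiM (seen t) (\<lambda>_. Q\<^sub>0)"

lemma cone_seen: "cone v t \<subseteq> seen t" by (auto simp: cone_def seen_def)

lemma space_obs [simp]: "space (obs n t) = space (joint n)"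
  unfolding obs_filtration_def by (rule space_measure_of) auto

lemma sets_obs: "sets (obs n t) = sigma_sets (space (joint n))
   {(\<lambda>(v, y). y (u, s)) -` A \<inter> space (joint n) | u s A. s \<le> t \<and> A \<in> sets Q\<^sub>0}"
  unfolding obs_filtration_def by (rule sets_measure_of) auto

lemma subalgebra_obs: "subalgebra (joint n :: ('d::finite, 'b) outcome measure) (obs n t)"
  unfolding subalgebra_def sets_obs
proof (intro conjI space_obs sets.sigma_sets_subset, safe)
  fix u :: "int ^ 'd" and s :: nat and A assume [measurable]: "A \<in> sets Q\<^sub>0"
  have "(\<lambda>(v, y). y (u, s)) \<in> count_space UNIV \<Otimes>\<^sub>M fields \<rightarrow>\<^sub>M Q\<^sub>0" by measurable
  then have "(\<lambda>(v, y). y (u, s)) \<in> joint n \<rightarrow>\<^sub>M Q\<^sub>0"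
    using measurable_cong_sets[OF sets_cascade refl] by blast
  then show "(\<lambda>(v, y). y (u, s)) -` A \<inter> space (joint n) \<in> sets (joint n)"
    by (rule measurable_sets) fact
qed

lemma obs_mono: "s \<le> t \<Longrightarrow> sets (obs n s) \<subseteq> sets (obs n t)"
  unfolding sets_obs by (rule sigma_sets_mono') force

lemma measurable_obs_signal:
  assumes "i \<in> seen t"
  shows "(\<lambda>\<omega>. snd \<omega> i) \<in> obs n t \<rightarrow>\<^sub>M Q\<^sub>0"
proof (rule measurableI)
  show "snd \<omega> i \<in> space Q\<^sub>0" if "\<omega> \<in> space (obs n t)" for \<omega>
    using that by (auto simp: space_cascade space_PiM)
  fix A assume A: "A \<in> sets Q\<^sub>0"
  have "(\<lambda>\<omega>. snd \<omega> i) -` A \<inter> space (obs n t)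
      = (\<lambda>(v, y). y (fst i, snd i)) -` A \<inter> space (joint n)"
    by auto
  also have "\<dots> \<in> sets (obs n t)"
    unfolding sets_obs
  proof (rule sigma_sets.Basic, intro CollectI exI conjI)
    show "snd i \<le> t" using assms by (simp add: seen_def)
  qed (rule refl A)+
  finally show "(\<lambda>\<omega>. snd \<omega> i) -` A \<inter> space (obs n t) \<in> sets (obs n t)" .
qed

text \<open>The observable events are generated by the restriction map to the signals up to time t,
  hence they do not depend on the source coordinate of the outcome.\<close>

lemma obs_set_cylinder:
  fixes A :: "('d::finite, 'b) outcome set"
  assumes "A \<in> sets (obs n t)"
  obtains C where "C \<in> sets (seen_fields t)"
    "\<And>v y. y \<in> space fields \<Longrightarrow> (v, y) \<in> A \<longleftrightarrow> restrict y (seen t) \<in> C"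
proof -
  let ?r = "\<lambda>\<omega>. restrict (snd \<omega>) (seen t)"
  let ?\<Omega> = "space (joint n) :: ('d, 'b) outcome set"
  have r: "?r \<in> ?\<Omega> \<rightarrow> space (seen_fields t)"
    by (auto simp: space_cascade space_PiM)
  have "sigma_sets ?\<Omega> {(\<lambda>(v, y). y (u, s)) -` A \<inter> ?\<Omega> | u s A. s \<le> t \<and> A \<in> sets Q\<^sub>0}
      \<subseteq> sets (vimage_algebra ?\<Omega> ?r (seen_fields t))"
  proof (rule sets.sigma_sets_subset[where M = "vimage_algebra ?\<Omega> ?r (seen_fields t)", unfolded space_vimage_algebra], safe)
    fix u :: "int ^ 'd" and s A assume s: "s \<le> t" and A [measurable]: "A \<in> sets Q\<^sub>0"
    then have s': "(u, s) \<in> seen t" by (auto simp: seen_def)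
    have C: "(\<lambda>z. z (u, s)) -` A \<inter> space (seen_fields t) \<in> sets (seen_fields t)"
      using measurable_component_singleton[OF s', of "\<lambda>_. Q\<^sub>0"] A by (rule measurable_sets)
    have eq: "(\<lambda>(v, y). y (u, s)) -` A \<inter> ?\<Omega>
        = ?r -` ((\<lambda>z. z (u, s)) -` A \<inter> space (seen_fields t)) \<inter> ?\<Omega>"
      using r s' by auto
    show "(\<lambda>(v, y). y (u, s)) -` A \<inter> ?\<Omega> \<in> sets (vimage_algebra ?\<Omega> ?r (seen_fields t))"
      by (subst eq) (rule in_vimage_algebra[OF C])
  qed
  with assms have "A \<in> sets (vimage_algebra ?\<Omega> ?r (seen_fields t))"
    unfolding sets_obs by blast
  then obtain C where "C \<in> sets (seen_fields t)" "A = ?r -` C \<inter> ?\<Omega>"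
    unfolding sets_vimage_algebra2[OF r] by blast
  then show ?thesis using that[of C] by (auto simp: space_cascade)
qed

lemma prod_q_ennreal: "(\<Prod>i\<in>S. ennreal (q (y i))) = ennreal (\<Prod>i\<in>S. q (y i))"
  by (rule prod_ennreal) (auto intro: less_imp_le q_pos)

lemma lik_measurable_seen:
  "(\<lambda>z. lik q t u z) \<in> borel_measurable (seen_fields t)"
  unfolding lik_def using cone_seen[of u t]
  by (intro borel_measurable_prod measurable_compose[OF measurable_component_singleton[of _ "seen t" "\<lambda>_. Q\<^sub>0"] q_meas]) auto

text \<open>Infinitely many vertices are observed by time t, but the source changes the law of only
  finitely many signals, those in its cone; so a density with respect to pure noise exists.\<close>

lemma nn_integral_signal_seen:
  fixes v :: "int ^ 'd::finite"
  assumes f [measurable]: "f \<in> borel_measurable (seen_fields t)"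
  shows "(\<integral>\<^sup>+ y. f (restrict y (seen t)) \<partial>law v)
    = (\<integral>\<^sup>+ z. ennreal (lik q t v z) * f z \<partial>seen_fields t)"
proof -
  define K where "K = (\<lambda>i :: (int ^ 'd) \<times> nat. if ldist (fst i) v \<le> snd i then Q\<^sub>1 else Q\<^sub>0)"
  have law: "law v = PiM UNIV K"
    unfolding signal_law_def K_def by (intro arg_cong[where f = "PiM UNIV"]) auto
  have K: "prob_space (K i)" for i by (auto simp: K_def Q0 Q1)
  have sK: "sets (PiM (seen t) K) = sets (seen_fields t)"
    by (intro sets_PiM_cong) (auto simp: K_def sets_Q1)
  have [measurable]: "f \<in> borel_measurable (PiM (seen t) K)"
    using f measurable_cong_sets[OF sK refl] by blast
  have [measurable]: "(\<lambda>y. restrict y (seen t)) \<in> PiM UNIV K \<rightarrow>\<^sub>M PiM (seen t) K"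
    by (rule measurable_restrict_subset) simp
  have "(\<integral>\<^sup>+ y. f (restrict y (seen t)) \<partial>law v)
      = (\<integral>\<^sup>+ z. f z \<partial>distr (PiM UNIV K) (PiM (seen t) K) (\<lambda>y. restrict y (seen t)))"
    unfolding law by (subst nn_integral_distr) auto
  \<comment> \<open>The marginal on a subset of coordinates is a reindexing of the product along the
    inclusion.\<close>
  also have "distr (PiM UNIV K) (PiM (seen t) K) (\<lambda>y. restrict y (seen t)) = PiM (seen t) K"
    using distr_PiM_reindex[of UNIV K "\<lambda>i. i" "seen t"] K by (simp add: restrict_def)
  also have "PiM (seen t) K = PiM (seen t) (\<lambda>i. if i \<in> cone v t then density Q\<^sub>0 (\<lambda>x. ennreal (q x)) else Q\<^sub>0)"
    by (intro PiM_cong) (auto simp: K_def cone_def seen_def Q1_eq)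
  also have "\<dots> = density (seen_fields t) (\<lambda>z. \<Prod>i\<in>cone v t. ennreal (q (z i)))"
    by (rule PiM_density[OF Q0 finite_cone cone_seen]) (use Q1 Q1_eq in auto)
  also have "\<dots> = density (seen_fields t) (\<lambda>z. ennreal (lik q t v z))"
    by (simp add: prod_q_ennreal lik_def)
  finally show ?thesis
    using lik_measurable_seen[of t v] by (simp add: nn_integral_density restrict_def)
qed

lemma lik_pos: "0 < lik q t u y"
  unfolding lik_def by (intro prod_pos) (auto simp: q_pos)

lemma sum_lik_pos: "0 < (\<Sum>u\<in>sources n. lik q t (u :: int ^ 'd::finite) y)"
  by (intro sum_pos lik_pos) auto

lemma post_nonneg: "0 \<le> post q n t u y"
  unfolding post_def by (intro divide_nonneg_nonneg sum_nonneg less_imp_le lik_pos)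

lemma sum_post: "(\<Sum>u\<in>sources n. post q n t u y) = 1"
  unfolding post_def sum_divide_distrib[symmetric] using sum_lik_pos[of t y n] by simp

lemma post_le_1: "u \<in> sources n \<Longrightarrow> post q n t u y \<le> 1"
  using member_le_sum[of u "sources n" "\<lambda>u. post q n t u y"] by (simp add: post_nonneg sum_post)

lemma lik_restrict: "lik q t u (restrict y (seen t)) = lik q t u y"
  unfolding lik_def using cone_seen[of u t] by (intro prod.cong) auto

lemma post_restrict: "post q n t u (restrict y (seen t)) = post q n t u y"
  unfolding post_def lik_restrict ..

lemma lik_measurable_obs [measurable]:
  "(\<lambda>\<omega>. lik q t u (snd \<omega>)) \<in> borel_measurable (obs n t)"
  unfolding lik_def using cone_seen[of u t]
  by (intro borel_measurable_prod measurable_compose[OF measurable_obs_signal q_meas]) auto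

lemma post_measurable_obs [measurable]:
  "(\<lambda>\<omega>. post q n t u (snd \<omega>)) \<in> borel_measurable (obs n t)"
  unfolding post_def by measurable

lemma lik_measurable [measurable]:
  "(\<lambda>y. lik q t u y) \<in> borel_measurable fields"
  unfolding lik_def
  by (intro borel_measurable_prod measurable_compose[OF measurable_component_singleton[of _ UNIV "\<lambda>_. Q\<^sub>0"] q_meas]) auto

lemma post_measurable [measurable]: "(\<lambda>y. post q n t u y) \<in> borel_measurable fields"
  unfolding post_def by measurable

text \<open>Bayes' formula in integrated form. Written against the common noise measure, the sum
  over sources of the likelihoods cancels the denominator of \<open>post\<close> and leaves the
  likelihood of u.\<close>

lemma nn_integral_posterior:
  fixes u :: "int ^ 'd::finite"
  assumes u: "u \<in> sources n" and A: "A \<in> sets (obs n t)"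
  shows "(\<integral>\<^sup>+ \<omega>. ennreal (indicator A \<omega> * post q n t u (snd \<omega>)) \<partial>joint n)
    = (\<integral>\<^sup>+ \<omega>. ennreal (indicator A \<omega> * indicator {u} (fst \<omega>)) \<partial>joint n)"
proof -
  let ?S = "seen_fields t :: ((int ^ 'd) \<times> nat \<Rightarrow> 'b) measure"
  from A obtain C where C [measurable]: "C \<in> sets ?S"
    and AC: "\<And>v y. y \<in> space fields \<Longrightarrow> (v, y) \<in> A \<longleftrightarrow> restrict y (seen t) \<in> C"
    using obs_set_cylinder by blast
  have AM [measurable]: "A \<in> sets (joint n)"
    using A subalgebra_obs by (auto simp: subalgebra_def)
  have lS [measurable]: "lik q t v \<in> borel_measurable ?S" for v by (rule lik_measurable_seen)
  have pS [measurable]: "post q n t u \<in> borel_measurable ?S"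
    unfolding post_def by (intro borel_measurable_divide borel_measurable_sum lS)
  have iS: "(\<lambda>z. ennreal (indicator C z * post q n t u z)) \<in> borel_measurable ?S"
    by (intro measurable_compose[OF _ measurable_ennreal] borel_measurable_times borel_measurable_indicator C pS)
  define c where "c = (of_nat (card (sources n :: (int ^ 'd) set)) :: ennreal)"
  have "(\<integral>\<^sup>+ \<omega>. ennreal (indicator A \<omega> * post q n t u (snd \<omega>)) \<partial>joint n)
      = (\<Sum>v\<in>sources n. \<integral>\<^sup>+ y. ennreal (indicator A (v, y) * post q n t u y) \<partial>law v) / c"
    unfolding c_def by (subst nn_integral_cascade) auto
  also have "(\<Sum>v\<in>sources n. \<integral>\<^sup>+ y. ennreal (indicator A (v, y) * post q n t u y) \<partial>law v)
      = (\<Sum>v\<in>sources n. \<integral>\<^sup>+ z. ennreal (lik q t v z) * ennreal (indicator C z * post q n t u z) \<partial>?S)"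
  proof (intro sum.cong refl)
    fix v
    have "(\<integral>\<^sup>+ y. ennreal (indicator A (v, y) * post q n t u y) \<partial>law v)
      = (\<integral>\<^sup>+ y. ennreal (indicator C (restrict y (seen t)) * post q n t u (restrict y (seen t))) \<partial>law v)"
      by (intro nn_integral_cong) (auto simp: AC space_signal post_restrict indicator_def)
    also have "\<dots> = (\<integral>\<^sup>+ z. ennreal (lik q t v z) * ennreal (indicator C z * post q n t u z) \<partial>?S)"
      by (rule nn_integral_signal_seen[OF iS])
    finally show "(\<integral>\<^sup>+ y. ennreal (indicator A (v, y) * post q n t u y) \<partial>law v) = \<dots>" .
  qed
  also have "\<dots> = (\<integral>\<^sup>+ z. (\<Sum>v\<in>sources n. ennreal (lik q t v z) * ennreal (indicator C z * post q n t u z)) \<partial>?S)"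
    by (intro nn_integral_sum[symmetric] borel_measurable_times_ennreal iS measurable_compose[OF lS measurable_ennreal])
  also have "\<dots> = (\<integral>\<^sup>+ z. ennreal (lik q t u z) * indicator C z \<partial>?S)"
  proof (intro nn_integral_cong)
    fix z
    have "(\<Sum>v\<in>sources n. ennreal (lik q t v z) * ennreal (indicator C z * post q n t u z))
      = ennreal ((\<Sum>v\<in>sources n. lik q t v z) * (indicator C z * post q n t u z))"
      unfolding sum_distrib_right
      by (subst sum_ennreal[symmetric])
         (auto intro!: sum.cong mult_nonneg_nonneg post_nonneg simp: ennreal_mult' less_imp_le[OF lik_pos])
    also have "(\<Sum>v\<in>sources n. lik q t v z) * (indicator C z * post q n t u z) = lik q t u z * indicator C z"
      unfolding post_def using sum_lik_pos[of t z n] by simp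
    finally show "(\<Sum>v\<in>sources n. ennreal (lik q t v z) * ennreal (indicator C z * post q n t u z))
      = ennreal (lik q t u z) * indicator C z"
      by (auto simp: indicator_def)
  qed
  also have "\<dots> = (\<integral>\<^sup>+ y. indicator C (restrict y (seen t)) \<partial>law u)"
    by (intro nn_integral_signal_seen[symmetric] borel_measurable_indicator C)
  also have "\<dots> = (\<Sum>v\<in>sources n. if v = u then \<integral>\<^sup>+ y. indicator C (restrict y (seen t)) \<partial>law v else 0)"
    using u by simp
  also have "\<dots> = (\<Sum>v\<in>sources n. \<integral>\<^sup>+ y. ennreal (indicator A (v, y) * indicator {u} v) \<partial>law v)"
    by (intro sum.cong refl) (auto intro!: nn_integral_cong simp: AC space_signal indicator_def)
  also have "\<dots> / c = (\<integral>\<^sup>+ \<omega>. ennreal (indicator A \<omega> * indicator {u} (fst \<omega>)) \<partial>joint n)"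
    unfolding c_def by (subst nn_integral_cascade) auto
  finally show ?thesis .
qed

lemma finite_measure_subalgebra_obs:
  "finite_measure_subalgebra (joint n) (obs n t)"
  using prob_space.finite_measure[OF prob_space_cascade]
  by (intro finite_measure_subalgebra.intro subalgebra_obs finite_measure_subalgebra_axioms.intro)

lemma cond_exp_source:
  fixes u :: "int ^ 'd::finite"
  assumes u: "u \<in> sources n"
  shows "AE \<omega> in joint n. real_cond_exp (joint n) (obs n t)
    (\<lambda>\<omega>. indicator {u} (fst \<omega>)) \<omega> = post q n t u (snd \<omega>)"
proof -
  let ?M = "joint n :: ('d, 'b) outcome measure" and ?F = "obs n t :: ('d, 'b) outcome measure"
  interpret prob_space ?M by (rule prob_space_cascade)
  interpret F: finite_measure_subalgebra ?M ?F by (rule finite_measure_subalgebra_obs)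
  show ?thesis
  proof (rule F.real_cond_exp_charact)
    show "integrable ?M (\<lambda>\<omega>. indicator {u} (fst \<omega>) :: real)"
      by (intro integrable_const_bound[of _ 1]) auto
    show "integrable ?M (\<lambda>\<omega>. post q n t u (snd \<omega>))"
      using post_nonneg[of n t u] post_le_1[OF u]
      by (intro integrable_const_bound[of _ 1]) (auto intro: measurable_from_subalg[OF subalgebra_obs post_measurable_obs])
    fix A assume A: "A \<in> sets ?F"
    then have [measurable]: "A \<in> sets ?M" using subalgebra_obs by (auto simp: subalgebra_def)
    show "(\<integral>\<omega>\<in>A. indicator {u} (fst \<omega>) \<partial>?M) = (\<integral>\<omega>\<in>A. post q n t u (snd \<omega>) \<partial>?M)"
      unfolding set_lebesgue_integral_def
      by (subst (1 2) integral_eq_nn_integral)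
         (auto simp: nn_integral_posterior[OF u A] post_nonneg intro!: measurable_compose[OF measurable_snd post_measurable])
  qed (rule post_measurable_obs)
qed

text \<open>Split g according to the value of the source: each coefficient is observable and comes
  out of the conditional expectation, leaving the posterior weight. The coefficients may depend on
  the signals, as needed for distances to the posterior mean.\<close>

lemma cond_exp_posterior:
  fixes h :: "int ^ 'd::finite \<Rightarrow> ('d, 'b) outcome \<Rightarrow> real"
  assumes h: "\<And>u. u \<in> sources n \<Longrightarrow> h u \<in> borel_measurable (obs n t)"
    and bound: "\<And>u \<omega>. u \<in> sources n \<Longrightarrow> \<bar>h u \<omega>\<bar> \<le> B"
    and g: "g \<in> borel_measurable (joint n)"
    and eq: "AE \<omega> in joint n. g \<omega> = h (fst \<omega>) \<omega>"
  shows "AE \<omega> in joint n. real_cond_exp (joint n) (obs n t) g \<omega>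
    = (\<Sum>u\<in>sources n. h u \<omega> * post q n t u (snd \<omega>))"
proof -
  let ?M = "joint n :: ('d, 'b) outcome measure" and ?F = "obs n t :: ('d, 'b) outcome measure"
  interpret prob_space ?M by (rule prob_space_cascade)
  interpret F: finite_measure_subalgebra ?M ?F by (rule finite_measure_subalgebra_obs)
  \<comment> \<open>Extension by zero outside the sources makes measurability and bounds hold for
    every u.\<close>
  define k where "k u \<omega> = (if u \<in> sources n then h u \<omega> else 0)" for u \<omega>
  have kF: "k u \<in> borel_measurable ?F" for u using h unfolding k_def by (cases "u \<in> sources n") simp_all
  have kM [measurable]: "k u \<in> borel_measurable ?M" for u
    by (rule measurable_from_subalg[OF subalgebra_obs kF])
  have kB: "\<bar>k u \<omega>\<bar> \<le> \<bar>B\<bar>" for u \<omega> using bound[of u \<omega>] by (auto simp: k_def)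
  have int: "integrable ?M (\<lambda>\<omega>. k u \<omega> * indicator {u} (fst \<omega>))" for u
    using kB by (intro integrable_const_bound[of _ "\<bar>B\<bar>"]) (auto simp: indicator_def)
  have "AE \<omega> in ?M. g \<omega> = (\<Sum>u\<in>sources n. k u \<omega> * indicator {u} (fst \<omega>))"
    using eq AE_fst_sources[where 'd='d, of n]
    by eventually_elim (simp add: k_def indicator_def if_distrib cong: if_cong)
  then have 1: "AE \<omega> in ?M. real_cond_exp ?M ?F g \<omega> = real_cond_exp ?M ?F (\<lambda>\<omega>. \<Sum>u\<in>sources n. k u \<omega> * indicator {u} (fst \<omega>)) \<omega>"
    by (intro F.real_cond_exp_cong g) auto
  have 2: "AE \<omega> in ?M. real_cond_exp ?M ?F (\<lambda>\<omega>. \<Sum>u\<in>sources n. k u \<omega> * indicator {u} (fst \<omega>)) \<omega>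
      = (\<Sum>u\<in>sources n. real_cond_exp ?M ?F (\<lambda>\<omega>. k u \<omega> * indicator {u} (fst \<omega>)) \<omega>)"
    by (rule F.real_cond_exp_sum[OF int])
  have "AE \<omega> in ?M. \<forall>u\<in>sources n. real_cond_exp ?M ?F (\<lambda>\<omega>. k u \<omega> * indicator {u} (fst \<omega>)) \<omega> = h u \<omega> * post q n t u (snd \<omega>)"
  proof (rule AE_finite_allI)
    fix u :: "int ^ 'd" assume u: "u \<in> sources n"
    have "AE \<omega> in ?M. real_cond_exp ?M ?F (\<lambda>\<omega>. k u \<omega> * indicator {u} (fst \<omega>)) \<omega>
        = k u \<omega> * real_cond_exp ?M ?F (\<lambda>\<omega>. indicator {u} (fst \<omega>)) \<omega>"
      by (rule F.real_cond_exp_mult[OF kF _ int]) measurable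
    with cond_exp_source[OF u, of t] show "AE \<omega> in ?M. real_cond_exp ?M ?F (\<lambda>\<omega>. k u \<omega> * indicator {u} (fst \<omega>)) \<omega> = h u \<omega> * post q n t u (snd \<omega>)"
      by eventually_elim (simp add: k_def u)
  qed simp
  with 1 2 show ?thesis by eventually_elim simp
qed

end

section \<open>Posterior mean and variance\<close>

text \<open>The parallel axis identity: the cross term vanishes because m is the barycentre.\<close>

lemma weighted_variance_decomposition:
  fixes x :: "'i \<Rightarrow> 'a::real_inner"
  assumes "(\<Sum>i\<in>S. w i) = 1"
  defines "m \<equiv> (\<Sum>i\<in>S. w i *\<^sub>R x i)"
  shows "(\<Sum>i\<in>S. w i * (norm (x i - c))\<^sup>2) = (\<Sum>i\<in>S. w i * (norm (x i - m))\<^sup>2) + (norm (m - c))\<^sup>2"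
proof -
  have "(norm (x i - c))\<^sup>2 = (norm (x i - m))\<^sup>2 + 2 * ((x i - m) \<bullet> (m - c)) + (norm (m - c))\<^sup>2" for i
    unfolding power2_norm_eq_inner by (simp add: inner_diff_left inner_diff_right inner_commute algebra_simps)
  then have "(\<Sum>i\<in>S. w i * (norm (x i - c))\<^sup>2)
      = (\<Sum>i\<in>S. w i * (norm (x i - m))\<^sup>2) + 2 * (\<Sum>i\<in>S. w i * ((x i - m) \<bullet> (m - c)))
        + (\<Sum>i\<in>S. w i) * (norm (m - c))\<^sup>2"
    by (simp only: distrib_left sum.distrib sum_distrib_left sum_distrib_right mult.left_commute)
  also have "(\<Sum>i\<in>S. w i * ((x i - m) \<bullet> (m - c))) = (\<Sum>i\<in>S. w i *\<^sub>R (x i - m)) \<bullet> (m - c)"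
    by (simp add: inner_sum_left)
  also have "(\<Sum>i\<in>S. w i *\<^sub>R (x i - m)) = m - (\<Sum>i\<in>S. w i) *\<^sub>R m"
    by (simp add: scaleR_diff_right sum_subtractf m_def scaleR_sum_left)
  finally show ?thesis using assms(1) by simp
qed

lemma borel_measurable_sq_dist:
  fixes f g :: "'a \<Rightarrow> 'b::{real_normed_vector, second_countable_topology}"
  assumes [measurable]: "f \<in> borel_measurable M" "g \<in> borel_measurable M"
  shows "(\<lambda>x. (norm (f x - g x))\<^sup>2) \<in> borel_measurable M"
  by measurable

lemma borel_measurable_vec_lambda:
  fixes f :: "'d::finite \<Rightarrow> 'a \<Rightarrow> real"
  assumes "\<And>i. f i \<in> borel_measurable M"
  shows "(\<lambda>x. \<chi> i. f i x) \<in> borel_measurable M"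
proof (subst borel_measurable_euclidean_space, rule ballI)
  fix b :: "real ^ 'd" assume "b \<in> Basis"
  then obtain i where "b = axis i 1" by (auto simp: Basis_vec_def)
  then show "(\<lambda>x. (\<chi> i. f i x) \<bullet> b) \<in> borel_measurable M"
    using assms by (simp add: inner_axis)
qed

context signal_model
begin

lemma pvar_decomposition:
  "(\<Sum>u\<in>sources n. post q n t u y * (norm (embed u - c))\<^sup>2) = pvar q n t y + (norm (pmean q n t y - c))\<^sup>2"
  unfolding pvar_def pmean_def by (rule weighted_variance_decomposition[OF sum_post])

lemma pvar_nonneg: "0 \<le> pvar q n t y"
  unfolding pvar_def by (intro sum_nonneg mult_nonneg_nonneg post_nonneg) auto

text \<open>A crude bound for fixed n that serves only to make the random variables integrable; its
  size never enters an estimate.\<close>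

definition radius :: "'d::finite itself \<Rightarrow> nat \<Rightarrow> real"
  where "radius _ n = (\<Sum>u\<in>(sources n :: (int ^ 'd) set). norm (embed u))"

lemma norm_embed_le_radius: "u \<in> sources n \<Longrightarrow> norm (embed (u :: int ^ 'd::finite)) \<le> radius TYPE('d) n"
  unfolding radius_def by (rule member_le_sum) auto

lemma norm_pmean_le: "norm (pmean q n t y :: real ^ 'd::finite) \<le> radius TYPE('d) n"
proof -
  have "norm (pmean q n t y :: real ^ 'd) \<le> (\<Sum>u\<in>sources n. post q n t u y * radius TYPE('d) n)"
    unfolding pmean_def
    by (intro sum_norm_le) (auto simp: post_nonneg intro!: mult_left_mono norm_embed_le_radius)
  also have "\<dots> = radius TYPE('d) n" by (simp add: sum_distrib_right[symmetric] sum_post)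
  finally show ?thesis .
qed

lemma norm_diff_pmean_sq_le:
  assumes "norm (x :: real ^ 'd::finite) \<le> radius TYPE('d) n"
  shows "(norm (x - pmean q n t y))\<^sup>2 \<le> (2 * radius TYPE('d) n)\<^sup>2"
  using norm_triangle_ineq4[of x "pmean q n t y"] norm_pmean_le[of n t y] assms
  by (intro power_mono) auto

lemma pvar_le: "pvar q n t (y :: (int ^ 'd::finite) \<times> nat \<Rightarrow> 'b) \<le> (2 * radius TYPE('d) n)\<^sup>2"
proof -
  have "pvar q n t y \<le> (\<Sum>u\<in>sources n. post q n t u y * (2 * radius TYPE('d) n)\<^sup>2)"
    unfolding pvar_def
    by (intro sum_mono mult_left_mono norm_diff_pmean_sq_le norm_embed_le_radius post_nonneg)
  also have "\<dots> = (2 * radius TYPE('d) n)\<^sup>2" by (simp add: sum_distrib_right[symmetric] sum_post)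
  finally show ?thesis .
qed

lemma pmean_measurable_obs:
  "(\<lambda>\<omega>. pmean q n t (snd \<omega>)) \<in> borel_measurable (obs n t)"
  unfolding pmean_def by (intro borel_measurable_sum borel_measurable_scaleR post_measurable_obs) simp

lemma pvar_measurable_obs:
  "(\<lambda>\<omega>. pvar q n t (snd \<omega>)) \<in> borel_measurable (obs n t)"
  unfolding pvar_def
  by (intro borel_measurable_sum borel_measurable_times post_measurable_obs borel_measurable_sq_dist pmean_measurable_obs) simp

lemma pmean_measurable: "pmean q n t \<in> borel_measurable fields"
  unfolding pmean_def by (intro borel_measurable_sum borel_measurable_scaleR post_measurable) simp

lemma pvar_measurable: "pvar q n t \<in> borel_measurable fields"
  unfolding pvar_def
  by (intro borel_measurable_sum borel_measurable_times post_measurable borel_measurable_sq_dist pmean_measurable) simp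

lemmas pmean_measurable_cascade = measurable_from_subalg[OF subalgebra_obs pmean_measurable_obs]
lemmas pvar_measurable_cascade = measurable_from_subalg[OF subalgebra_obs pvar_measurable_obs]

lemma measurable_obs_mono:
  assumes "s \<le> t" "f \<in> borel_measurable (obs n s)"
  shows "f \<in> borel_measurable (obs n t)"
  by (rule measurable_from_subalg[OF _ assms(2)]) (simp add: subalgebra_def obs_mono[OF assms(1)])

text \<open>A single null set serves all times, so the identity may be used at a random
  time.\<close>

lemma vhat_eq_pmean:
  "AE \<omega> in joint n. \<forall>t. vhat Q\<^sub>0 Q\<^sub>1 n t \<omega> = (pmean q n t (snd \<omega>) :: real ^ 'd::finite)"
proof (subst AE_all_countable, rule allI)
  fix t
  let ?M = "joint n :: ('d, 'b) outcome measure"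
  have "AE \<omega> in ?M. \<forall>i. vhat Q\<^sub>0 Q\<^sub>1 n t \<omega> $ i = pmean q n t (snd \<omega>) $ i"
  proof (subst AE_all_countable, rule allI)
    fix i :: 'd
    have "AE \<omega> in ?M. real_cond_exp ?M (obs n t) (\<lambda>(v, y). embed v $ i) \<omega>
        = (\<Sum>u\<in>sources n. embed u $ i * post q n t u (snd \<omega>))"
    proof (rule cond_exp_posterior[where B = "radius TYPE('d) n"])
      show "\<bar>embed u $ i\<bar> \<le> radius TYPE('d) n" if "u \<in> sources n" for u :: "int ^ 'd"
        using component_le_norm_cart[of "embed u" i] norm_embed_le_radius[OF that] by linarith
      have "(\<lambda>\<omega>. embed (fst \<omega>) $ i) \<in> borel_measurable ?M"
        by (rule measurable_compose[where N = "count_space UNIV" and g = "\<lambda>u. embed u $ i"]) measurable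
      then show "(\<lambda>(v, y). embed v $ i) \<in> borel_measurable ?M" by (simp add: case_prod_beta')
    qed (auto simp: case_prod_beta')
    then show "AE \<omega> in ?M. vhat Q\<^sub>0 Q\<^sub>1 n t \<omega> $ i = pmean q n t (snd \<omega>) $ i"
      by eventually_elim (simp add: vhat_def pmean_def mult.commute)
  qed
  then show "AE \<omega> in ?M. vhat Q\<^sub>0 Q\<^sub>1 n t \<omega> = pmean q n t (snd \<omega>)"
    by eventually_elim (simp add: vec_eq_iff)
qed

lemma vhat_measurable: "vhat Q\<^sub>0 Q\<^sub>1 n t \<in> borel_measurable (joint n)"
  unfolding vhat_def
  by (intro borel_measurable_vec_lambda borel_measurable_cond_exp2)

lemma embed_fst_measurable: "(\<lambda>\<omega>. embed (fst \<omega>)) \<in> borel_measurable (joint n)"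
  by (rule measurable_compose[where N = "count_space UNIV" and g = embed]) measurable

text \<open>For s = t this identifies the posterior variance. For s < t, conditioning once more on
  time s yields the martingale identity: the expected squared move of the mean is the expected drop
  of the variance.\<close>

lemma cond_exp_sq_dist:
  assumes "s \<le> t"
  shows "AE \<omega> in joint n. real_cond_exp (joint n) (obs n t)
      (\<lambda>\<omega>. (norm (embed (fst \<omega> :: int ^ 'd::finite) - pmean q n s (snd \<omega>)))\<^sup>2) \<omega>
    = pvar q n t (snd \<omega>) + (norm (pmean q n t (snd \<omega>) - pmean q n s (snd \<omega>)))\<^sup>2"
proof -
  let ?M = "joint n :: ('d, 'b) outcome measure"
  have "AE \<omega> in ?M. real_cond_exp ?M (obs n t)
      (\<lambda>\<omega>. (norm (embed (fst \<omega>) - pmean q n s (snd \<omega>)))\<^sup>2) \<omega>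
    = (\<Sum>u\<in>sources n. (norm (embed u - pmean q n s (snd \<omega>)))\<^sup>2 * post q n t u (snd \<omega>))"
  proof (rule cond_exp_posterior[where B = "(2 * radius TYPE('d) n)\<^sup>2"])
    fix u :: "int ^ 'd" assume u: "u \<in> sources n"
    show "(\<lambda>\<omega>. (norm (embed u - pmean q n s (snd \<omega>)))\<^sup>2) \<in> borel_measurable (obs n t)"
      by (intro borel_measurable_sq_dist
          measurable_obs_mono[OF assms pmean_measurable_obs]) simp
    show "\<bar>(norm (embed u - pmean q n s (snd \<omega>)))\<^sup>2\<bar> \<le> (2 * radius TYPE('d) n)\<^sup>2" for \<omega> :: "('d, 'b) outcome"
      using norm_diff_pmean_sq_le[OF norm_embed_le_radius[OF u], of s "snd \<omega>"] by simp
  qed (auto intro!: borel_measurable_sq_dist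
      pmean_measurable_cascade embed_fst_measurable)
  then show ?thesis
    by eventually_elim (simp add: pvar_decomposition mult.commute)
qed

lemma cond_exp_vhat_error:
  "AE \<omega> in joint n. \<forall>s. real_cond_exp (joint n) (obs n s)
      (\<lambda>(v, y). (norm (embed (v :: int ^ 'd::finite) - vhat Q\<^sub>0 Q\<^sub>1 n s (v, y)))\<^sup>2) \<omega> = pvar q n s (snd \<omega>)"
proof (subst AE_all_countable, rule allI)
  fix s
  let ?M = "joint n :: ('d, 'b) outcome measure"
  interpret F: finite_measure_subalgebra ?M "obs n s" by (rule finite_measure_subalgebra_obs)
  have "AE \<omega> in ?M. real_cond_exp ?M (obs n s) (\<lambda>(v, y). (norm (embed v - vhat Q\<^sub>0 Q\<^sub>1 n s (v, y)))\<^sup>2) \<omega>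
      = real_cond_exp ?M (obs n s) (\<lambda>\<omega>. (norm (embed (fst \<omega>) - pmean q n s (snd \<omega>)))\<^sup>2) \<omega>"
    unfolding case_prod_beta' prod.collapse
  proof (rule F.real_cond_exp_cong)
    show "AE \<omega> in ?M. (norm (embed (fst \<omega>) - vhat Q\<^sub>0 Q\<^sub>1 n s \<omega>))\<^sup>2 = (norm (embed (fst \<omega>) - pmean q n s (snd \<omega>)))\<^sup>2"
      using vhat_eq_pmean[of n] by eventually_elim simp
  qed (intro borel_measurable_sq_dist
      pmean_measurable_cascade embed_fst_measurable vhat_measurable)+
  with cond_exp_sq_dist[OF order_refl, of n s]
  show "AE \<omega> in ?M. real_cond_exp ?M (obs n s) (\<lambda>(v, y). (norm (embed v - vhat Q\<^sub>0 Q\<^sub>1 n s (v, y)))\<^sup>2) \<omega>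
      = pvar q n s (snd \<omega>)"
    by eventually_elim simp
qed

section \<open>Stopped increments of the posterior mean\<close>

lemma stopping_time_level_obs:
  assumes "stopping_time (obs n) T"
  shows "{\<omega> \<in> space (joint n). T \<omega> = t} \<in> sets (obs n t)"
proof -
  have le: "{\<omega> \<in> space (joint n). T \<omega> \<le> s} \<in> sets (obs n s)" for s
    using stopping_timeD[OF assms, of s] by (simp add: pred_def)
  show ?thesis
  proof (cases t)
    case 0
    then show ?thesis using le[of 0] by simp
  next
    case (Suc s)
    have "{\<omega> \<in> space (joint n). T \<omega> = t}
        = {\<omega> \<in> space (joint n). T \<omega> \<le> t} - {\<omega> \<in> space (joint n). T \<omega> \<le> s}"
      using Suc by auto
    also have "\<dots> \<in> sets (obs n t)"
      using le[of t] le[of s] obs_mono[of s t n] Suc by auto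
    finally show ?thesis .
  qed
qed

lemma stopping_time_measurable:
  assumes "stopping_time (obs n) T"
  shows "T \<in> joint n \<rightarrow>\<^sub>M count_space UNIV"
proof (subst measurable_count_space_eq2_countable, safe)
  fix t
  have "T -` {t} \<inter> space (joint n) = {\<omega> \<in> space (joint n). T \<omega> = t}" by auto
  with stopping_time_level_obs[OF assms, of t] subalgebra_obs
  show "T -` {t} \<inter> space (joint n) \<in> sets (joint n)"
    by (auto simp: subalgebra_def)
qed auto

text \<open>Jensen's inequality on each level set of the stopping time replaces optional sampling.\<close>

lemma nn_integral_stopped_increment_le:
  fixes T :: "('d::finite, 'b) outcome \<Rightarrow> nat"
  assumes T: "stopping_time (obs n) T"
    and B: "B \<in> sets (obs n s)" and BT: "\<And>\<omega>. \<omega> \<in> B \<Longrightarrow> s \<le> T \<omega>"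
  shows "(\<integral>\<^sup>+ \<omega>. ennreal (indicator B \<omega> * (norm (pmean q n (T \<omega>) (snd \<omega>) - pmean q n s (snd \<omega>)))\<^sup>2) \<partial>joint n)
    \<le> (\<integral>\<^sup>+ \<omega>. ennreal (indicator B \<omega> * pvar q n s (snd \<omega>)) \<partial>joint n)"
proof -
  let ?M = "joint n :: ('d, 'b) outcome measure"
  let ?F = "obs n :: nat \<Rightarrow> ('d, 'b) outcome measure"
  interpret prob_space ?M by (rule prob_space_cascade)
  define W where "W \<omega> = (norm (embed (fst \<omega>) - pmean q n s (snd \<omega>)))\<^sup>2" for \<omega> :: "('d, 'b) outcome"
  define G where "G t \<omega> = (norm (pmean q n t (snd \<omega>) - pmean q n s (snd \<omega>)))\<^sup>2" for t and \<omega> :: "('d, 'b) outcome"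
  define L where "L t = B \<inter> {\<omega> \<in> space ?M. T \<omega> = t}" for t
  have WM: "W \<in> borel_measurable ?M"
    unfolding W_def by (intro borel_measurable_sq_dist
      pmean_measurable_cascade embed_fst_measurable)
  have Wb: "AE \<omega> in ?M. norm (W \<omega>) \<le> (2 * radius TYPE('d) n)\<^sup>2"
    using AE_fst_sources[where 'd='d, of n]
  proof eventually_elim
    case (elim \<omega>)
    from norm_diff_pmean_sq_le[OF norm_embed_le_radius[OF elim], of s "snd \<omega>"]
    show ?case by (simp add: W_def)
  qed
  have Wint: "integrable ?M W" using Wb WM by (rule integrable_const_bound)
  have W0: "0 \<le> W \<omega>" for \<omega> by (simp add: W_def)
  have GM: "G t \<in> borel_measurable ?M" for t
    unfolding G_def by (intro borel_measurable_sq_dist pmean_measurable_cascade)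
  have BM: "B \<in> sets ?M" using B subalgebra_obs by (auto simp: subalgebra_def)
  \<comment> \<open>Given the information at time t, the conditional mean of W is the variance plus
    G, hence at least G.\<close>
  have step: "(\<integral>\<^sup>+ \<omega>. ennreal (indicator C \<omega> * G t \<omega>) \<partial>?M) \<le> (\<integral>\<^sup>+ \<omega>. ennreal (indicator C \<omega> * W \<omega>) \<partial>?M)
     \<and> (\<integral>\<^sup>+ \<omega>. ennreal (indicator C \<omega> * W \<omega>) \<partial>?M) = (\<integral>\<^sup>+ \<omega>. ennreal (indicator C \<omega> * (pvar q n t (snd \<omega>) + G t \<omega>)) \<partial>?M)"
    if C: "C \<in> sets (?F t)" and "s \<le> t" for C t
  proof -
    interpret F: finite_measure_subalgebra ?M "?F t" by (rule finite_measure_subalgebra_obs)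
    have CM: "C \<in> sets ?M" using C subalgebra_obs by (auto simp: subalgebra_def)
    have "(\<integral>\<omega>\<in>C. W \<omega> \<partial>?M) = (\<integral>\<omega>\<in>C. real_cond_exp ?M (?F t) W \<omega> \<partial>?M)"
      by (rule F.real_cond_exp_intA[OF Wint C])
    also have "\<dots> = (\<integral>\<omega>\<in>C. pvar q n t (snd \<omega>) + G t \<omega> \<partial>?M)"
    proof (rule set_lebesgue_integral_cong_AE[OF CM])
      have "AE \<omega> in ?M. real_cond_exp ?M (?F t) W \<omega> = pvar q n t (snd \<omega>) + G t \<omega>"
        unfolding W_def G_def by (rule cond_exp_sq_dist[OF \<open>s \<le> t\<close>])
      then show "AE \<omega>\<in>C in ?M. real_cond_exp ?M (?F t) W \<omega> = pvar q n t (snd \<omega>) + G t \<omega>"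
        by eventually_elim simp
    qed (auto intro!: borel_measurable_add GM pvar_measurable_cascade borel_measurable_cond_exp2)
    finally have "(\<integral>\<omega>. indicator C \<omega> * W \<omega> \<partial>?M) = (\<integral>\<omega>. indicator C \<omega> * (pvar q n t (snd \<omega>) + G t \<omega>) \<partial>?M)"
      by (simp add: set_lebesgue_integral_def)
    moreover have "(\<integral>\<^sup>+ \<omega>. ennreal (indicator C \<omega> * W \<omega>) \<partial>?M) = ennreal (\<integral>\<omega>. indicator C \<omega> * W \<omega> \<partial>?M)"
      using integrable_mult_indicator[OF CM Wint] W0 by (intro nn_integral_eq_integral) auto
    moreover have "(\<integral>\<^sup>+ \<omega>. ennreal (indicator C \<omega> * (pvar q n t (snd \<omega>) + G t \<omega>)) \<partial>?M)
        = ennreal (\<integral>\<omega>. indicator C \<omega> * (pvar q n t (snd \<omega>) + G t \<omega>) \<partial>?M)"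
    proof (rule nn_integral_eq_integral)
      have "norm (pvar q n t (snd \<omega>) + G t \<omega>) \<le> (2 * radius TYPE('d) n)\<^sup>2 + (2 * radius TYPE('d) n)\<^sup>2" for \<omega>
        using pvar_nonneg[of n t "snd \<omega>"] pvar_le[of n t "snd \<omega>"] norm_diff_pmean_sq_le[OF norm_pmean_le[of n t "snd \<omega>"], of s "snd \<omega>"]
        by (simp add: G_def)
      then have "integrable ?M (\<lambda>\<omega>. pvar q n t (snd \<omega>) + G t \<omega>)"
        by (intro integrable_const_bound[where B = "(2 * radius TYPE('d) n)\<^sup>2 + (2 * radius TYPE('d) n)\<^sup>2"] AE_I2 borel_measurable_add GM pvar_measurable_cascade)
      from integrable_mult_indicator[OF CM this]
      show "integrable ?M (\<lambda>\<omega>. indicator C \<omega> * (pvar q n t (snd \<omega>) + G t \<omega>))" by simp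
    qed (auto simp: G_def pvar_nonneg)
    ultimately have eq: "(\<integral>\<^sup>+ \<omega>. ennreal (indicator C \<omega> * W \<omega>) \<partial>?M) = (\<integral>\<^sup>+ \<omega>. ennreal (indicator C \<omega> * (pvar q n t (snd \<omega>) + G t \<omega>)) \<partial>?M)"
      by simp
    show ?thesis
      by (intro conjI eq) (subst eq, auto intro!: nn_integral_mono ennreal_leI mult_left_mono simp: pvar_nonneg)
  qed
  have L: "L t \<in> sets (?F t)" if "s \<le> t" for t
    unfolding L_def using B obs_mono[OF that] stopping_time_level_obs[OF T] by (intro sets.Int) auto
  have LM: "L t \<in> sets ?M" for t
    unfolding L_def using BM stopping_time_level_obs[OF T, of t] subalgebra_obs[of n t]
    by (intro sets.Int) (auto simp: subalgebra_def)
  have L_empty: "L t = {}" if "t < s" for t using that by (force simp: L_def dest!: BT)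
  \<comment> \<open>The decomposition runs over all times as a series of nonnegative terms, so T
    need not be bounded.\<close>
  have decomp: "ennreal (indicator B \<omega> * f (T \<omega>)) = (\<Sum>t. ennreal (indicator (L t) \<omega> * f t))"
    if "\<omega> \<in> space ?M" for \<omega> and f :: "nat \<Rightarrow> real"
  proof -
    have "(\<Sum>t. ennreal (indicator (L t) \<omega> * f t)) = (\<Sum>t\<in>{T \<omega>}. ennreal (indicator (L t) \<omega> * f t))"
      by (rule suminf_finite) (auto simp: L_def)
    then show ?thesis using that by (simp add: L_def indicator_def)
  qed
  have "(\<integral>\<^sup>+ \<omega>. ennreal (indicator B \<omega> * G (T \<omega>) \<omega>) \<partial>?M) = (\<integral>\<^sup>+ \<omega>. (\<Sum>t. ennreal (indicator (L t) \<omega> * G t \<omega>)) \<partial>?M)"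
    by (intro nn_integral_cong decomp)
  also have "\<dots> = (\<Sum>t. \<integral>\<^sup>+ \<omega>. ennreal (indicator (L t) \<omega> * G t \<omega>) \<partial>?M)"
    by (intro nn_integral_suminf measurable_compose[OF _ measurable_ennreal] borel_measurable_times GM borel_measurable_indicator LM)
  also have "\<dots> \<le> (\<Sum>t. \<integral>\<^sup>+ \<omega>. ennreal (indicator (L t) \<omega> * W \<omega>) \<partial>?M)"
  proof (intro suminf_le)
    fix t
    show "(\<integral>\<^sup>+ \<omega>. ennreal (indicator (L t) \<omega> * G t \<omega>) \<partial>?M) \<le> (\<integral>\<^sup>+ \<omega>. ennreal (indicator (L t) \<omega> * W \<omega>) \<partial>?M)"
    proof (cases "s \<le> t")
      case True
      from step[OF L[OF True] True] show ?thesis by (rule conjunct1)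
    next
      case False
      then show ?thesis using L_empty[of t] by simp
    qed
  qed auto
  also have "\<dots> = (\<integral>\<^sup>+ \<omega>. (\<Sum>t. ennreal (indicator (L t) \<omega> * W \<omega>)) \<partial>?M)"
    by (intro nn_integral_suminf[symmetric] measurable_compose[OF _ measurable_ennreal] borel_measurable_times WM borel_measurable_indicator LM)
  also have "\<dots> = (\<integral>\<^sup>+ \<omega>. ennreal (indicator B \<omega> * W \<omega>) \<partial>?M)"
    by (intro nn_integral_cong decomp[symmetric])
  \<comment> \<open>W does not involve the stopping time, so the level sets recombine; conditioning
    at time s turns W into the variance, because \<open>G s\<close> is 0.\<close>
  also have "\<dots> = (\<integral>\<^sup>+ \<omega>. ennreal (indicator B \<omega> * (pvar q n s (snd \<omega>) + G s \<omega>)) \<partial>?M)"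
    using step[OF B order_refl] by (rule conjunct2)
  finally show ?thesis by (simp add: G_def)
qed

end

section \<open>The two stopping times\<close>

context signal_model
begin

definition opt_value :: "nat \<Rightarrow> nat \<Rightarrow> ('d::finite, 'b) outcome \<Rightarrow> ereal"
  where "opt_value n s = ess_sup (joint n)
    {ereal_cond_exp (joint n) (obs n s) (stop_gain Q\<^sub>0 Q\<^sub>1 n s T)
      | T. T \<in> stopping_times Q\<^sub>0 Q\<^sub>1 n s}"

lemma T_opt_eq: "T_opt Q\<^sub>0 Q\<^sub>1 n \<omega> = Inf {enat s | s. opt_value n s \<omega> = 0}"
  unfolding T_opt_def opt_value_def ..

lemma ereal_cond_exp_measurable: "ereal_cond_exp M F f \<in> borel_measurable M"
  unfolding ereal_cond_exp_def by measurable

lemma is_ess_sup_opt_value: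
  "is_ess_sup (joint n)
    {ereal_cond_exp (joint n) (obs n s) (stop_gain Q\<^sub>0 Q\<^sub>1 n s T)
      | T. T \<in> stopping_times Q\<^sub>0 Q\<^sub>1 n s} (opt_value n s)"
  unfolding opt_value_def
  by (rule is_ess_sup_ess_sup[OF prob_space_cascade]) (auto intro: ereal_cond_exp_measurable)

lemma opt_value_measurable [measurable]: "opt_value n s \<in> borel_measurable (joint n)"
  using is_ess_sup_opt_value unfolding is_ess_sup_def by blast

lemma opt_value_ge:
  "T \<in> stopping_times Q\<^sub>0 Q\<^sub>1 n s \<Longrightarrow> AE \<omega> in joint n.
    ereal_cond_exp (joint n) (obs n s) (stop_gain Q\<^sub>0 Q\<^sub>1 n s T) \<omega> \<le> opt_value n s \<omega>"
  using is_ess_sup_opt_value[of n s] unfolding is_ess_sup_def by blast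

lemma const_stopping_time: "s \<le> t \<Longrightarrow> (\<lambda>_. t) \<in> stopping_times Q\<^sub>0 Q\<^sub>1 n s"
  by (simp add: stopping_times_def stopping_time_const)

lemma stop_gain_measurable:
  fixes T :: "('d::finite, 'b) outcome \<Rightarrow> nat"
  assumes "T \<in> stopping_times Q\<^sub>0 Q\<^sub>1 n s"
  shows "stop_gain Q\<^sub>0 Q\<^sub>1 n s T \<in> borel_measurable (joint n)"
proof -
  have T: "T \<in> joint n \<rightarrow>\<^sub>M count_space UNIV"
    using assms by (intro stopping_time_measurable) (simp add: stopping_times_def)
  have a: "(\<lambda>\<omega>. vhat Q\<^sub>0 Q\<^sub>1 n (T \<omega>) \<omega>) \<in> borel_measurable (joint n)"
    by (rule measurable_compose_countable[OF vhat_measurable T])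
  have b: "(\<lambda>\<omega>. real (ball_size TYPE('d) (T \<omega>))) \<in> borel_measurable (joint n)"
    by (rule measurable_compose[OF T, of "\<lambda>t. real (ball_size TYPE('d) t)"]) simp
  show ?thesis
    unfolding stop_gain_def[abs_def]
    by (intro borel_measurable_diff borel_measurable_sq_dist vhat_measurable borel_measurable_const a b)
qed

text \<open>The value of waiting until t: the expected drop of the posterior variance, by the
  martingale identity, minus the cost of the additional ball.\<close>

lemma opt_value_deterministic_ge:
  assumes "s \<le> t"
  shows "AE \<omega> in joint n. ereal (pvar q n s (snd \<omega>)
      - real_cond_exp (joint n) (obs n s) (\<lambda>\<omega>. pvar q n t (snd \<omega>)) \<omega>
      - (real (ball_size TYPE('d::finite) t) - real (ball_size TYPE('d) s)))
    \<le> opt_value n s (\<omega> :: ('d, 'b) outcome)"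
proof -
  let ?M = "joint n :: ('d, 'b) outcome measure"
  let ?F = "obs n :: nat \<Rightarrow> ('d, 'b) outcome measure"
  let ?R = "(2 * radius TYPE('d) n)\<^sup>2"
  define c where "c = real (ball_size TYPE('d) t) - real (ball_size TYPE('d) s)"
  define G where "G \<omega> = (norm (pmean q n t (snd \<omega>) - pmean q n s (snd \<omega>)))\<^sup>2" for \<omega> :: "('d, 'b) outcome"
  define W where "W \<omega> = (norm (embed (fst \<omega>) - pmean q n s (snd \<omega>)))\<^sup>2" for \<omega> :: "('d, 'b) outcome"
  interpret prob_space ?M by (rule prob_space_cascade)
  interpret F: finite_measure_subalgebra ?M "?F s" by (rule finite_measure_subalgebra_obs)
  have GM: "G \<in> borel_measurable ?M"
    unfolding G_def by (intro borel_measurable_sq_dist pmean_measurable_cascade)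
  have Gint: "integrable ?M G"
    using norm_diff_pmean_sq_le[OF norm_pmean_le]
    by (intro integrable_const_bound[where B = ?R] GM AE_I2) (auto simp: G_def)
  have Vint: "integrable ?M (\<lambda>\<omega>. pvar q n t (snd \<omega>))"
  proof (intro integrable_const_bound[where B = ?R] pvar_measurable_cascade AE_I2)
    show "norm (pvar q n t (snd \<omega>)) \<le> ?R" for \<omega> :: "('d, 'b) outcome"
      using pvar_nonneg[of n t "snd \<omega>"] pvar_le[of n t "snd \<omega>"] by simp
  qed
  have WM: "W \<in> borel_measurable ?M"
    unfolding W_def by (intro borel_measurable_sq_dist pmean_measurable_cascade embed_fst_measurable)
  have Wint: "integrable ?M W"
  proof (rule integrable_const_bound[where B = ?R, OF _ WM])
    show "AE \<omega> in ?M. norm (W \<omega>) \<le> ?R"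
      using AE_fst_sources[where 'd='d, of n]
    proof eventually_elim
      case (elim \<omega>)
      from norm_diff_pmean_sq_le[OF norm_embed_le_radius[OF elim], of s "snd \<omega>"]
      show ?case by (simp add: W_def)
    qed
  qed
  have sub: "subalgebra (?F t) (?F s)" using obs_mono[OF assms] by (simp add: subalgebra_def)
  have 1: "AE \<omega> in ?M. real_cond_exp ?M (?F s) (real_cond_exp ?M (?F t) W) \<omega> = real_cond_exp ?M (?F s) W \<omega>"
    by (rule F.real_cond_exp_nested_subalg[OF subalgebra_obs sub Wint])
  have 2: "AE \<omega> in ?M. real_cond_exp ?M (?F s) (real_cond_exp ?M (?F t) W) \<omega>
      = real_cond_exp ?M (?F s) (\<lambda>\<omega>. pvar q n t (snd \<omega>) + G \<omega>) \<omega>"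
    using cond_exp_sq_dist[OF assms, of n]
    by (intro F.real_cond_exp_cong borel_measurable_add pvar_measurable_cascade GM borel_measurable_cond_exp2)
       (simp add: W_def[abs_def] G_def)
  have 3: "AE \<omega> in ?M. real_cond_exp ?M (?F s) (\<lambda>\<omega>. pvar q n t (snd \<omega>) + G \<omega>) \<omega>
      = real_cond_exp ?M (?F s) (\<lambda>\<omega>. pvar q n t (snd \<omega>)) \<omega> + real_cond_exp ?M (?F s) G \<omega>"
    by (rule F.real_cond_exp_add[OF Vint Gint])
  have 4: "AE \<omega> in ?M. real_cond_exp ?M (?F s) W \<omega> = pvar q n s (snd \<omega>)"
    using cond_exp_sq_dist[OF order_refl, of n s] by (simp add: W_def[abs_def])
  have 5: "AE \<omega> in ?M. real_cond_exp ?M (?F s) (\<lambda>\<omega>. G \<omega> - c) \<omega> = real_cond_exp ?M (?F s) G \<omega> - real_cond_exp ?M (?F s) (\<lambda>_. c) \<omega>"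
    by (rule F.real_cond_exp_diff[OF Gint]) simp
  have 6: "AE \<omega> in ?M. real_cond_exp ?M (?F s) (\<lambda>_. c) \<omega> = c"
    by (rule F.real_cond_exp_F_meas) auto
  have gM: "stop_gain Q\<^sub>0 Q\<^sub>1 n s (\<lambda>_. t) \<in> borel_measurable ?M"
    by (rule stop_gain_measurable[OF const_stopping_time[OF assms]])
  have 7: "AE \<omega> in ?M. stop_gain Q\<^sub>0 Q\<^sub>1 n s (\<lambda>_. t) \<omega> = G \<omega> - c"
    using vhat_eq_pmean[of n] by eventually_elim (simp add: stop_gain_def G_def c_def)
  have gint: "integrable ?M (stop_gain Q\<^sub>0 Q\<^sub>1 n s (\<lambda>_. t))"
    using 7 by (subst integrable_cong_AE[where g = "\<lambda>\<omega>. G \<omega> - c"]) (auto intro!: gM GM Gint borel_measurable_diff)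
  have 8: "AE \<omega> in ?M. real_cond_exp ?M (?F s) (stop_gain Q\<^sub>0 Q\<^sub>1 n s (\<lambda>_. t)) \<omega> = real_cond_exp ?M (?F s) (\<lambda>\<omega>. G \<omega> - c) \<omega>"
    using 7 gM GM by (intro F.real_cond_exp_cong borel_measurable_diff) auto
  from 1 2 3 4 5 6 8 F.ereal_cond_exp_eq_real[OF gint] opt_value_ge[OF const_stopping_time[OF assms, where n=n and 'a='d]]
  show ?thesis
  proof eventually_elim
    case (elim \<omega>)
    have "pvar q n s (snd \<omega>) - real_cond_exp ?M (?F s) (\<lambda>\<omega>. pvar q n t (snd \<omega>)) \<omega> - c
        = real_cond_exp ?M (?F s) (stop_gain Q\<^sub>0 Q\<^sub>1 n s (\<lambda>_. t)) \<omega>"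
      using elim(1-7) by simp
    with elim(8,9) show ?case unfolding c_def[symmetric] by simp
  qed
qed

text \<open>Stopping at once is admissible and has gain 0.\<close>

lemma opt_value_nonneg: "AE \<omega> in joint n. 0 \<le> opt_value n s (\<omega> :: ('d::finite, 'b) outcome)"
proof -
  let ?M = "joint n :: ('d, 'b) outcome measure"
  interpret F: finite_measure_subalgebra ?M "obs n s" by (rule finite_measure_subalgebra_obs)
  have "AE \<omega> in ?M. 0 = nn_cond_exp ?M (obs n s) (\<lambda>_. 0) \<omega>"
    by (rule F.nn_cond_exp_F_meas) auto
  with opt_value_ge[OF const_stopping_time[OF order_refl[of s], where n=n and 'a='d]]
  show ?thesis
    by eventually_elim (simp add: stop_gain_def[abs_def] ereal_cond_exp_def zero_ennreal.rep_eq)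
qed

text \<open>Whoever continues pays at least the next sphere, while the expected squared move of the
  mean is at most the current variance. With \<open>opt_value_nonneg\<close> the value is exactly 0
  on this event.\<close>

lemma opt_value_nonpos:
  "AE \<omega> in joint n. pvar q n s (snd \<omega>) \<le> real (sphere_size TYPE('d::finite) s)
    \<longrightarrow> opt_value n s (\<omega> :: ('d, 'b) outcome) \<le> 0"
proof -
  let ?M = "joint n :: ('d, 'b) outcome measure"
  let ?F = "obs n :: nat \<Rightarrow> ('d, 'b) outcome measure"
  let ?R = "(2 * radius TYPE('d) n)\<^sup>2"
  interpret prob_space ?M by (rule prob_space_cascade)
  interpret F: finite_measure_subalgebra ?M "?F s" by (rule finite_measure_subalgebra_obs)
  define A where "A = {\<omega> \<in> space ?M. pvar q n s (snd \<omega>) \<le> real (sphere_size TYPE('d) s)}"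
  have A: "A \<in> sets (?F s)"
    using borel_measurable_le[OF pvar_measurable_obs[of n s] borel_measurable_const, of "real (sphere_size TYPE('d) s)"]
    by (simp add: A_def)
  have AM: "A \<in> sets ?M" using A subalgebra_obs by (auto simp: subalgebra_def)
  define \<sigma> where "\<sigma> = real (sphere_size TYPE('d) (Suc s))"
  have \<sigma>: "real (sphere_size TYPE('d) s) \<le> \<sigma>" "0 \<le> \<sigma>"
    using sphere_size_mono_Suc[where 'd='d, of s] by (simp_all add: \<sigma>_def)
  have X: "AE \<omega> in ?M. \<omega> \<in> A \<longrightarrow> ereal_cond_exp ?M (?F s) (stop_gain Q\<^sub>0 Q\<^sub>1 n s T) \<omega> \<le> 0"
    if T: "T \<in> stopping_times Q\<^sub>0 Q\<^sub>1 n s" for T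
  proof -
    from T have st: "stopping_time ?F T" and ge: "AE \<omega> in ?M. s \<le> T \<omega>" by (auto simp: stopping_times_def)
    have TM: "T \<in> ?M \<rightarrow>\<^sub>M count_space UNIV" by (rule stopping_time_measurable[OF st])
    define G where "G \<omega> = (norm (pmean q n (T \<omega>) (snd \<omega>) - pmean q n s (snd \<omega>)))\<^sup>2" for \<omega> :: "('d, 'b) outcome"
    define E where "E = {\<omega> \<in> space ?M. s < T \<omega>}"
    \<comment> \<open>The true cost is replaced by its least value \<sigma>, which keeps the
      majorant integrable. The event E of continuing is already decided at time s.\<close>
    define f' where "f' \<omega> = indicator E \<omega> * (G \<omega> - \<sigma>)" for \<omega>
    have EF: "E \<in> sets (?F s)"
      using stopping_timeD2[OF st, of s] by (simp add: E_def pred_def)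
    have EM: "E \<in> sets ?M" using EF subalgebra_obs by (auto simp: subalgebra_def)
    have GM: "G \<in> borel_measurable ?M"
      unfolding G_def
      by (intro borel_measurable_sq_dist measurable_compose_countable[OF pmean_measurable_cascade TM] pmean_measurable_cascade)
    have Gint: "integrable ?M G"
      using norm_diff_pmean_sq_le[OF norm_pmean_le]
      by (intro integrable_const_bound[where B = ?R] GM AE_I2) (auto simp: G_def)
    have f'int: "integrable ?M f'"
      using integrable_mult_indicator[OF EM, of "\<lambda>\<omega>. G \<omega> - \<sigma>"] Gint by (simp add: f'_def[abs_def])
    show ?thesis
    proof (rule F.ereal_cond_exp_nonpos[OF A stop_gain_measurable[OF T] f'int])
      show "AE \<omega> in ?M. \<omega> \<in> A \<longrightarrow> stop_gain Q\<^sub>0 Q\<^sub>1 n s T \<omega> \<le> f' \<omega>"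
        using ge vhat_eq_pmean[of n]
      proof (eventually_elim, intro impI)
        case (elim \<omega>)
        assume "\<omega> \<in> A"
        then have \<omega>: "\<omega> \<in> space ?M" by (simp add: A_def)
        show "stop_gain Q\<^sub>0 Q\<^sub>1 n s T \<omega> \<le> f' \<omega>"
        proof (cases "T \<omega> = s")
          case True
          then show ?thesis by (simp add: stop_gain_def f'_def E_def)
        next
          case False
          with elim(1) have "Suc s \<le> T \<omega>" by simp
          from ball_size_mono[OF this, where 'd='d] have "\<sigma> \<le> real (ball_size TYPE('d) (T \<omega>)) - real (ball_size TYPE('d) s)"
            by (simp add: \<sigma>_def ball_size_Suc)
          moreover have "\<omega> \<in> E" using \<omega> \<open>Suc s \<le> T \<omega>\<close> by (simp add: E_def)
          ultimately show ?thesis using elim(2) by (simp add: stop_gain_def f'_def G_def)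
        qed
      qed
      fix C assume C: "C \<in> sets (?F s)" "C \<subseteq> A"
      define B where "B = C \<inter> E"
      have B: "B \<in> sets (?F s)" using C EF by (auto simp: B_def)
      have BM: "B \<in> sets ?M" using B subalgebra_obs by (auto simp: subalgebra_def)
      have "(\<integral>\<^sup>+ \<omega>. ennreal (indicator B \<omega> * G \<omega>) \<partial>?M) \<le> (\<integral>\<^sup>+ \<omega>. ennreal (indicator B \<omega> * pvar q n s (snd \<omega>)) \<partial>?M)"
        unfolding G_def
        by (rule nn_integral_stopped_increment_le[OF st B]) (auto simp: B_def E_def)
      also have "\<dots> \<le> (\<integral>\<^sup>+ \<omega>. ennreal (indicator B \<omega> * \<sigma>) \<partial>?M)"
        using C \<sigma> by (intro nn_integral_mono ennreal_leI) (auto simp: indicator_def B_def A_def)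
      finally have le: "(\<integral>\<^sup>+ \<omega>. ennreal (indicator B \<omega> * G \<omega>) \<partial>?M) \<le> (\<integral>\<^sup>+ \<omega>. ennreal (indicator B \<omega> * \<sigma>) \<partial>?M)" .
      have i1: "integrable ?M (\<lambda>\<omega>. indicator B \<omega> * G \<omega>)" and i2: "integrable ?M (\<lambda>\<omega>. indicator B \<omega> * \<sigma>)"
        using integrable_mult_indicator[OF BM Gint] integrable_mult_indicator[OF BM, of "\<lambda>_. \<sigma>"] by simp_all
      have "ennreal (\<integral>\<omega>. indicator B \<omega> * G \<omega> \<partial>?M) \<le> ennreal (\<integral>\<omega>. indicator B \<omega> * \<sigma> \<partial>?M)"
        using le nn_integral_eq_integral[OF i1] nn_integral_eq_integral[OF i2] \<sigma> by (simp add: G_def)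
      then have "(\<integral>\<omega>. indicator B \<omega> * G \<omega> \<partial>?M) \<le> (\<integral>\<omega>. indicator B \<omega> * \<sigma> \<partial>?M)"
        using \<sigma> by (subst (asm) ennreal_le_iff) (auto intro!: integral_nonneg_AE)
      moreover have "(\<integral>\<omega>\<in>C. f' \<omega> \<partial>?M) = (\<integral>\<omega>. indicator B \<omega> * G \<omega> - indicator B \<omega> * \<sigma> \<partial>?M)"
        unfolding set_lebesgue_integral_def f'_def B_def
        by (intro Bochner_Integration.integral_cong) (auto simp: indicator_def)
      ultimately show "(\<integral>\<omega>\<in>C. f' \<omega> \<partial>?M) \<le> 0"
        using i1 i2 by simp
    qed
  qed
  \<comment> \<open>A competitor for the essential supremum that is infinite outside A, so that
    minimality yields a statement on A only.\<close>
  define Z' :: "('d, 'b) outcome \<Rightarrow> ereal" where "Z' \<omega> = (if \<omega> \<in> A then 0 else \<infinity>)" for \<omega>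
  have Z': "Z' \<in> borel_measurable ?M"
    unfolding Z'_def using AM by (intro measurable_If_set) auto
  have "AE \<omega> in ?M. opt_value n s \<omega> \<le> Z' \<omega>"
  proof -
    have "\<forall>Y\<in>{ereal_cond_exp ?M (?F s) (stop_gain Q\<^sub>0 Q\<^sub>1 n s T) | T. T \<in> stopping_times Q\<^sub>0 Q\<^sub>1 n s}. AE \<omega> in ?M. Y \<omega> \<le> Z' \<omega>"
    proof safe
      fix T :: "('d, 'b) outcome \<Rightarrow> nat" assume "T \<in> stopping_times Q\<^sub>0 Q\<^sub>1 n s"
      from X[OF this] show "AE \<omega> in ?M. ereal_cond_exp ?M (?F s) (stop_gain Q\<^sub>0 Q\<^sub>1 n s T) \<omega> \<le> Z' \<omega>"
        by eventually_elim (simp add: Z'_def)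
    qed
    with Z' is_ess_sup_opt_value[of n s] show ?thesis unfolding is_ess_sup_def by blast
  qed
  moreover have "AE \<omega> in ?M. \<omega> \<in> space ?M" by (rule AE_space)
  ultimately show ?thesis by eventually_elim (auto simp: Z'_def A_def split: if_splits)
qed

text \<open>Off one null set, every time that meets the threshold of \<open>T_plus\<close> has value
  0, so the minimum for \<open>T_opt\<close> is over a larger set.\<close>

lemma T_opt_le_T_plus: "AE \<omega> in joint n. T_opt Q\<^sub>0 Q\<^sub>1 n (\<omega> :: ('d::finite, 'b) outcome) \<le> T_plus Q\<^sub>0 Q\<^sub>1 n \<omega>"
proof -
  have "AE \<omega> in joint n. \<forall>s. 0 \<le> opt_value n s (\<omega> :: ('d, 'b) outcome) \<and>
    (pvar q n s (snd \<omega>) \<le> real (sphere_size TYPE('d) s) \<longrightarrow> opt_value n s \<omega> \<le> 0)"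
    using opt_value_nonneg opt_value_nonpos by (subst AE_all_countable) (auto intro: AE_conjI)
  with cond_exp_vhat_error[where 'd='d, of n] show ?thesis
  proof eventually_elim
    case (elim \<omega>)
    then show ?case unfolding T_opt_eq T_plus_def
      by (intro Inf_superset_mono) (auto intro: antisym)
  qed
qed

lemma T_plus_le:
  "AE \<omega> in joint n. \<forall>s. pvar q n s (snd \<omega>) \<le> 1 \<longrightarrow> T_plus Q\<^sub>0 Q\<^sub>1 n (\<omega> :: ('d::finite, 'b) outcome) \<le> enat s"
  using cond_exp_vhat_error[where 'd='d, of n]
proof eventually_elim
  case (elim \<omega>)
  show ?case
  proof (intro allI impI)
    fix s assume "pvar q n s (snd \<omega>) \<le> 1"
    also have "1 \<le> real (sphere_size TYPE('d) s)" using sphere_size_ge_1[where 'd='d, of s] by simp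
    finally show "T_plus Q\<^sub>0 Q\<^sub>1 n \<omega> \<le> enat s"
      unfolding T_plus_def using elim by (intro Inf_lower) auto
  qed
qed

lemma T_opt_ge: "(\<And>s. s \<le> k \<Longrightarrow> 0 < opt_value n s \<omega>) \<Longrightarrow> enat (Suc k) \<le> T_opt Q\<^sub>0 Q\<^sub>1 n \<omega>"
  unfolding T_opt_eq by (rule Inf_greatest) (force simp: Suc_le_eq not_le[symmetric])

lemma Inf_enat_measurable:
  assumes "\<And>s. Measurable.pred M (P s)"
  shows "(\<lambda>\<omega>. Inf {enat s | s. P s \<omega>}) \<in> M \<rightarrow>\<^sub>M count_space UNIV"
proof -
  have eq: "Inf {enat s | s. P s \<omega>} = (if \<exists>s. P s \<omega> then enat (LEAST s. P s \<omega>) else \<infinity>)" for \<omega>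
  proof (cases "\<exists>s. P s \<omega>")
    case True
    then have "Inf {enat s | s. P s \<omega>} = enat (LEAST s. P s \<omega>)"
      by (intro antisym Inf_lower Inf_greatest) (auto intro: LeastI Least_le)
    with True show ?thesis by simp
  next
    case False
    then show ?thesis by (simp add: top_enat_def)
  qed
  note [measurable] = assms
  show ?thesis unfolding eq by measurable
qed

lemma T_opt_measurable: "T_opt Q\<^sub>0 Q\<^sub>1 n \<in> joint n \<rightarrow>\<^sub>M count_space UNIV"
  unfolding T_opt_eq[abs_def] by (intro Inf_enat_measurable pred_eq_const1[OF opt_value_measurable]) simp

lemma T_plus_measurable: "T_plus Q\<^sub>0 Q\<^sub>1 n \<in> joint n \<rightarrow>\<^sub>M count_space UNIV"
  unfolding T_plus_def[abs_def]
  by (intro Inf_enat_measurable, unfold pred_def)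
     (intro borel_measurable_le borel_measurable_cond_exp2 borel_measurable_const)

end

section \<open>The posterior variance under a fixed source\<close>

lemma real_sqrt_prod: "sqrt (\<Prod>i\<in>S. f i) = (\<Prod>i\<in>S. sqrt (f i))"
  by (induction S rule: infinite_finite_induct) (simp_all add: real_sqrt_mult)

lemma (in prob_space) markov_nn_integral:
  assumes f: "f \<in> borel_measurable M" and "0 < a" "0 \<le> c"
    and le: "(\<integral>\<^sup>+ x. ennreal (f x) \<partial>M) \<le> ennreal c"
  shows "measure M {x \<in> space M. a \<le> f x} \<le> c / a"
proof -
  have fM: "(\<lambda>x. ennreal (f x)) \<in> borel_measurable M"
    by (intro measurable_compose[OF f measurable_ennreal])
  have "{x \<in> space M. a \<le> f x} \<subseteq> {x \<in> space M. 1 \<le> ennreal (1 / a) * ennreal (f x)}"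
  proof safe
    fix x assume "a \<le> f x"
    then have "1 \<le> 1 / a * f x" using \<open>0 < a\<close> by simp
    then have "ennreal 1 \<le> ennreal (1 / a * f x)" by (rule ennreal_leI)
    moreover have "ennreal (1 / a * f x) = ennreal (1 / a) * ennreal (f x)"
      using \<open>0 < a\<close> by (intro ennreal_mult') simp
    ultimately show "1 \<le> ennreal (1 / a) * ennreal (f x)" by (simp only: ennreal_1)
  qed
  then have "emeasure M {x \<in> space M. a \<le> f x} \<le> emeasure M {x \<in> space M. 1 \<le> ennreal (1 / a) * ennreal (f x)}"
    by (intro emeasure_mono) (use fM in measurable)
  also have "\<dots> \<le> ennreal (1 / a) * (\<integral>\<^sup>+ x. ennreal (f x) * indicator (space M) x \<partial>M)"
    by (intro nn_integral_Markov_inequality sets.top borel_measurable_times_ennreal fM borel_measurable_indicator)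
  also have "\<dots> = ennreal (1 / a) * (\<integral>\<^sup>+ x. ennreal (f x) \<partial>M)"
    by (intro arg_cong2[where f = times] refl nn_integral_cong) simp
  also have "\<dots> \<le> ennreal (1 / a) * ennreal c" by (intro mult_left_mono le) simp
  also have "\<dots> = ennreal (c / a)" using assms(2,3) by (simp add: ennreal_mult[symmetric])
  finally show ?thesis using assms(2,3) by (simp add: emeasure_eq_measure)
qed

context signal_model
begin

section \<open>Likelihood ratios under a fixed source\<close>

definition vertex_law :: "int ^ 'd \<Rightarrow> (int ^ 'd) \<times> nat \<Rightarrow> 'b measure"
  where "vertex_law v i = (if ldist (fst i) v \<le> snd i then Q\<^sub>1 else Q\<^sub>0)"

lemma signal_law_eq: "law v = PiM UNIV (vertex_law v)"
  unfolding signal_law_def vertex_law_def by (intro arg_cong[where f = "PiM UNIV"]) auto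

lemma prob_space_vertex_law: "prob_space (vertex_law v i)"
  by (simp add: vertex_law_def Q0 Q1)

lemma sets_vertex_law: "sets (vertex_law v i) = sets Q\<^sub>0"
  by (simp add: vertex_law_def sets_Q1)

lemma vertex_law_cone: "i \<in> cone v t \<Longrightarrow> vertex_law v i = Q\<^sub>1"
  by (auto simp: cone_def vertex_law_def)

lemma vertex_law_not_cone: "i \<in> cone u t \<Longrightarrow> i \<notin> cone v t \<Longrightarrow> vertex_law v i = Q\<^sub>0"
  by (auto simp: cone_def vertex_law_def)

lemma nn_integral_signal_prod:
  assumes "finite S" "\<And>i. i \<in> S \<Longrightarrow> f i \<in> borel_measurable Q\<^sub>0"
  shows "(\<integral>\<^sup>+ y. (\<Prod>i\<in>S. f i (y i)) \<partial>law v) = (\<Prod>i\<in>S. \<integral>\<^sup>+ x. f i x \<partial>vertex_law v i)"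
  unfolding signal_law_eq using assms
  by (intro nn_integral_PiM_prod prob_space_vertex_law) (auto simp: measurable_cong_sets[OF sets_vertex_law refl])

lemma nn_integral_signal_component:
  assumes "f \<in> borel_measurable Q\<^sub>0"
  shows "(\<integral>\<^sup>+ y. f (y i) \<partial>law v) = (\<integral>\<^sup>+ x. f x \<partial>vertex_law v i)"
  using nn_integral_signal_prod[of "{i}" "\<lambda>_. f" v] assms by simp

lemma nn_integral_Q1: "f \<in> borel_measurable Q\<^sub>0 \<Longrightarrow> (\<integral>\<^sup>+ x. f x \<partial>Q\<^sub>1) = (\<integral>\<^sup>+ x. ennreal (q x) * f x \<partial>Q\<^sub>0)"
  by (subst Q1_eq) (simp add: nn_integral_density)

lemma nn_integral_q: "(\<integral>\<^sup>+ x. ennreal (q x) \<partial>Q\<^sub>0) = 1"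
  using nn_integral_Q1[of "\<lambda>_. 1"] prob_space.emeasure_space_1[OF Q1] by simp

lemma coord_measurable: "f \<in> borel_measurable Q\<^sub>0 \<Longrightarrow> (\<lambda>y. f (y i)) \<in> borel_measurable fields"
  by (rule measurable_compose[OF measurable_component_singleton[of i UNIV "\<lambda>_. Q\<^sub>0"]]) auto

lemma signal_measurable: "f \<in> borel_measurable fields \<Longrightarrow> f \<in> borel_measurable (law v)"
  using measurable_cong_sets[OF sets_signal refl] by blast

lemma markov_signal:
  assumes f: "f \<in> borel_measurable fields" and "0 < a" "0 \<le> c"
    and le: "(\<integral>\<^sup>+ y. ennreal (f y) \<partial>law v) \<le> ennreal c"
  shows "measure (law v) {y \<in> space fields. a \<le> f y} \<le> c / a"
  using prob_space.markov_nn_integral[OF prob_space_signal signal_measurable[OF f] assms(2-4)]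
  by (simp add: space_signal)

text \<open>The ratio factorises over signals. A point in the cone of u only contributes the
  affinity, a point in the cone of v only contributes at most 1, and common points cancel.\<close>

lemma hellinger_ratio:
  fixes u v :: "int ^ 'd::finite"
  assumes \<rho>: "0 < \<rho>" "\<rho> < 1" "(\<integral>\<^sup>+ x. ennreal (sqrt (q x)) \<partial>Q\<^sub>0) \<le> ennreal \<rho>"
  shows "(\<integral>\<^sup>+ y. ennreal (sqrt (lik q t u y / lik q t v y)) \<partial>law v)
    \<le> ennreal (\<rho> ^ card (cone u t - cone v t))"
proof -
  let ?U = "cone u t \<union> cone v t"
  define g where "g i x = (if i \<in> cone u t then sqrt (q x) else 1) / (if i \<in> cone v t then sqrt (q x) else 1)" for i x
  have sq: "(\<lambda>x. sqrt (q x)) \<in> borel_measurable Q\<^sub>0" by measurable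
  have gM: "(\<lambda>x. ennreal (g i x)) \<in> borel_measurable Q\<^sub>0" for i
    unfolding g_def by (cases "i \<in> cone u t"; cases "i \<in> cone v t") (simp_all add: sq)
  have g0: "0 \<le> g i x" for i x using q_pos[of x] by (simp add: g_def)
  have sqrt_lik: "sqrt (lik q t w y) = (\<Prod>i\<in>cone w t. sqrt (q (y i)))" for w y
    unfolding lik_def by (rule real_sqrt_prod)
  have "sqrt (lik q t u y / lik q t v y) = (\<Prod>i\<in>?U. g i (y i))" for y
  proof -
    have "(\<Prod>i\<in>?U. g i (y i)) = (\<Prod>i\<in>?U. if i \<in> cone u t then sqrt (q (y i)) else 1) / (\<Prod>i\<in>?U. if i \<in> cone v t then sqrt (q (y i)) else 1)"
      unfolding g_def by (rule prod_dividef)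
    also have "(\<Prod>i\<in>?U. if i \<in> cone u t then sqrt (q (y i)) else 1) = (\<Prod>i\<in>cone u t. sqrt (q (y i)))"
      by (intro prod.mono_neutral_cong_right) auto
    also have "(\<Prod>i\<in>?U. if i \<in> cone v t then sqrt (q (y i)) else 1) = (\<Prod>i\<in>cone v t. sqrt (q (y i)))"
      by (intro prod.mono_neutral_cong_right) auto
    finally show ?thesis by (simp add: real_sqrt_divide sqrt_lik)
  qed
  then have "(\<integral>\<^sup>+ y. ennreal (sqrt (lik q t u y / lik q t v y)) \<partial>law v)
      = (\<integral>\<^sup>+ y. (\<Prod>i\<in>?U. ennreal (g i (y i))) \<partial>law v)"
    by (simp add: prod_ennreal g0)
  also have "\<dots> = (\<Prod>i\<in>?U. \<integral>\<^sup>+ x. ennreal (g i x) \<partial>vertex_law v i)"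
    by (rule nn_integral_signal_prod) (simp_all add: gM)
  also have "\<dots> \<le> (\<Prod>i\<in>?U. ennreal (if i \<in> cone u t - cone v t then \<rho> else 1))"
  proof (rule prod_mono_ennreal)
    fix i assume i: "i \<in> ?U"
    consider "i \<in> cone u t" "i \<notin> cone v t" | "i \<in> cone v t" "i \<notin> cone u t" | "i \<in> cone v t" "i \<in> cone u t"
      using i by blast
    then show "(\<integral>\<^sup>+ x. ennreal (g i x) \<partial>vertex_law v i) \<le> ennreal (if i \<in> cone u t - cone v t then \<rho> else 1)"
    proof cases
      case 1
      then show ?thesis using \<rho>(3) by (simp add: vertex_law_not_cone g_def)
    next
      case 2
      \<comment> \<open>Changing the measure from \<open>Q\<^sub>1\<close> to
        \<open>Q\<^sub>0\<close> turns the inverse root into the root, so this is again the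
        affinity.\<close>
      have "(\<integral>\<^sup>+ x. ennreal (1 / sqrt (q x)) \<partial>Q\<^sub>1) = (\<integral>\<^sup>+ x. ennreal (q x) * ennreal (1 / sqrt (q x)) \<partial>Q\<^sub>0)"
        by (rule nn_integral_Q1) (use sq in measurable)
      also have "\<dots> = (\<integral>\<^sup>+ x. ennreal (sqrt (q x)) \<partial>Q\<^sub>0)"
      proof (intro nn_integral_cong)
        fix x
        have "q x * (1 / sqrt (q x)) = sqrt (q x)" using q_pos[of x] by (simp add: real_div_sqrt)
        then show "ennreal (q x) * ennreal (1 / sqrt (q x)) = ennreal (sqrt (q x))"
          using q_pos[of x] by (simp add: ennreal_mult[symmetric])
      qed
      also have "\<dots> \<le> 1" using \<rho> by (intro order.trans[OF \<rho>(3)]) (simp add: ennreal_le_1)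
      finally show ?thesis using 2 by (simp add: vertex_law_cone g_def)
    next
      case 3
      have "g i x = 1" for x using 3 q_pos[of x] by (simp add: g_def)
      then show ?thesis using 3 prob_space.emeasure_space_1[OF Q1] by (simp add: vertex_law_cone)
    qed
  qed
  also have "\<dots> = ennreal (\<Prod>i\<in>?U. if i \<in> cone u t - cone v t then \<rho> else 1)"
    using \<rho> by (intro prod_ennreal) auto
  also have "(\<Prod>i\<in>?U. if i \<in> cone u t - cone v t then \<rho> else 1) = (\<Prod>i\<in>cone u t - cone v t. \<rho>)"
    by (intro prod.mono_neutral_cong_right) auto
  finally show ?thesis by simp
qed

text \<open>The variance is at most the second moment about the true source. A posterior weight is
  at most 1 and at most the likelihood ratio, hence at most its square root, the quantity with a
  small mean.\<close>

lemma pvar_le_sqrt_ratio: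
  fixes v :: "int ^ 'd::finite"
  assumes v: "v \<in> sources n"
  shows "pvar q n t y \<le> (\<Sum>u\<in>sources n - {v}. sqrt (lik q t u y / lik q t v y) * (norm (embed u - embed v))\<^sup>2)"
proof -
  have "pvar q n t y \<le> (\<Sum>u\<in>sources n. post q n t u y * (norm (embed u - embed v))\<^sup>2)"
    unfolding pvar_decomposition[of n t y "embed v"] by simp
  also have "\<dots> = (\<Sum>u\<in>sources n - {v}. post q n t u y * (norm (embed u - embed v))\<^sup>2)"
    by (intro sum.mono_neutral_right) auto
  also have "\<dots> \<le> (\<Sum>u\<in>sources n - {v}. sqrt (lik q t u y / lik q t v y) * (norm (embed u - embed v))\<^sup>2)"
  proof (intro sum_mono mult_right_mono)
    fix u assume u: "u \<in> sources n - {v}"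
    let ?r = "lik q t u y / lik q t v y"
    have r0: "0 \<le> ?r" using lik_pos[of t u y] lik_pos[of t v y] by simp
    have "lik q t v y \<le> (\<Sum>u\<in>sources n. lik q t u y)"
      by (rule member_le_sum[OF v]) (auto intro: less_imp_le lik_pos)
    then have "post q n t u y \<le> ?r"
      unfolding post_def using lik_pos[of t v y] lik_pos[of t u y] sum_lik_pos[of t y n]
      by (intro divide_left_mono mult_pos_pos) auto
    moreover have "post q n t u y \<le> 1" using u by (intro post_le_1) auto
    ultimately have "(post q n t u y)\<^sup>2 \<le> 1 * ?r"
      unfolding power2_eq_square by (intro mult_mono) (auto simp: post_nonneg)
    then show "post q n t u y \<le> sqrt ?r" by (intro real_le_rsqrt) simp
  qed auto
  finally show ?thesis .
qed

lemma nn_integral_pvar_le: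
  fixes v :: "int ^ 'd::finite"
  assumes \<rho>: "0 < \<rho>" "\<rho> < 1" "(\<integral>\<^sup>+ x. ennreal (sqrt (q x)) \<partial>Q\<^sub>0) \<le> ennreal \<rho>"
    and v: "v \<in> sources n"
  shows "(\<integral>\<^sup>+ y. ennreal (pvar q n t y) \<partial>law v)
    \<le> ennreal (\<Sum>u\<in>sources n - {v}. \<rho> ^ card (cone u t - cone v t) * (norm (embed u - embed v))\<^sup>2)"
proof -
  have rM: "(\<lambda>y. ennreal (sqrt (lik q t u y / lik q t v y))) \<in> borel_measurable (law v)" for u
    by (intro signal_measurable measurable_compose[OF _ measurable_ennreal] measurable_compose[OF _ borel_measurable_sqrt]
        borel_measurable_divide lik_measurable)
  have "(\<integral>\<^sup>+ y. ennreal (pvar q n t y) \<partial>law v)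
    \<le> (\<integral>\<^sup>+ y. (\<Sum>u\<in>sources n - {v}. ennreal (sqrt (lik q t u y / lik q t v y)) * ennreal ((norm (embed u - embed v))\<^sup>2)) \<partial>law v)"
  proof (intro nn_integral_mono)
    fix y
    have "(\<Sum>u\<in>sources n - {v}. ennreal (sqrt (lik q t u y / lik q t v y)) * ennreal ((norm (embed u - embed v))\<^sup>2))
      = ennreal (\<Sum>u\<in>sources n - {v}. sqrt (lik q t u y / lik q t v y) * (norm (embed u - embed v))\<^sup>2)"
      by (subst sum_ennreal[symmetric])
         (auto intro!: sum.cong mult_nonneg_nonneg real_sqrt_ge_zero divide_nonneg_nonneg less_imp_le[OF lik_pos] simp: ennreal_mult'')
    then show "ennreal (pvar q n t y) \<le> (\<Sum>u\<in>sources n - {v}. ennreal (sqrt (lik q t u y / lik q t v y)) * ennreal ((norm (embed u - embed v))\<^sup>2))"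
      using pvar_le_sqrt_ratio[OF v] by (simp add: ennreal_leI)
  qed
  also have "\<dots> = (\<Sum>u\<in>sources n - {v}. (\<integral>\<^sup>+ y. ennreal (sqrt (lik q t u y / lik q t v y)) \<partial>law v) * ennreal ((norm (embed u - embed v))\<^sup>2))"
    using rM by (subst nn_integral_sum) (auto intro!: sum.cong nn_integral_multc)
  also have "\<dots> \<le> (\<Sum>u\<in>sources n - {v}. ennreal (\<rho> ^ card (cone u t - cone v t)) * ennreal ((norm (embed u - embed v))\<^sup>2))"
    by (intro sum_mono mult_right_mono hellinger_ratio[OF \<rho>]) simp
  also have "\<dots> = ennreal (\<Sum>u\<in>sources n - {v}. \<rho> ^ card (cone u t - cone v t) * (norm (embed u - embed v))\<^sup>2)"
    using \<rho> by (subst sum_ennreal[symmetric]) (auto simp: ennreal_mult)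
  finally show ?thesis .
qed

end

section \<open>Deterministic bounds for the expected variance\<close>

text \<open>For times of order \<open>ln n\<close>, where \<rho> to the power t alone beats the
  cubic factor: one n for the number of sources, two for the squared distance.\<close>

lemma sum_pvar_bound_crude:
  fixes v :: "int ^ 'd::finite"
  assumes \<rho>: "0 < \<rho>" "\<rho> < 1" and v: "v \<in> sources n" and n: "1 \<le> n"
  shows "(\<Sum>u\<in>sources n - {v}. \<rho> ^ card (cone u t - cone v t) * (norm (embed u - embed v))\<^sup>2)
    \<le> 3 ^ CARD('d) * 4 * real n ^ 3 * \<rho> ^ t"
proof -
  have "(\<Sum>u\<in>sources n - {v}. \<rho> ^ card (cone u t - cone v t) * (norm (embed u - embed v))\<^sup>2)
      \<le> (\<Sum>u\<in>sources n - {v}. \<rho> ^ t * (2 * real n)\<^sup>2)"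
  proof (intro sum_mono mult_mono power_mono)
    fix u assume u: "u \<in> sources n - {v}"
    then have "t \<le> card (cone u t - cone v t)" using card_cone_diff_ge[of u v t] by auto
    then show "\<rho> ^ card (cone u t - cone v t) \<le> \<rho> ^ t" using \<rho> by (intro power_decreasing) auto
    show "norm (embed u - embed v) \<le> 2 * real n" using u by (intro norm_embed_diff_sources v n) auto
  qed (use \<rho> in auto)
  also have "\<dots> = real (card (sources n - {v})) * (\<rho> ^ t * (2 * real n)\<^sup>2)" by simp
  also have "\<dots> \<le> (3 ^ CARD('d) * real n) * (\<rho> ^ t * (2 * real n)\<^sup>2)"
  proof (intro mult_right_mono)
    have "card (sources n - {v}) \<le> card (sources n :: (int ^ 'd) set)" by (intro card_mono) auto
    with card_sources_le[where 'd='d, OF n] show "real (card (sources n - {v})) \<le> 3 ^ CARD('d) * real n" by linarith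
  qed (use \<rho> in auto)
  finally show ?thesis by (simp add: power2_eq_square power3_eq_cube mult_ac)
qed

text \<open>For the much shorter times with growth of order \<open>ln n\<close>. Within distance 2r
  the number of rivals and their squared distances are polynomial in r, so \<rho> to the power r
  suffices; beyond 2r, where all powers of n occur, \<open>growth r\<close> signals separate the
  cones.\<close>

lemma sum_pvar_bound:
  fixes v :: "int ^ 'd::finite"
  assumes \<rho>: "0 < \<rho>" "\<rho> < 1" and v: "v \<in> sources n" and n: "1 \<le> n"
  shows "(\<Sum>u\<in>sources n - {v}. \<rho> ^ card (cone u (2 * r) - cone v (2 * r)) * (norm (embed u - embed v))\<^sup>2)
    \<le> (4 * real r + 1) ^ CARD('d) * (2 * real r)\<^sup>2 * \<rho> ^ r + 3 ^ CARD('d) * 4 * real n ^ 3 * \<rho> ^ growth TYPE('d) r"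
proof -
  let ?f = "\<lambda>u. \<rho> ^ card (cone u (2 * r) - cone v (2 * r)) * (norm (embed u - embed v))\<^sup>2"
  define A where "A = {u \<in> sources n - {v}. ldist u v \<le> 2 * r}"
  define B where "B = {u \<in> sources n - {v}. 2 * r < ldist u v}"
  have "sum ?f (sources n - {v}) = sum ?f A + sum ?f B"
    by (subst sum.union_disjoint[symmetric]) (auto simp: A_def B_def intro!: arg_cong[where f = "sum _"])
  moreover have "sum ?f A \<le> (4 * real r + 1) ^ CARD('d) * (2 * real r)\<^sup>2 * \<rho> ^ r"
  proof -
    have "sum ?f A \<le> (\<Sum>u\<in>A. \<rho> ^ r * (2 * real r)\<^sup>2)"
    proof (intro sum_mono mult_mono power_mono)
      fix u assume u: "u \<in> A"
      then have "r \<le> card (cone u (2 * r) - cone v (2 * r))" using card_cone_diff_ge[of u v "2 * r"] by (auto simp: A_def)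
      then show "\<rho> ^ card (cone u (2 * r) - cone v (2 * r)) \<le> \<rho> ^ r" using \<rho> by (intro power_decreasing) auto
      have "real (ldist u v) \<le> real (2 * r)" using u by (simp add: A_def)
      with norm_embed_diff_le[of u v] show "norm (embed u - embed v) \<le> 2 * real r" by simp
    qed (use \<rho> in auto)
    also have "\<dots> = real (card A) * (\<rho> ^ r * (2 * real r)\<^sup>2)" by simp
    also have "\<dots> \<le> (4 * real r + 1) ^ CARD('d) * (\<rho> ^ r * (2 * real r)\<^sup>2)"
    proof (intro mult_right_mono)
      have "card A \<le> card {u. ldist u v \<le> 2 * r}" by (intro card_mono) (auto simp: A_def)
      also have "\<dots> \<le> (2 * (2 * r) + 1) ^ CARD('d)" unfolding card_ldist_ball by (rule ball_size_le)
      finally have "real (card A) \<le> real ((2 * (2 * r) + 1) ^ CARD('d))" by (subst of_nat_le_iff)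
      then show "real (card A) \<le> (4 * real r + 1) ^ CARD('d)" by (simp add: add.commute)
    qed (use \<rho> in auto)
    finally show ?thesis by (simp add: mult_ac)
  qed
  moreover have "sum ?f B \<le> 3 ^ CARD('d) * 4 * real n ^ 3 * \<rho> ^ growth TYPE('d) r"
  proof -
    have "sum ?f B \<le> (\<Sum>u\<in>B. \<rho> ^ growth TYPE('d) r * (2 * real n)\<^sup>2)"
    proof (intro sum_mono mult_mono power_mono)
      fix u assume u: "u \<in> B"
      then have "growth TYPE('d) r \<le> card (cone u (2 * r) - cone v (2 * r))"
        by (intro card_cone_diff_ge_growth) (auto simp: B_def)
      then show "\<rho> ^ card (cone u (2 * r) - cone v (2 * r)) \<le> \<rho> ^ growth TYPE('d) r" using \<rho> by (intro power_decreasing) auto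
      show "norm (embed u - embed v) \<le> 2 * real n" using u by (intro norm_embed_diff_sources v n) (auto simp: B_def)
    qed (use \<rho> in auto)
    also have "\<dots> = real (card B) * (\<rho> ^ growth TYPE('d) r * (2 * real n)\<^sup>2)" by simp
    also have "\<dots> \<le> (3 ^ CARD('d) * real n) * (\<rho> ^ growth TYPE('d) r * (2 * real n)\<^sup>2)"
    proof (intro mult_right_mono)
      have "card B \<le> card (sources n :: (int ^ 'd) set)" by (intro card_mono) (auto simp: B_def)
      with card_sources_le[where 'd='d, OF n] show "real (card B) \<le> 3 ^ CARD('d) * real n" by linarith
    qed (use \<rho> in auto)
    finally show ?thesis by (simp add: power2_eq_square power3_eq_cube mult_ac)
  qed
  ultimately show ?thesis by linarith
qed

section \<open>Likelihoods at early times\<close>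

context signal_model
begin

text \<open>The positive part of the log-likelihood ratio; its mean under \<open>Q\<^sub>1\<close>
  is finite because the divergence is.\<close>

definition log_gain :: "'b \<Rightarrow> real" where "log_gain x = max 0 (ln (q x))"

lemma log_gain_measurable: "log_gain \<in> borel_measurable Q\<^sub>0"
  unfolding log_gain_def by measurable

lemma log_gain_nonneg: "0 \<le> log_gain x"
  by (simp add: log_gain_def)

lemma q_le_exp_log_gain: "q x \<le> exp (log_gain x)"
proof -
  have "q x = exp (ln (q x))" using q_pos[of x] by simp
  also have "\<dots> \<le> exp (log_gain x)" by (simp add: log_gain_def)
  finally show ?thesis .
qed

text \<open>
  Only the first moment of \<open>log_gain\<close> is finite, so the tail of the sum is split at level \<open>K\<close>:
  Markov's inequality for the part above, Chernoff's bound for the part below.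
\<close>

lemma log_gain_sum_tail:
  fixes v :: "int ^ 'd::finite"
  assumes m: "0 \<le> m" "(\<integral>\<^sup>+ x. ennreal (log_gain x) \<partial>Q\<^sub>1) \<le> ennreal m"
    and \<delta>: "0 \<le> \<delta>" "(\<integral>\<^sup>+ x. ennreal (if log_gain x > K then log_gain x else 0) \<partial>Q\<^sub>1) \<le> ennreal \<delta>"
    and \<theta>: "0 < \<theta>" "exp (\<theta> * K) \<le> 2" and a: "0 < a"
  shows "measure (law v) {y \<in> space fields. 2 * a \<le> (\<Sum>i\<in>cone v t. log_gain (y i))}
    \<le> real (growth TYPE('d) t) * \<delta> / a + exp (2 * \<theta> * m * real (growth TYPE('d) t) - \<theta> * a)"
proof -
  interpret K: prob_space "law v" by (rule prob_space_signal)
  let ?N = "real (growth TYPE('d) t)"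
  define big where "big x = (if log_gain x > K then log_gain x else 0)" for x
  define small where "small x = (if log_gain x > K then 0 else log_gain x)" for x
  note [measurable] = log_gain_measurable
  have bM: "big \<in> borel_measurable Q\<^sub>0" and sM: "small \<in> borel_measurable Q\<^sub>0"
    unfolding big_def small_def by measurable
  have b0: "0 \<le> big x" and s0: "0 \<le> small x" for x
    using log_gain_nonneg[of x] by (simp_all add: big_def small_def)
  have eM: "(\<lambda>x. exp (\<theta> * small x)) \<in> borel_measurable Q\<^sub>0" using sM by measurable
  define SB where "SB y = (\<Sum>i\<in>cone v t. big (y i))" for y
  define SS where "SS y = exp (\<theta> * (\<Sum>i\<in>cone v t. small (y i)))" for y
  have SBM: "SB \<in> borel_measurable fields"
    unfolding SB_def by (intro borel_measurable_sum coord_measurable bM)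
  have SSe: "SS y = (\<Prod>i\<in>cone v t. exp (\<theta> * small (y i)))" for y
    unfolding SS_def by (simp add: sum_distrib_left exp_sum)
  have SSM: "SS \<in> borel_measurable fields"
    unfolding SSe by (intro borel_measurable_prod coord_measurable[where f = "\<lambda>x. exp (\<theta> * small x)"] eM)
  have "(\<integral>\<^sup>+ y. ennreal (SB y) \<partial>law v) = (\<Sum>i\<in>cone v t. \<integral>\<^sup>+ y. ennreal (big (y i)) \<partial>law v)"
    unfolding SB_def by (subst nn_integral_sum[symmetric])
      (auto simp: b0 intro!: signal_measurable coord_measurable bM)
  also have "\<dots> = (\<Sum>i\<in>cone v t. \<integral>\<^sup>+ x. ennreal (big x) \<partial>Q\<^sub>1)"
    by (intro sum.cong refl, subst nn_integral_signal_component)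
       (auto simp: vertex_law_cone intro!: measurable_compose[OF bM measurable_ennreal])
  also have "\<dots> \<le> (\<Sum>i\<in>cone v t. ennreal \<delta>)"
    using \<delta> by (intro sum_mono) (simp add: big_def)
  also have "\<dots> = ennreal (?N * \<delta>)" by (simp add: card_cone ennreal_mult'' \<delta> ennreal_of_nat_eq_real_of_nat)
  finally have B: "measure (law v) {y \<in> space fields. a \<le> SB y} \<le> ?N * \<delta> / a"
    using \<delta> a by (intro markov_signal[OF SBM]) auto
  have one: "(\<integral>\<^sup>+ x. ennreal (exp (\<theta> * small x)) \<partial>Q\<^sub>1) \<le> ennreal (exp (2 * \<theta> * m))"
  proof -
    have "exp (\<theta> * small x) \<le> 1 + 2 * \<theta> * log_gain x" for x
    proof -
      have "small x \<le> max K 0" "small x \<le> log_gain x" using log_gain_nonneg[of x] by (auto simp: small_def)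
      define z where "z = \<theta> * small x"
      have z0: "0 \<le> z" using s0 \<theta> by (simp add: z_def)
      have "exp z \<le> 2"
      proof (cases "log_gain x > K")
        case False
        then have "z \<le> \<theta> * K" using \<theta> by (simp add: z_def small_def)
        then show ?thesis using \<theta>(2) by (meson exp_le_cancel_iff order_trans)
      qed (simp add: z_def small_def)
      \<comment> \<open>This gives exp z - 1 <= z * exp z <= 2 * z as long as exp z <= 2, which is
        what the truncation at K ensures.\<close>
      have "1 - z \<le> exp (- z)" using exp_ge_add_one_self[of "- z"] by simp
      then have "exp z * (1 - z) \<le> exp z * exp (- z)" by (intro mult_left_mono) auto
      then have "exp z \<le> 1 + exp z * z" by (simp add: algebra_simps exp_minus)
      also have "exp z * z \<le> 2 * z" using z0 \<open>exp z \<le> 2\<close> by (intro mult_right_mono)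
      also have "2 * z \<le> 2 * \<theta> * log_gain x" using \<theta> \<open>small x \<le> log_gain x\<close> by (simp add: z_def)
      finally show ?thesis by (simp add: z_def)
    qed
    then have "(\<integral>\<^sup>+ x. ennreal (exp (\<theta> * small x)) \<partial>Q\<^sub>1) \<le> (\<integral>\<^sup>+ x. 1 + ennreal (2 * \<theta>) * ennreal (log_gain x) \<partial>Q\<^sub>1)"
    proof (intro nn_integral_mono)
      fix x assume *: "\<And>x. exp (\<theta> * small x) \<le> 1 + 2 * \<theta> * log_gain x"
      have "ennreal (exp (\<theta> * small x)) \<le> ennreal (1 + 2 * \<theta> * log_gain x)" by (intro ennreal_leI *)
      also have "\<dots> = 1 + ennreal (2 * \<theta>) * ennreal (log_gain x)"
        using \<theta> log_gain_nonneg[of x] by (simp add: ennreal_plus ennreal_mult[symmetric])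
      finally show "ennreal (exp (\<theta> * small x)) \<le> 1 + ennreal (2 * \<theta>) * ennreal (log_gain x)" .
    qed
    also have "\<dots> = 1 + ennreal (2 * \<theta>) * (\<integral>\<^sup>+ x. ennreal (log_gain x) \<partial>Q\<^sub>1)"
    proof -
      have lg: "(\<lambda>x. ennreal (log_gain x)) \<in> borel_measurable Q\<^sub>1"
        using measurable_compose[OF log_gain_measurable measurable_ennreal] measurable_cong_sets[OF sets_Q1 refl] by blast
      have "(\<integral>\<^sup>+ x. 1 + ennreal (2 * \<theta>) * ennreal (log_gain x) \<partial>Q\<^sub>1)
          = (\<integral>\<^sup>+ x. 1 \<partial>Q\<^sub>1) + (\<integral>\<^sup>+ x. ennreal (2 * \<theta>) * ennreal (log_gain x) \<partial>Q\<^sub>1)"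
        by (intro nn_integral_add borel_measurable_const borel_measurable_times_ennreal lg)
      also have "\<dots> = 1 + ennreal (2 * \<theta>) * (\<integral>\<^sup>+ x. ennreal (log_gain x) \<partial>Q\<^sub>1)"
        using prob_space.emeasure_space_1[OF Q1] unfolding nn_integral_cmult[OF lg] by simp
      finally show ?thesis .
    qed
    also have "\<dots> \<le> 1 + ennreal (2 * \<theta>) * ennreal m" by (intro add_left_mono mult_left_mono m) simp
    also have "\<dots> = ennreal (1 + 2 * \<theta> * m)" using \<theta> m by (simp add: ennreal_plus ennreal_mult[symmetric])
    also have "\<dots> \<le> ennreal (exp (2 * \<theta> * m))" by (intro ennreal_leI exp_ge_add_one_self)
    finally show ?thesis .
  qed
  have "(\<integral>\<^sup>+ y. ennreal (SS y) \<partial>law v) = (\<integral>\<^sup>+ y. (\<Prod>i\<in>cone v t. ennreal (exp (\<theta> * small (y i)))) \<partial>law v)"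
    unfolding SSe by (simp add: prod_ennreal)
  also have "\<dots> = (\<Prod>i\<in>cone v t. \<integral>\<^sup>+ x. ennreal (exp (\<theta> * small x)) \<partial>vertex_law v i)"
    by (intro nn_integral_signal_prod finite_cone measurable_compose[OF eM measurable_ennreal])
  also have "\<dots> \<le> (\<Prod>i\<in>cone v t. ennreal (exp (2 * \<theta> * m)))"
    by (intro prod_mono_ennreal) (simp add: vertex_law_cone one)
  also have "\<dots> = ennreal (exp (2 * \<theta> * m * ?N))"
    by (simp add: card_cone ennreal_power exp_of_nat_mult[symmetric] mult.commute)
  finally have "measure (law v) {y \<in> space fields. exp (\<theta> * a) \<le> SS y} \<le> exp (2 * \<theta> * m * ?N) / exp (\<theta> * a)"
    by (intro markov_signal[OF SSM]) auto
  then have S: "measure (law v) {y \<in> space fields. exp (\<theta> * a) \<le> SS y} \<le> exp (2 * \<theta> * m * ?N - \<theta> * a)"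
    by (simp add: exp_diff)
  have sets1: "{y \<in> space fields. a \<le> SB y} \<in> sets (law v)"
    and sets2: "{y \<in> space fields. exp (\<theta> * a) \<le> SS y} \<in> sets (law v)"
    unfolding sets_signal by (intro borel_measurable_le borel_measurable_const SBM SSM)+
  have "{y \<in> space fields. 2 * a \<le> (\<Sum>i\<in>cone v t. log_gain (y i))}
      \<subseteq> {y \<in> space fields. a \<le> SB y} \<union> {y \<in> space fields. exp (\<theta> * a) \<le> SS y}"
  \<comment> \<open>If the total reaches 2 * a, then the truncated or the large gains must reach
    a.\<close>
  proof safe
    fix y assume y: "2 * a \<le> (\<Sum>i\<in>cone v t. log_gain (y i))" "\<not> exp (\<theta> * a) \<le> SS y"
    have "(\<Sum>i\<in>cone v t. log_gain (y i)) = SB y + (\<Sum>i\<in>cone v t. small (y i))"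
      unfolding SB_def sum.distrib[symmetric] by (intro sum.cong) (auto simp: big_def small_def)
    moreover have "(\<Sum>i\<in>cone v t. small (y i)) < a" using y(2) \<theta> by (simp add: SS_def not_le)
    ultimately show "a \<le> SB y" using y(1) by linarith
  qed
  then have "measure (law v) {y \<in> space fields. 2 * a \<le> (\<Sum>i\<in>cone v t. log_gain (y i))}
      \<le> measure (law v) ({y \<in> space fields. a \<le> SB y} \<union> {y \<in> space fields. exp (\<theta> * a) \<le> SS y})"
    using sets1 sets2 by (intro K.finite_measure_mono) auto
  also have "\<dots> \<le> measure (law v) {y \<in> space fields. a \<le> SB y} + measure (law v) {y \<in> space fields. exp (\<theta> * a) \<le> SS y}"
    by (rule measure_Un_le[OF sets1 sets2])
  finally show ?thesis using B S by linarith
qed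

text \<open>Under the source v the signals outside the cone of v are pure noise, so this part of the
  likelihood of u has mean one, however long the time.\<close>

definition outer_lik :: "nat \<Rightarrow> int ^ 'd::finite \<Rightarrow> int ^ 'd \<Rightarrow> ((int ^ 'd) \<times> nat \<Rightarrow> 'b) \<Rightarrow> real"
  where "outer_lik t v u y = (\<Prod>i\<in>cone u t - cone v t. q (y i))"

lemma outer_lik_pos: "0 < outer_lik t v u y"
  unfolding outer_lik_def by (intro prod_pos) (auto simp: q_pos)

lemma outer_lik_measurable: "outer_lik t v u \<in> borel_measurable fields"
  unfolding outer_lik_def by (intro borel_measurable_prod coord_measurable q_meas)

text \<open>The factors shared with the cone of v are replaced by the total log gain in that cone,
  which depends on neither u nor s. One exponential thus serves all rivals and all times up to
  t.\<close>

lemma lik_le_outer_lik: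
  assumes "s \<le> t"
  shows "lik q s u y \<le> outer_lik s v u y * exp (\<Sum>i\<in>cone v t. log_gain (y i))"
proof -
  have "lik q s u y = outer_lik s v u y * (\<Prod>i\<in>cone u s \<inter> cone v s. q (y i))"
    unfolding lik_def outer_lik_def by (subst prod.union_disjoint[symmetric]) (auto intro!: prod.cong)
  also have "\<dots> \<le> outer_lik s v u y * (\<Prod>i\<in>cone u s \<inter> cone v s. exp (log_gain (y i)))"
    by (intro mult_left_mono prod_mono conjI less_imp_le[OF q_pos] q_le_exp_log_gain less_imp_le[OF outer_lik_pos])
  also have "(\<Prod>i\<in>cone u s \<inter> cone v s. exp (log_gain (y i))) = exp (\<Sum>i\<in>cone u s \<inter> cone v s. log_gain (y i))"
    by (simp add: exp_sum)
  also have "outer_lik s v u y * \<dots> \<le> outer_lik s v u y * exp (\<Sum>i\<in>cone v t. log_gain (y i))"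
    using cone_mono[OF assms, of v]
    by (intro mult_left_mono less_imp_le[OF outer_lik_pos])
       (auto intro!: sum_mono2 simp: log_gain_nonneg)
  finally show ?thesis .
qed

lemma nn_integral_outer_lik: "(\<integral>\<^sup>+ y. ennreal (outer_lik t v u y) \<partial>law v) = 1"
proof -
  have "(\<integral>\<^sup>+ y. ennreal (outer_lik t v u y) \<partial>law v)
      = (\<integral>\<^sup>+ y. (\<Prod>i\<in>cone u t - cone v t. ennreal (q (y i))) \<partial>law v)"
    unfolding outer_lik_def prod_q_ennreal ..
  also have "\<dots> = (\<Prod>i\<in>cone u t - cone v t. \<integral>\<^sup>+ x. ennreal (q x) \<partial>vertex_law v i)"
    by (rule nn_integral_signal_prod) (auto intro!: measurable_compose[OF q_meas measurable_ennreal])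
  also have "\<dots> = 1"
    by (intro prod.neutral) (auto simp: vertex_law_not_cone nn_integral_q)
  finally show ?thesis .
qed

lemma outer_lik_sum_tail:
  fixes v :: "int ^ 'd::finite"
  assumes "0 < a"
  shows "measure (law v)
      {y \<in> space fields. \<exists>s\<le>t. a * real (card (sources n :: (int ^ 'd) set)) \<le> (\<Sum>u\<in>sources n. outer_lik s v u y)}
    \<le> real (Suc t) / a"
proof -
  interpret K: prob_space "law v" by (rule prob_space_signal)
  let ?c = "real (card (sources n :: (int ^ 'd) set))"
  let ?E = "\<lambda>s. {y \<in> space fields. a * ?c \<le> (\<Sum>u\<in>sources n. outer_lik s v u y)}"
  have c: "0 < ?c" using card_sources_pos[where 'd='d, of n] by simp
  have sM: "(\<lambda>y. \<Sum>u\<in>sources n. outer_lik s v u y) \<in> borel_measurable fields" for s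
    by (intro borel_measurable_sum outer_lik_measurable)
  have E: "?E s \<in> sets (law v)" for s
    unfolding sets_signal by (intro borel_measurable_le borel_measurable_const sM)
  have one: "measure (law v) (?E s) \<le> 1 / a" for s
  proof -
    have "(\<integral>\<^sup>+ y. ennreal (\<Sum>u\<in>sources n. outer_lik s v u y) \<partial>law v)
        = (\<Sum>u\<in>sources n. \<integral>\<^sup>+ y. ennreal (outer_lik s v u y) \<partial>law v)"
      by (subst nn_integral_sum[symmetric])
         (auto simp: less_imp_le[OF outer_lik_pos] intro!: signal_measurable outer_lik_measurable)
    also have "\<dots> = ennreal ?c" by (simp add: nn_integral_outer_lik ennreal_of_nat_eq_real_of_nat)
    finally have "measure (law v) (?E s) \<le> ?c / (a * ?c)"
      using c assms by (intro markov_signal[OF sM]) auto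
    then show ?thesis using c by simp
  qed
  have "{y \<in> space fields. \<exists>s\<le>t. a * ?c \<le> (\<Sum>u\<in>sources n. outer_lik s v u y)} = (\<Union>s\<le>t. ?E s)" by auto
  also have "measure (law v) (\<Union>s\<le>t. ?E s) \<le> (\<Sum>s\<le>t. measure (law v) (?E s))"
    by (intro measure_UNION_le E) auto
  also have "\<dots> \<le> (\<Sum>s\<le>t. 1 / a)" by (intro sum_mono one)
  finally show ?thesis by simp
qed

section \<open>Vertices that look like a source\<close>

text \<open>Requiring each single signal to favour u, instead of bounding only the product, gives
  likelihood at least one at all earlier times simultaneously and an event that factorises over the
  cone.\<close>

definition lucky :: "nat \<Rightarrow> int ^ 'd::finite \<Rightarrow> ((int ^ 'd) \<times> nat \<Rightarrow> 'b) set"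
  where "lucky t u = {y \<in> space fields. \<forall>i\<in>cone u t. 1 \<le> q (y i)}"

lemma lucky_lik_ge_1: "y \<in> lucky t u \<Longrightarrow> s \<le> t \<Longrightarrow> 1 \<le> lik q s u y"
  unfolding lik_def lucky_def using cone_mono[of s t u] by (intro prod_ge_1) auto

lemma emeasure_all_ge_1:
  assumes "finite S"
  shows "{y \<in> space fields. \<forall>i\<in>S. 1 \<le> q (y i)} \<in> sets fields"
    and "measure (law v) {y \<in> space fields. \<forall>i\<in>S. 1 \<le> q (y i)}
      = (\<Prod>i\<in>S. measure (vertex_law v i) {x \<in> space Q\<^sub>0. 1 \<le> q x})"
proof -
  have A: "{x \<in> space Q\<^sub>0. 1 \<le> q x} \<in> sets Q\<^sub>0" by measurable
  interpret P: product_prob_space "vertex_law v" UNIV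
    by (intro product_prob_spaceI prob_space_vertex_law)
  have eq: "{y \<in> space fields. \<forall>i\<in>S. 1 \<le> q (y i)} = P.emb UNIV S (Pi\<^sub>E S (\<lambda>_. {x \<in> space Q\<^sub>0. 1 \<le> q x}))"
    using sets_eq_imp_space_eq[OF sets_vertex_law[of v]]
    by (auto simp: prod_emb_def space_PiM PiE_iff)
  show "{y \<in> space fields. \<forall>i\<in>S. 1 \<le> q (y i)} \<in> sets fields"
    unfolding sets_signal[of v, symmetric] signal_law_eq eq using assms A
    by (intro sets_PiM_I) (auto simp: sets_vertex_law)
  show "measure (law v) {y \<in> space fields. \<forall>i\<in>S. 1 \<le> q (y i)}
      = (\<Prod>i\<in>S. measure (vertex_law v i) {x \<in> space Q\<^sub>0. 1 \<le> q x})"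
    unfolding signal_law_eq eq using assms A
    by (intro P.measure_PiM_emb) (auto simp: sets_vertex_law)
qed

lemma lucky_sets: "lucky t u \<in> sets (law v)"
  unfolding lucky_def sets_signal by (rule emeasure_all_ge_1(1)) simp

text \<open>The constant p serves both signal laws, so the position of u relative to the source is
  irrelevant.\<close>

lemma lucky_prob_ge:
  fixes u v :: "int ^ 'd::finite"
  assumes p: "0 \<le> p" "p \<le> measure Q\<^sub>0 {x \<in> space Q\<^sub>0. 1 \<le> q x}" "p \<le> measure Q\<^sub>1 {x \<in> space Q\<^sub>0. 1 \<le> q x}"
  shows "p ^ growth TYPE('d) t \<le> measure (law v) (lucky t u)"
proof -
  have "p ^ growth TYPE('d) t = (\<Prod>i\<in>cone u t. p)" by (simp add: card_cone)
  also have "\<dots> \<le> (\<Prod>i\<in>cone u t. measure (vertex_law v i) {x \<in> space Q\<^sub>0. 1 \<le> q x})"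
    using p by (intro prod_mono) (auto simp: vertex_law_def)
  finally show ?thesis unfolding lucky_def by (subst emeasure_all_ge_1(2)) auto
qed

lemma lucky_indep:
  assumes "2 * t < ldist u u'"
  shows "measure (law v) (lucky t u \<inter> lucky t u')
    = measure (law v) (lucky t u) * measure (law v) (lucky t u')"
proof -
  have "lucky t u \<inter> lucky t u' = {y \<in> space fields. \<forall>i\<in>cone u t \<union> cone u' t. 1 \<le> q (y i)}"
    by (auto simp: lucky_def)
  then show ?thesis
    using cone_disjoint[OF assms, of t] by (simp add: lucky_def emeasure_all_ge_1(2) prod.union_disjoint)
qed

text \<open>The second moment method; events of vertices farther apart than \<open>2t\<close> are independent.\<close>

lemma lucky_count_tail:
  fixes v :: "int ^ 'd::finite" and t :: nat
  assumes p: "0 < p" "p \<le> measure Q\<^sub>0 {x \<in> space Q\<^sub>0. 1 \<le> q x}" "p \<le> measure Q\<^sub>1 {x \<in> space Q\<^sub>0. 1 \<le> q x}"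
    and U: "finite U" "U \<noteq> {}"
  defines "b \<equiv> real (card U) * p ^ growth TYPE('d) t"
  shows "measure (law v) {y \<in> space fields. (\<Sum>u\<in>U. indicator (lucky t u) y) \<le> b / 2}
    \<le> 4 * (4 * real t + 1) ^ CARD('d) / b"
proof -
  let ?K = "law v"
  interpret K: prob_space ?K by (rule prob_space_signal)
  define Z :: "_ \<Rightarrow> real" where "Z y = (\<Sum>u\<in>U. indicator (lucky t u) y)" for y
  define \<mu> where "\<mu> = (\<Sum>u\<in>U. measure ?K (lucky t u))"
  define C where "C = (4 * real t + 1) ^ CARD('d)"
  have iM: "(indicator (lucky t u) :: _ \<Rightarrow> real) \<in> borel_measurable ?K" for u
    by (intro borel_measurable_indicator lucky_sets)
  have iint: "integrable ?K (indicator (lucky t u) :: _ \<Rightarrow> real)" for u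
    by (intro K.integrable_const_bound[of _ 1] iM AE_I2) (simp add: indicator_def)
  have sp: "lucky t u \<inter> space ?K = lucky t u" for u by (auto simp: lucky_def space_signal)
  have ZM: "Z \<in> borel_measurable ?K" unfolding Z_def by (intro borel_measurable_sum iM)
  have EZ: "K.expectation Z = \<mu>"
    unfolding Z_def \<mu>_def
    by (subst Bochner_Integration.integral_sum[OF iint]) (simp add: sp)
  have Z2: "(Z y)\<^sup>2 = (\<Sum>u\<in>U. \<Sum>u'\<in>U. indicator (lucky t u \<inter> lucky t u') y)" for y
    unfolding Z_def power2_eq_square sum_product by (simp add: indicator_inter_arith)
  have i2: "integrable ?K (indicator (lucky t u \<inter> lucky t u') :: _ \<Rightarrow> real)" for u u'
    by (intro K.integrable_const_bound[of _ 1] AE_I2 borel_measurable_indicator sets.Int lucky_sets) (simp add: indicator_def)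
  have Z2int: "integrable ?K (\<lambda>y. (Z y)\<^sup>2)"
    unfolding Z2 by (intro Bochner_Integration.integrable_sum i2)
  have EZ2: "K.expectation (\<lambda>y. (Z y)\<^sup>2) = (\<Sum>u\<in>U. \<Sum>u'\<in>U. measure ?K (lucky t u \<inter> lucky t u'))"
  proof -
    have "K.expectation (\<lambda>y. (Z y)\<^sup>2) = (\<Sum>u\<in>U. K.expectation (\<lambda>y. \<Sum>u'\<in>U. indicator (lucky t u \<inter> lucky t u') y))"
      unfolding Z2 by (intro Bochner_Integration.integral_sum Bochner_Integration.integrable_sum i2)
    also have "\<dots> = (\<Sum>u\<in>U. \<Sum>u'\<in>U. measure ?K (lucky t u \<inter> lucky t u'))"
      by (intro sum.cong refl, subst Bochner_Integration.integral_sum[OF i2]) (simp add: sp Int_assoc)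
    finally show ?thesis .
  qed
  \<comment> \<open>Far pairs contribute no covariance, and near pairs at most the probability of
    one event; each vertex has only polynomially many near partners.\<close>
  have pair: "measure ?K (lucky t u \<inter> lucky t u') \<le> measure ?K (lucky t u) * measure ?K (lucky t u')
      + (if ldist u' u \<le> 2 * t then measure ?K (lucky t u) else 0)" for u u'
  proof (cases "ldist u' u \<le> 2 * t")
    case True
    have "measure ?K (lucky t u \<inter> lucky t u') \<le> measure ?K (lucky t u)"
      by (intro K.finite_measure_mono lucky_sets) auto
    then show ?thesis using True by (simp add: add_increasing)
  next
    case False
    then show ?thesis by (simp add: lucky_indep ldist_commute)
  qed
  have "K.expectation (\<lambda>y. (Z y)\<^sup>2) \<le> (\<Sum>u\<in>U. \<Sum>u'\<in>U. measure ?K (lucky t u) * measure ?K (lucky t u')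
      + (if ldist u' u \<le> 2 * t then measure ?K (lucky t u) else 0))"
    unfolding EZ2 by (intro sum_mono pair)
  also have "\<dots> = \<mu>\<^sup>2 + (\<Sum>u\<in>U. real (card {u'\<in>U. ldist u' u \<le> 2 * t}) * measure ?K (lucky t u))"
    using U by (simp add: sum.distrib \<mu>_def power2_eq_square sum_product sum.If_cases Int_def conj_commute)
  also have "(\<Sum>u\<in>U. real (card {u'\<in>U. ldist u' u \<le> 2 * t}) * measure ?K (lucky t u)) \<le> (\<Sum>u\<in>U. C * measure ?K (lucky t u))"
  proof (intro sum_mono mult_right_mono)
    fix u
    have "card {u'\<in>U. ldist u' u \<le> 2 * t} \<le> card {u'. ldist u' u \<le> 2 * t}" by (intro card_mono) auto
    also have "\<dots> \<le> (2 * (2 * t) + 1) ^ CARD('d)" unfolding card_ldist_ball by (rule ball_size_le)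
    finally have "real (card {u'\<in>U. ldist u' u \<le> 2 * t}) \<le> real ((2 * (2 * t) + 1) ^ CARD('d))" by (subst of_nat_le_iff)
    then show "real (card {u'\<in>U. ldist u' u \<le> 2 * t}) \<le> C" by (simp add: C_def add.commute)
  qed auto
  also have "(\<Sum>u\<in>U. C * measure ?K (lucky t u)) = C * \<mu>" by (simp add: \<mu>_def sum_distrib_left)
  finally have var: "K.variance Z \<le> C * \<mu>"
    using K.variance_eq[OF _ Z2int] EZ iint by (simp add: Z_def[abs_def])
  have b0: "0 < b" using p U by (simp add: b_def card_gt_0_iff)
  have "(\<Sum>u\<in>U. p ^ growth TYPE('d) t) \<le> \<mu>"
    unfolding \<mu>_def using p by (intro sum_mono lucky_prob_ge) auto
  then have b\<mu>: "b \<le> \<mu>" by (simp add: b_def)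
  with b0 have \<mu>0: "0 < \<mu>" by linarith
  \<comment> \<open>b is only a lower bound for the mean \<mu>, so a count of at most b / 2 deviates
    from \<mu> by at least \<mu> / 2.\<close>
  have "measure ?K {y \<in> space fields. Z y \<le> b / 2} \<le> measure ?K {y \<in> space ?K. \<mu> / 2 \<le> \<bar>Z y - K.expectation Z\<bar>}"
  proof (intro K.finite_measure_mono)
    show "{y \<in> space fields. Z y \<le> b / 2} \<subseteq> {y \<in> space ?K. \<mu> / 2 \<le> \<bar>Z y - K.expectation Z\<bar>}"
      unfolding EZ using b\<mu> \<mu>0 by (auto simp: space_signal abs_if)
    show "{y \<in> space ?K. \<mu> / 2 \<le> \<bar>Z y - K.expectation Z\<bar>} \<in> sets ?K" using ZM by measurable
  qed
  also have "\<dots> \<le> K.variance Z / (\<mu> / 2)\<^sup>2"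
    using \<mu>0 by (intro K.Chebyshev_inequality ZM Z2int) auto
  also have "\<dots> \<le> C * \<mu> / (\<mu> / 2)\<^sup>2" by (intro divide_right_mono var) auto
  also have "\<dots> = 4 * C / \<mu>" using \<mu>0 by (simp add: power2_eq_square field_simps)
  also have "\<dots> \<le> 4 * C / b" using b0 b\<mu> \<mu>0 by (intro divide_left_mono) (auto simp: C_def)
  finally show ?thesis by (simp add: Z_def C_def)
qed

end

section \<open>Asymptotic bounds\<close>

lemma poly_exp_decay:
  fixes a C :: real
  assumes "0 < a"
  shows "((\<lambda>x. C * x ^ k * exp (- (a * x))) \<longlongrightarrow> 0) at_top"
proof -
  have "filterlim (\<lambda>x :: real. a * x) at_top at_top"
    using assms by (intro filterlim_tendsto_pos_mult_at_top[OF tendsto_const]) (auto intro: filterlim_ident)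
  from filterlim_compose[OF tendsto_power_div_exp_0 this, of k]
  have "((\<lambda>x. C / a ^ k * ((a * x) ^ k / exp (a * x))) \<longlongrightarrow> C / a ^ k * 0) at_top"
    by (intro tendsto_mult tendsto_const)
  moreover have "C / a ^ k * ((a * x) ^ k / exp (a * x)) = C * x ^ k * exp (- (a * x))" for x
    using assms by (simp add: power_mult_distrib exp_minus field_simps)
  ultimately show ?thesis by simp
qed

lemma poly_exp_decay_ln:
  fixes a C \<eta> :: real
  assumes "0 < a" "0 < \<eta>"
  shows "\<forall>\<^sub>F n in sequentially. C * ln (real n) ^ k * exp (- (a * ln (real n))) < \<eta>"
proof -
  have "filterlim (\<lambda>n. ln (real n)) at_top sequentially"
    by (rule filterlim_compose[OF ln_at_top filterlim_real_sequentially])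
  from filterlim_compose[OF poly_exp_decay[OF assms(1)] this]
  show ?thesis using assms(2) by (rule order_tendstoD)
qed

lemma eventually_ln_ge: "\<forall>\<^sub>F n in sequentially. c \<le> ln (real n)"
proof -
  have "filterlim (\<lambda>n. ln (real n)) at_top sequentially"
    by (rule filterlim_compose[OF ln_at_top filterlim_real_sequentially])
  then show ?thesis by (simp add: filterlim_at_top)
qed

lemma poly_times_power_tendsto_0:
  fixes \<rho> :: real
  assumes "0 < \<rho>" "\<rho> < 1"
  shows "(\<lambda>r. (4 * real r + 1) ^ k * (2 * real r)\<^sup>2 * \<rho> ^ r) \<longlonglongrightarrow> 0"
proof -
  \<comment> \<open>With this root, each of the k + 2 linear factors receives its own geometric
    factor.\<close>
  define \<sigma> where "\<sigma> = root (k + 2) \<rho>"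
  have \<sigma>: "0 < \<sigma>" "\<sigma> < 1" "\<sigma> ^ (k + 2) = \<rho>"
    using assms by (simp_all add: \<sigma>_def del: add_2_eq_Suc')
  have "(\<lambda>r. 5 * (real r * \<sigma> ^ r)) \<longlonglongrightarrow> 5 * 0"
    using \<sigma> by (intro tendsto_mult tendsto_const powser_times_n_limit_0) auto
  then have "(\<lambda>r. (5 * (real r * \<sigma> ^ r)) ^ (k + 2)) \<longlonglongrightarrow> (5 * 0) ^ (k + 2)"
    by (rule tendsto_power)
  then have lim: "(\<lambda>r. (5 * (real r * \<sigma> ^ r)) ^ (k + 2)) \<longlonglongrightarrow> 0" by simp
  show ?thesis
  proof (rule tendsto_sandwich[OF _ _ tendsto_const lim])
    show "\<forall>\<^sub>F r in sequentially. 0 \<le> (4 * real r + 1) ^ k * (2 * real r)\<^sup>2 * \<rho> ^ r"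
      using assms by (intro always_eventually) auto
    show "\<forall>\<^sub>F r in sequentially. (4 * real r + 1) ^ k * (2 * real r)\<^sup>2 * \<rho> ^ r \<le> (5 * (real r * \<sigma> ^ r)) ^ (k + 2)"
      using eventually_ge_at_top[of 1]
    proof eventually_elim
      case (elim r)
      have "(4 * real r + 1) ^ k * (2 * real r)\<^sup>2 * \<rho> ^ r \<le> (5 * real r) ^ k * (5 * real r)\<^sup>2 * \<rho> ^ r"
        using elim assms by (intro mult_right_mono mult_mono power_mono) auto
      also have "\<dots> = (5 * (real r * \<sigma> ^ r)) ^ (k + 2)"
      proof -
        have "\<rho> ^ r = (\<sigma> ^ r) ^ (k + 2)" using \<sigma>(3) by (metis mult.commute power_mult)
        then show ?thesis by (simp only: power_mult_distrib power_add mult_ac)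
      qed
      finally show ?case .
    qed
  qed
qed

lemma power_eq_exp_ln: "0 < x \<Longrightarrow> x ^ k = exp (- (ln (1 / x) * real k))" for x :: real
  by (simp add: ln_div exp_of_nat2_mult)

context signal_model
begin

lemma log_gain_truncation:
  assumes "integrable Q\<^sub>1 log_gain" "0 < \<delta>"
  obtains K where "0 \<le> K" "(\<integral>\<^sup>+ x. ennreal (if log_gain x > K then log_gain x else 0) \<partial>Q\<^sub>1) \<le> ennreal \<delta>"
proof -
  define f where "f k x = (if log_gain x > real k then log_gain x else 0)" for k :: nat and x
  have lM: "log_gain \<in> borel_measurable Q\<^sub>1" using assms(1) by auto
  have fM: "f k \<in> borel_measurable Q\<^sub>1" for k
    unfolding f_def using lM by measurable
  have f0: "0 \<le> f k x" for k x by (simp add: f_def log_gain_nonneg)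
  have "(\<lambda>k. \<integral>x. f k x \<partial>Q\<^sub>1) \<longlonglongrightarrow> (\<integral>x. 0 \<partial>Q\<^sub>1)"
  proof (rule integral_dominated_convergence[where w = log_gain])
    show "AE x in Q\<^sub>1. (\<lambda>k. f k x) \<longlonglongrightarrow> 0"
    proof (intro AE_I2 tendsto_eventually)
      fix x
      show "\<forall>\<^sub>F k in sequentially. f k x = 0"
        using eventually_ge_at_top[of "nat \<lceil>log_gain x\<rceil>"]
        by eventually_elim (auto simp: f_def not_less ceiling_le_iff nat_le_iff)
    qed
    show "AE x in Q\<^sub>1. norm (f k x) \<le> log_gain x" for k
      by (simp add: f_def log_gain_nonneg)
  qed (simp_all add: fM assms(1))
  then have "\<forall>\<^sub>F k in sequentially. (\<integral>x. f k x \<partial>Q\<^sub>1) < \<delta>"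
    using assms(2) by (intro order_tendstoD) auto
  then obtain k where k: "(\<integral>x. f k x \<partial>Q\<^sub>1) < \<delta>" by (auto simp: eventually_sequentially)
  have "integrable Q\<^sub>1 (f k)"
    by (rule Bochner_Integration.integrable_bound[OF assms(1) fM]) (auto simp: f_def log_gain_nonneg)
  from nn_integral_eq_integral[OF this] have "(\<integral>\<^sup>+ x. ennreal (f k x) \<partial>Q\<^sub>1) = ennreal (\<integral>x. f k x \<partial>Q\<^sub>1)"
    by (simp add: f0)
  also have "\<dots> \<le> ennreal \<delta>" using k by (intro ennreal_leI) simp
  finally show ?thesis using that[of "real k"] by (simp add: f_def)
qed

text \<open>Whatever the sign of the i-th coordinate of the posterior mean, the group on the other
  side stays at distance at least r from it.\<close>

lemma pvar_ge_spread:
  fixes y :: "(int ^ 'd::finite) \<times> nat \<Rightarrow> 'b"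
  assumes G1: "G\<^sub>1 \<subseteq> sources n" "\<And>u. u \<in> G\<^sub>1 \<Longrightarrow> r \<le> embed u $ i" "a \<le> (\<Sum>u\<in>G\<^sub>1. post q n s u y)"
    and G2: "G\<^sub>2 \<subseteq> sources n" "\<And>u. u \<in> G\<^sub>2 \<Longrightarrow> embed u $ i \<le> - r" "a \<le> (\<Sum>u\<in>G\<^sub>2. post q n s u y)"
    and r: "0 \<le> r"
  shows "a * r\<^sup>2 \<le> pvar q n s y"
proof -
  have key: "a * r\<^sup>2 \<le> pvar q n s y"
    if G: "G \<subseteq> sources n" "a \<le> (\<Sum>u\<in>G. post q n s u y)"
      and far: "\<And>u. u \<in> G \<Longrightarrow> r \<le> \<bar>embed u $ i - pmean q n s y $ i\<bar>" for G :: "(int ^ 'd) set"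
  proof -
    have "a * r\<^sup>2 \<le> (\<Sum>u\<in>G. post q n s u y) * r\<^sup>2" using G by (intro mult_right_mono) auto
    also have "\<dots> = (\<Sum>u\<in>G. post q n s u y * r\<^sup>2)" by (simp add: sum_distrib_right)
    also have "\<dots> \<le> (\<Sum>u\<in>G. post q n s u y * (norm (embed u - pmean q n s y))\<^sup>2)"
    proof (intro sum_mono mult_left_mono power_mono)
      fix u assume "u \<in> G"
      from far[OF this] component_le_norm_cart[of "embed u - pmean q n s y" i]
      show "r \<le> norm (embed u - pmean q n s y)" by simp
    qed (auto simp: post_nonneg r)
    also have "\<dots> \<le> pvar q n s y"
      unfolding pvar_def using G by (intro sum_mono2) (auto simp: post_nonneg)
    finally show ?thesis .
  qed
  show ?thesis
  proof (cases "pmean q n s y $ i \<le> 0")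
    case True
    have "r \<le> \<bar>embed u $ i - pmean q n s y $ i\<bar>" if "u \<in> G\<^sub>1" for u using G1(2)[OF that] True by linarith
    then show ?thesis by (intro key[OF G1(1,3)])
  next
    case False
    have "r \<le> \<bar>embed u $ i - pmean q n s y $ i\<bar>" if "u \<in> G\<^sub>2" for u using G2(2)[OF that] False by linarith
    then show ?thesis by (intro key[OF G2(1,3)])
  qed
qed

text \<open>Each lucky vertex adds at least 1 to the numerator, and the denominator is bounded by
  \<open>lik_le_outer_lik\<close>. Luck and log gains are taken at the later time k, so both apply
  to every s up to k.\<close>

lemma post_sum_ge:
  fixes y :: "(int ^ 'd::finite) \<times> nat \<Rightarrow> 'b"
  assumes "s \<le> k" and G: "G \<subseteq> sources n"
    and y: "y \<in> space fields" and z: "0 \<le> z" "z \<le> (\<Sum>u\<in>G. indicator (lucky k u) y)"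
    and E: "(\<Sum>i\<in>cone v k. log_gain (y i)) \<le> e" and A: "(\<Sum>u\<in>sources n. outer_lik s v u y) \<le> A"
  shows "z / (A * exp e) \<le> (\<Sum>u\<in>G. post q n s u y)"
proof -
  have finG: "finite G" by (rule finite_subset[OF G]) simp
  have "z \<le> (\<Sum>u\<in>G. lik q s u y)"
    using lucky_lik_ge_1[of y k _ s] assms(1) less_imp_le[OF lik_pos]
    by (intro order.trans[OF z(2)] sum_mono) (auto simp: indicator_def)
  moreover have "(\<Sum>u\<in>sources n. lik q s u y) \<le> A * exp e"
  proof -
    have "(\<Sum>u\<in>sources n. lik q s u y) \<le> (\<Sum>u\<in>sources n. outer_lik s v u y * exp (\<Sum>i\<in>cone v k. log_gain (y i)))"
      by (intro sum_mono lik_le_outer_lik assms)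
    also have "\<dots> = (\<Sum>u\<in>sources n. outer_lik s v u y) * exp (\<Sum>i\<in>cone v k. log_gain (y i))"
      by (simp add: sum_distrib_right)
    also have "\<dots> \<le> A * exp e"
      using E A by (intro mult_mono) (auto intro!: sum_nonneg less_imp_le[OF outer_lik_pos] intro: order.trans[OF _ A])
    finally show ?thesis .
  qed
  ultimately have "z / (A * exp e) \<le> (\<Sum>u\<in>G. lik q s u y) / (\<Sum>u\<in>sources n. lik q s u y)"
    using z(1) sum_lik_pos[of s y n] by (intro frac_le) auto
  then show ?thesis by (simp add: post_def sum_divide_distrib)
qed

text \<open>The conditional expectation refers to the mixture, where Markov's inequality applies;
  restricting to the source v costs the number of sources as a factor, and a union over the times up
  to k the other.\<close>

lemma cond_pvar_tail:
  fixes v :: "int ^ 'd::finite"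
  assumes v: "v \<in> sources n" and c: "0 \<le> c"
    and le: "\<And>w :: int ^ 'd. w \<in> sources n \<Longrightarrow> (\<integral>\<^sup>+ y. ennreal (pvar q n t y) \<partial>law w) \<le> ennreal c"
  shows "measure (law v) {y \<in> space fields. \<exists>s\<le>k. 1 \<le> real_cond_exp (joint n)
      (obs n s) (\<lambda>\<omega>. pvar q n t (snd \<omega>)) (v, y)}
    \<le> real (Suc k) * real (card (sources n :: (int ^ 'd) set)) * c"
proof -
  let ?M = "joint n :: ('d, 'b) outcome measure"
  let ?c = "real (card (sources n :: (int ^ 'd) set))"
  define G where "G s = real_cond_exp ?M (obs n s) (\<lambda>\<omega>. pvar q n t (snd \<omega>))" for s
  interpret M: prob_space ?M by (rule prob_space_cascade)
  interpret K: prob_space "law v" by (rule prob_space_signal)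
  have c0: "0 < ?c" using card_sources_pos[where 'd='d, of n] by simp
  have pM: "(\<lambda>\<omega>. pvar q n t (snd \<omega>)) \<in> borel_measurable ?M" by (rule pvar_measurable_cascade)
  have pint: "integrable ?M (\<lambda>\<omega>. pvar q n t (snd \<omega>))"
  proof (intro M.integrable_const_bound[where B = "(2 * radius TYPE('d) n)\<^sup>2"] pM AE_I2)
    show "norm (pvar q n t (snd \<omega>)) \<le> (2 * radius TYPE('d) n)\<^sup>2" for \<omega> :: "('d, 'b) outcome"
      using pvar_nonneg[of n t "snd \<omega>"] pvar_le[of n t "snd \<omega>"] by simp
  qed
  have tot: "(\<integral>\<^sup>+ \<omega>. ennreal (pvar q n t (snd \<omega>)) \<partial>?M) \<le> ennreal c"
  proof -
    have "(\<integral>\<^sup>+ \<omega>. ennreal (pvar q n t (snd \<omega>)) \<partial>?M)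
        = (\<Sum>w\<in>(sources n :: (int ^ 'd) set). \<integral>\<^sup>+ y. ennreal (pvar q n t y) \<partial>law w) / of_nat (card (sources n :: (int ^ 'd) set))"
      by (subst nn_integral_cascade[OF measurable_compose[OF pM measurable_ennreal]]) simp
    also have "\<dots> \<le> (\<Sum>w\<in>(sources n :: (int ^ 'd) set). ennreal c) / of_nat (card (sources n :: (int ^ 'd) set))"
      by (intro divide_right_mono_ennreal sum_mono le)
    also have "\<dots> = ennreal (?c * c) / ennreal ?c"
      using c by (simp add: ennreal_mult ennreal_of_nat_eq_real_of_nat)
    also have "\<dots> = ennreal c" using c c0 by (subst divide_ennreal) auto
    finally show ?thesis .
  qed
  have one: "measure (law v) {y \<in> space fields. 1 \<le> G s (v, y)} \<le> ?c * c"
    and Eset: "{y \<in> space fields. 1 \<le> G s (v, y)} \<in> sets (law v)" for s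
  proof -
    interpret F: finite_measure_subalgebra ?M "obs n s" by (rule finite_measure_subalgebra_obs)
    have GM: "G s \<in> borel_measurable ?M" unfolding G_def by (rule borel_measurable_cond_exp2)
    have Gint: "integrable ?M (G s)" unfolding G_def by (rule F.real_cond_exp_int(1)[OF pint])
    have G0: "AE \<omega> in ?M. 0 \<le> G s \<omega>"
      unfolding G_def by (rule F.real_cond_exp_pos[OF _ pM]) (simp add: pvar_nonneg)
    have "(\<integral>\<^sup>+ \<omega>. ennreal (G s \<omega>) \<partial>?M) = ennreal (\<integral>\<omega>. G s \<omega> \<partial>?M)"
      by (rule nn_integral_eq_integral[OF Gint G0])
    also have "(\<integral>\<omega>. G s \<omega> \<partial>?M) = (\<integral>\<omega>. pvar q n t (snd \<omega>) \<partial>?M)"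
      unfolding G_def by (rule F.real_cond_exp_int(2)[OF pint])
    also have "ennreal (\<integral>\<omega>. pvar q n t (snd \<omega>) \<partial>?M) = (\<integral>\<^sup>+ \<omega>. ennreal (pvar q n t (snd \<omega>)) \<partial>?M)"
      by (rule nn_integral_eq_integral[OF pint, symmetric]) (simp add: pvar_nonneg)
    finally have "(\<integral>\<^sup>+ \<omega>. ennreal (G s \<omega>) \<partial>?M) \<le> ennreal c" using tot by simp
    then have m1: "measure ?M {\<omega> \<in> space ?M. 1 \<le> G s \<omega>} \<le> c"
      using M.markov_nn_integral[OF GM _ c, of 1] by simp
    let ?A = "{\<omega> \<in> space ?M. 1 \<le> G s \<omega>}"
    have A: "?A \<in> sets ?M" by (intro borel_measurable_le borel_measurable_const GM)
    have eq: "{y \<in> space fields. (v, y) \<in> ?A} = {y \<in> space fields. 1 \<le> G s (v, y)}"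
      by (auto simp: space_cascade)
    have A': "?A \<in> sets (count_space UNIV \<Otimes>\<^sub>M fields)" using A unfolding sets_cascade .
    have "Pair v -` ?A \<inter> space (law v) \<in> sets (law v)"
      by (rule measurable_sets[OF measurable_Pair_signal A'])
    also have "Pair v -` ?A \<inter> space (law v) = {y \<in> space fields. 1 \<le> G s (v, y)}"
      by (auto simp: space_cascade space_signal)
    finally show "{y \<in> space fields. 1 \<le> G s (v, y)} \<in> sets (law v)" .
    have "measure (law v) {y \<in> space fields. 1 \<le> G s (v, y)} / ?c = measure ?M {\<omega> \<in> ?A. fst \<omega> = v}"
      using measure_cascade_source[OF v A] unfolding eq by simp
    also have "\<dots> \<le> measure ?M ?A" by (rule M.finite_measure_mono[OF _ A]) auto
    also have "\<dots> \<le> c" by (rule m1)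
    finally show "measure (law v) {y \<in> space fields. 1 \<le> G s (v, y)} \<le> ?c * c"
      using c0 by (simp add: divide_le_eq mult.commute)
  qed
  have "{y \<in> space fields. \<exists>s\<le>k. 1 \<le> G s (v, y)} = (\<Union>s\<le>k. {y \<in> space fields. 1 \<le> G s (v, y)})" by auto
  also have "measure (law v) \<dots> \<le> (\<Sum>s\<le>k. measure (law v) {y \<in> space fields. 1 \<le> G s (v, y)})"
    by (intro measure_UNION_le Eset) auto
  also have "\<dots> \<le> (\<Sum>s\<le>k. ?c * c)" by (intro sum_mono one)
  finally show ?thesis by (simp add: G_def algebra_simps)
qed

section \<open>Choice of constants for the upper bound\<close>

lemma upper_bound:
  assumes \<rho>: "0 < \<rho>" "\<rho> < 1" "(\<integral>\<^sup>+ x. ennreal (sqrt (q x)) \<partial>Q\<^sub>0) \<le> ennreal \<rho>"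
  obtains \<Delta> :: real where "0 < \<Delta>"
    "\<forall>\<eta>>0. \<forall>\<^sub>F n in sequentially. \<exists>s. real (growth TYPE('d::finite) s) \<le> \<Delta> * ln (real n) \<and>
      (\<forall>v\<in>(sources n :: (int ^ 'd) set). measure (law v) {y \<in> space fields. 1 \<le> pvar q n s y} \<le> \<eta>)"
proof -
  let ?d = "CARD('d)"
  \<comment> \<open>Then \<rho> to the power \<open>\<kappa> * ln n\<close> is n to the power -4,
    which beats the n^3 in \<open>sum_pvar_bound\<close>.\<close>
  define \<kappa> where "\<kappa> = 4 / ln (1 / \<rho>)"
  have l\<rho>: "0 < ln (1 / \<rho>)" using \<rho> by simp
  have \<kappa>: "0 < \<kappa>" using l\<rho> by (simp add: \<kappa>_def)
  define c where "c = real (Suc ?d) * real ?d ^ ?d"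
  have c: "0 < c" by (simp add: c_def)
  \<comment> \<open>The variance is evaluated at time 2r, whose growth is at most (5r)^(d+1); the
    factor c * \<kappa> bounds r^(d+1) relative to \<open>ln n\<close>.\<close>
  define \<Delta> where "\<Delta> = 5 ^ Suc ?d * c * \<kappa>"
  have \<Delta>: "0 < \<Delta>" using \<kappa> c by (simp add: \<Delta>_def)
  have "\<forall>\<^sub>F n in sequentially. \<exists>s. real (growth TYPE('d) s) \<le> \<Delta> * ln (real n) \<and>
      (\<forall>v\<in>(sources n :: (int ^ 'd) set). measure (law v) {y \<in> space fields. 1 \<le> pvar q n s y} \<le> \<eta>)"
    if \<eta>: "0 < \<eta>" for \<eta>
  proof -
    have "\<forall>\<^sub>F r in sequentially. (4 * real r + 1) ^ ?d * (2 * real r)\<^sup>2 * \<rho> ^ r < \<eta> / 2"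
      using order_tendstoD(2)[OF poly_times_power_tendsto_0[OF \<rho>(1,2)], of "\<eta> / 2"] \<eta> by simp
    then obtain r0 where r0: "\<And>r. r0 \<le> r \<Longrightarrow> (4 * real r + 1) ^ ?d * (2 * real r)\<^sup>2 * \<rho> ^ r < \<eta> / 2"
      by (auto simp: eventually_sequentially)
    have "0 < \<eta> / 2" using \<eta> by simp
    from eventually_ln_ge[of "(real (growth TYPE('d) r0) + 1) / \<kappa>"] poly_exp_decay_ln[OF zero_less_one this, of "3 ^ ?d * 4" 0] eventually_ge_at_top[of 1]
    show ?thesis
    proof eventually_elim
      case (elim n)
      let ?L = "ln (real n)"
      have n: "1 \<le> n" by fact
      have L: "real (growth TYPE('d) r0) + 1 \<le> \<kappa> * ?L"
        using elim(1) \<kappa> by (simp add: divide_le_eq mult.commute)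
      \<comment> \<open>The first time at which the growth reaches the level: large enough for
        distant rivals, while its predecessor bounds it from above.\<close>
      define r where "r = (LEAST r. \<kappa> * ?L \<le> real (growth TYPE('d) r))"
      have ex: "\<kappa> * ?L \<le> real (growth TYPE('d) (nat \<lceil>\<kappa> * ?L\<rceil>))"
      proof -
        have "\<kappa> * ?L \<le> real (nat \<lceil>\<kappa> * ?L\<rceil>)" by linarith
        also have "\<dots> \<le> real (growth TYPE('d) (nat \<lceil>\<kappa> * ?L\<rceil>))"
          using growth_ge_Suc[where 'd='d, of "nat \<lceil>\<kappa> * ?L\<rceil>"] by linarith
        finally show ?thesis .
      qed
      have r: "\<kappa> * ?L \<le> real (growth TYPE('d) r)"
        unfolding r_def by (rule LeastI[of "\<lambda>r. \<kappa> * ?L \<le> real (growth TYPE('d) r)", OF ex])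
      have r_less: "real (growth TYPE('d) r') < \<kappa> * ?L" if "r' < r" for r'
        using not_less_Least[OF that[unfolded r_def]] by simp
      \<comment> \<open>The level exceeds \<open>growth r0\<close>. This makes the near part small
        and guarantees that r has a predecessor.\<close>
      have "r0 < r"
      proof (rule ccontr)
        assume "\<not> r0 < r"
        then have "growth TYPE('d) r \<le> growth TYPE('d) r0" by (intro growth_mono) simp
        with r L show False by linarith
      qed
      then obtain r' where r': "r = Suc r'" by (cases r) auto
      have "(real r) ^ Suc ?d / c \<le> real (growth TYPE('d) r')"
        using growth_ge[where 'd='d, of r'] by (simp add: r' c_def add.commute)
      also have "\<dots> < \<kappa> * ?L" by (rule r_less) (simp add: r')
      finally have rpow: "(real r) ^ Suc ?d \<le> c * \<kappa> * ?L" using c by (simp add: divide_less_eq mult_ac del: power_Suc)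
      have "real (growth TYPE('d) (2 * r)) \<le> (2 * real (2 * r) + 1) ^ Suc ?d" by (rule growth_le)
      also have "\<dots> \<le> (5 * real r) ^ Suc ?d" using r' by (intro power_mono) auto
      also have "\<dots> = 5 ^ Suc ?d * real r ^ Suc ?d" by (rule power_mult_distrib)
      also have "\<dots> \<le> 5 ^ Suc ?d * (c * \<kappa> * ?L)" by (intro mult_left_mono rpow) simp
      finally have g: "real (growth TYPE('d) (2 * r)) \<le> \<Delta> * ?L" by (simp add: \<Delta>_def mult_ac del: power_Suc)
      have "\<rho> ^ growth TYPE('d) r = exp (- (ln (1 / \<rho>) * real (growth TYPE('d) r)))"
        by (rule power_eq_exp_ln[OF \<rho>(1)])
      also have "\<dots> \<le> exp (- (ln (1 / \<rho>) * (\<kappa> * ?L)))"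
        using l\<rho> r by simp
      also have "ln (1 / \<rho>) * (\<kappa> * ?L) = 4 * ?L" using l\<rho> by (simp add: \<kappa>_def)
      finally have \<rho>g: "\<rho> ^ growth TYPE('d) r \<le> exp (- (4 * ?L))" .
      have nL: "real n = exp ?L" using n by simp
      have "3 ^ ?d * 4 * real n ^ 3 * \<rho> ^ growth TYPE('d) r \<le> 3 ^ ?d * 4 * real n ^ 3 * exp (- (4 * ?L))"
        by (intro mult_left_mono \<rho>g) auto
      also have "\<dots> = 3 ^ ?d * 4 * (real n ^ 3 * exp (- (4 * ?L)))" by (simp only: mult.assoc)
      also have "real n ^ 3 * exp (- (4 * ?L)) = exp (- ?L)"
        by (subst nL) (simp add: exp_of_nat_mult[symmetric] exp_add[symmetric] del: exp_ln)
      also have "3 ^ ?d * 4 * exp (- ?L) \<le> \<eta> / 2" using elim(2) by simp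
      finally have far: "3 ^ ?d * 4 * real n ^ 3 * \<rho> ^ growth TYPE('d) r \<le> \<eta> / 2" .
      have "measure (law v) {y \<in> space fields. 1 \<le> pvar q n (2 * r) y} \<le> \<eta>"
        if v: "v \<in> sources n" for v :: "int ^ 'd"
      proof -
        let ?S = "\<Sum>u\<in>sources n - {v}. \<rho> ^ card (cone u (2 * r) - cone v (2 * r)) * (norm (embed u - embed v))\<^sup>2"
        have "measure (law v) {y \<in> space fields. 1 \<le> pvar q n (2 * r) y} \<le> ?S / 1"
          using \<rho> by (intro markov_signal pvar_measurable nn_integral_pvar_le v sum_nonneg) auto
        also have "?S \<le> (4 * real r + 1) ^ ?d * (2 * real r)\<^sup>2 * \<rho> ^ r + 3 ^ ?d * 4 * real n ^ 3 * \<rho> ^ growth TYPE('d) r"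
          by (rule sum_pvar_bound[OF \<rho>(1,2) v n])
        finally show ?thesis using r0[of r] \<open>r0 < r\<close> far by simp
      qed
      with g show ?case by blast
    qed
  qed
  with \<Delta> that show ?thesis by blast
qed

end

section \<open>The lower bound\<close>

text \<open>Coordinates of modulus at most 2r give l1 norm at most 2rd, which dictates r. All
  coordinates of a box have the same sign, so any one of them separates the two boxes.\<close>

lemma exists_boxes:
  fixes n :: nat
  defines "r \<equiv> nat \<lfloor>root CARD('d::finite) (real n) / (2 * real CARD('d))\<rfloor>"
  obtains G\<^sub>1 G\<^sub>2 :: "(int ^ 'd) set" where "G\<^sub>1 \<subseteq> sources n" "G\<^sub>2 \<subseteq> sources n"
    "\<And>u i. u \<in> G\<^sub>1 \<Longrightarrow> real r \<le> embed u $ i" "\<And>u i. u \<in> G\<^sub>2 \<Longrightarrow> embed u $ i \<le> - real r"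
    "card G\<^sub>1 = r ^ CARD('d)" "card G\<^sub>2 = r ^ CARD('d)"
proof -
  define G\<^sub>1 where "G\<^sub>1 = {w :: int ^ 'd. \<forall>i. w $ i \<in> {int r ..< 2 * int r}}"
  define G\<^sub>2 where "G\<^sub>2 = {w :: int ^ 'd. \<forall>i. w $ i \<in> {- (2 * int r) <.. - int r}}"
  have sub: "w \<in> sources n" if "\<And>i. \<bar>w $ i\<bar> \<le> 2 * int r" for w :: "int ^ 'd"
  proof -
    have "int (ldist w 0) \<le> (\<Sum>i\<in>(UNIV :: 'd set). 2 * int r)"
      unfolding int_ldist using that by (intro sum_mono) simp
    then have "int (ldist w 0) \<le> int (CARD('d) * (2 * r))" by simp
    then have "real (ldist w 0) \<le> real (CARD('d) * (2 * r))" by (simp only: of_nat_le_iff)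
    also have "\<dots> \<le> root CARD('d) (real n)"
    proof -
      have "real r \<le> root CARD('d) (real n) / (2 * real CARD('d))"
        unfolding r_def by (intro of_nat_floor divide_nonneg_nonneg) auto
      then show ?thesis by (simp add: field_simps)
    qed
    finally show ?thesis by (simp add: sources_def nball_def)
  qed
  show ?thesis
  proof (rule that[of G\<^sub>1 G\<^sub>2])
    show "G\<^sub>1 \<subseteq> sources n"
    proof
      fix w assume "w \<in> G\<^sub>1"
      then have *: "int r \<le> w $ i \<and> w $ i < 2 * int r" for i by (simp add: G\<^sub>1_def)
      have "\<bar>w $ i\<bar> \<le> 2 * int r" for i using *[of i] by linarith
      then show "w \<in> sources n" by (rule sub)
    qed
    show "G\<^sub>2 \<subseteq> sources n"
    proof
      fix w assume "w \<in> G\<^sub>2"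
      then have *: "- (2 * int r) < w $ i \<and> w $ i \<le> - int r" for i by (simp add: G\<^sub>2_def)
      have "\<bar>w $ i\<bar> \<le> 2 * int r" for i using *[of i] by linarith
      then show "w \<in> sources n" by (rule sub)
    qed
    show "real r \<le> embed u $ i" if "u \<in> G\<^sub>1" for u i
    proof -
      have "int r \<le> u $ i" using that by (simp add: G\<^sub>1_def)
      then have "real_of_int (int r) \<le> real_of_int (u $ i)" by (simp only: of_int_le_iff)
      then show ?thesis by (simp add: embed_def)
    qed
    show "embed u $ i \<le> - real r" if "u \<in> G\<^sub>2" for u i
    proof -
      have "u $ i \<le> - int r" using that by (simp add: G\<^sub>2_def)
      then have "real_of_int (u $ i) \<le> real_of_int (- int r)" by (simp only: of_int_le_iff)
      then show ?thesis by (simp add: embed_def)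
    qed
    show "card G\<^sub>1 = r ^ CARD('d)" unfolding G\<^sub>1_def by (subst card_vec_box) simp_all
    show "card G\<^sub>2 = r ^ CARD('d)" unfolding G\<^sub>2_def by (subst card_vec_box) simp_all
  qed
qed

context signal_model
begin

lemma section_measurable:
  assumes "f \<in> borel_measurable (joint n)"
  shows "(\<lambda>y. f (v, y)) \<in> borel_measurable fields"
proof -
  have "f \<in> borel_measurable (count_space UNIV \<Otimes>\<^sub>M fields)"
    using assms measurable_cong_sets[OF sets_cascade refl] by blast
  from measurable_compose[OF measurable_Pair_signal this]
  show ?thesis using measurable_cong_sets[OF sets_signal refl] by blast
qed

text \<open>A union bound over five failures: large log gains, large outer likelihoods, too few
  lucky vertices in either box, or a large predicted variance at time t. Outside them, waiting until
  t has a strictly positive value at all times up to k.\<close>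

lemma opt_value_nonpos_prob:
  fixes v :: "int ^ 'd::finite"
  assumes v: "v \<in> sources n" and "k \<le> t"
    and G: "G\<^sub>1 \<subseteq> sources n" "G\<^sub>2 \<subseteq> sources n"
      "\<And>u. u \<in> G\<^sub>1 \<Longrightarrow> r \<le> embed u $ i" "\<And>u. u \<in> G\<^sub>2 \<Longrightarrow> embed u $ i \<le> - r"
    and r: "0 \<le> r" and z: "0 \<le> z"
    and large: "1 + real (ball_size TYPE('d) t) \<le> z / (A * exp e) * r\<^sup>2"
  shows "measure (law v) {y \<in> space fields. \<exists>s\<le>k. opt_value n s (v, y) \<le> 0}
    \<le> measure (law v) {y \<in> space fields. e \<le> (\<Sum>i\<in>cone v k. log_gain (y i))}
    + measure (law v) {y \<in> space fields. \<exists>s\<le>k. A \<le> (\<Sum>u\<in>sources n. outer_lik s v u y)}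
    + measure (law v) {y \<in> space fields. (\<Sum>u\<in>G\<^sub>1. indicator (lucky k u) y) \<le> z}
    + measure (law v) {y \<in> space fields. (\<Sum>u\<in>G\<^sub>2. indicator (lucky k u) y) \<le> z}
    + measure (law v) {y \<in> space fields. \<exists>s\<le>k. 1 \<le> real_cond_exp (joint n)
      (obs n s) (\<lambda>\<omega>. pvar q n t (snd \<omega>)) (v, y)}"
    (is "measure ?K ?bad \<le> measure ?K ?B1 + measure ?K ?B2 + measure ?K ?B3 + measure ?K ?B4 + measure ?K ?B5")
proof -
  interpret K: prob_space ?K by (rule prob_space_signal)
  have S1: "?B1 \<in> sets ?K"
    unfolding sets_signal by (intro borel_measurable_le borel_measurable_const borel_measurable_sum coord_measurable log_gain_measurable)
  have S2: "?B2 \<in> sets ?K"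
  proof -
    have "?B2 = (\<Union>s\<le>k. {y \<in> space fields. A \<le> (\<Sum>u\<in>sources n. outer_lik s v u y)})" by auto
    also have "\<dots> \<in> sets ?K"
      unfolding sets_signal
      by (intro sets.finite_UN borel_measurable_le borel_measurable_const borel_measurable_sum outer_lik_measurable) auto
    finally show ?thesis .
  qed
  have SG: "{y \<in> space fields. (\<Sum>u\<in>G. indicator (lucky k u) y) \<le> z} \<in> sets ?K" for G
    using lucky_sets[of k _ v] unfolding sets_signal
    by (intro borel_measurable_le borel_measurable_const borel_measurable_sum borel_measurable_indicator)
  have S5: "?B5 \<in> sets ?K"
  proof -
    have "?B5 = (\<Union>s\<le>k. {y \<in> space fields. 1 \<le> real_cond_exp (joint n)
      (obs n s) (\<lambda>\<omega>. pvar q n t (snd \<omega>)) (v, y)})" by auto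
    also have "\<dots> \<in> sets ?K"
      unfolding sets_signal
      by (intro sets.finite_UN borel_measurable_le borel_measurable_const section_measurable[where n = n] borel_measurable_cond_exp2) auto
    finally show ?thesis .
  qed
  have "AE \<omega> in joint n. \<forall>s\<in>{..k}. ereal (pvar q n s (snd \<omega>)
      - real_cond_exp (joint n) (obs n s) (\<lambda>\<omega>. pvar q n t (snd \<omega>)) \<omega>
      - (real (ball_size TYPE('d) t) - real (ball_size TYPE('d) s))) \<le> opt_value n s (\<omega> :: ('d, 'b) outcome)"
    using \<open>k \<le> t\<close> by (intro AE_finite_allI opt_value_deterministic_ge) auto
  from AE_cascade_source[OF v this]
  have "AE y in ?K. y \<in> ?bad \<longrightarrow> y \<in> ?B1 \<union> ?B2 \<union> ?B3 \<union> ?B4 \<union> ?B5"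
  proof eventually_elim
    case (elim y)
    show ?case
    proof (intro impI, rule ccontr)
      assume bad: "y \<in> ?bad" and no: "y \<notin> ?B1 \<union> ?B2 \<union> ?B3 \<union> ?B4 \<union> ?B5"
      from bad obtain s where y: "y \<in> space fields" and s: "s \<le> k" "opt_value n s (v, y) \<le> 0" by auto
      have E: "(\<Sum>i\<in>cone v k. log_gain (y i)) \<le> e" and A: "(\<Sum>u\<in>sources n. outer_lik s v u y) \<le> A"
        and z1: "z \<le> (\<Sum>u\<in>G\<^sub>1. indicator (lucky k u) y)" and z2: "z \<le> (\<Sum>u\<in>G\<^sub>2. indicator (lucky k u) y)"
        and g: "real_cond_exp (joint n) (obs n s) (\<lambda>\<omega>. pvar q n t (snd \<omega>)) (v, y) < 1"
        using no y s(1) by (auto simp: not_le intro: less_imp_le dest!: spec[of _ s])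
      \<comment> \<open>The surplus 1 pays for the conditional expectation of the later variance,
        which is below 1 here.\<close>
      have "1 + real (ball_size TYPE('d) t) \<le> pvar q n s y"
        by (rule order.trans[OF large], rule pvar_ge_spread[OF G(1,3) _ G(2,4)])
           (use post_sum_ge[OF s(1) G(1) y z z1 E A] post_sum_ge[OF s(1) G(2) y z z2 E A] r in auto)
      then have "0 < pvar q n s (snd (v, y))
        - real_cond_exp (joint n) (obs n s) (\<lambda>\<omega>. pvar q n t (snd \<omega>)) (v, y)
        - (real (ball_size TYPE('d) t) - real (ball_size TYPE('d) s))"
        using g by simp
      also have "ereal \<dots> \<le> opt_value n s (v, y)" using elim s(1) by simp
      finally show False using s(2) by (simp add: zero_ereal_def)
    qed
  qed
  then have "measure ?K ?bad \<le> measure ?K (?B1 \<union> ?B2 \<union> ?B3 \<union> ?B4 \<union> ?B5)"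
    by (rule K.finite_measure_mono_AE) (intro sets.Un S1 S2 SG S5)
  also have "\<dots> \<le> measure ?K (?B1 \<union> ?B2 \<union> ?B3 \<union> ?B4) + measure ?K ?B5"
    by (intro measure_Un_le sets.Un S1 S2 SG S5)
  also have "measure ?K (?B1 \<union> ?B2 \<union> ?B3 \<union> ?B4) \<le> measure ?K (?B1 \<union> ?B2 \<union> ?B3) + measure ?K ?B4"
    by (intro measure_Un_le sets.Un S1 S2 SG S5)
  also have "measure ?K (?B1 \<union> ?B2 \<union> ?B3) \<le> measure ?K (?B1 \<union> ?B2) + measure ?K ?B3"
    by (intro measure_Un_le sets.Un S1 S2 SG S5)
  also have "measure ?K (?B1 \<union> ?B2) \<le> measure ?K ?B1 + measure ?K ?B2"
    by (intro measure_Un_le S1 S2)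
  finally show ?thesis by simp
qed

lemma lower_bound:
  assumes \<rho>: "0 < \<rho>" "\<rho> < 1" "(\<integral>\<^sup>+ x. ennreal (sqrt (q x)) \<partial>Q\<^sub>0) \<le> ennreal \<rho>"
    and p: "0 < p" "p \<le> measure Q\<^sub>0 {x \<in> space Q\<^sub>0. 1 \<le> q x}" "p \<le> measure Q\<^sub>1 {x \<in> space Q\<^sub>0. 1 \<le> q x}"
    and kl: "integrable Q\<^sub>1 log_gain"
  obtains \<Delta> :: real where "0 < \<Delta>"
    "\<forall>\<eta>>0. \<forall>\<^sub>F n in sequentially. \<exists>k. \<Delta> * ln (real n) \<le> real (growth TYPE('d::finite) (Suc k)) \<and>
      (\<forall>v\<in>(sources n :: (int ^ 'd) set).
        measure (law v) {y \<in> space fields. \<exists>s\<le>k. opt_value n s (v, y) \<le> 0} \<le> \<eta>)"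
proof -
  let ?d = "CARD('d)"
  define D where "D = real ?d"
  have D: "1 \<le> D" by (simp add: D_def Suc_le_eq)
  \<comment> \<open>Three factors of n^\<epsilon> are lost: in the probability of luck, in the outer
    likelihoods and in the log gains. Together they cost n^(1/d), against n^(2/d) from the squared
    distance.\<close>
  define \<epsilon> where "\<epsilon> = 1 / (3 * D)"
  have \<epsilon>: "0 < \<epsilon>" "\<epsilon> \<le> 1 / 3" "3 * \<epsilon> = 1 / D" using D by (auto simp: \<epsilon>_def field_simps)
  define m where "m = (\<integral>x. log_gain x \<partial>Q\<^sub>1)"
  have m: "0 \<le> m" "(\<integral>\<^sup>+ x. ennreal (log_gain x) \<partial>Q\<^sub>1) \<le> ennreal m"
    using nn_integral_eq_integral[OF kl] by (auto simp: m_def log_gain_nonneg intro!: integral_nonneg_AE)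
  \<comment> \<open>Then \<rho> to the power t is at most n^(-8), which beats n^3 from the variance
    bound and n from the change to a fixed source.\<close>
  define \<tau> where "\<tau> = 8 / ln (1 / \<rho>)"
  have l\<rho>: "0 < ln (1 / \<rho>)" using \<rho> by simp
  have \<tau>: "0 < \<tau>" using l\<rho> by (simp add: \<tau>_def)
  \<comment> \<open>A positive upper bound for ln (1 / p), so that it can be divided by even if p =
    1.\<close>
  define lp where "lp = \<bar>ln (1 / p)\<bar> + 1"
  have lp: "0 < lp" "ln (1 / p) \<le> lp" by (auto simp: lp_def)
  \<comment> \<open>The three constraints keep the exponential moment of the log gains below the
    threshold, keep the probability of luck above n^(-\<epsilon>), and place k before the waiting
    time t.\<close>
  define \<Delta> where "\<Delta> = Min {\<epsilon> / (8 * (m + 1)), \<epsilon> / lp, \<tau>}"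
  have \<Delta>: "0 < \<Delta>" using \<epsilon> m lp \<tau> by (simp add: \<Delta>_def)
  have "\<Delta> \<le> \<epsilon> / (8 * (m + 1))" "\<Delta> \<le> \<epsilon> / lp" and \<Delta>\<tau>: "\<Delta> \<le> \<tau>" by (auto simp: \<Delta>_def)
  then have "8 * (m + 1) * \<Delta> \<le> \<epsilon>" and \<Delta>p: "lp * \<Delta> \<le> \<epsilon>" using m lp by (auto simp: field_simps)
  then have \<Delta>m: "8 * m * \<Delta> \<le> \<epsilon>" using \<Delta> by (simp add: algebra_simps)
  define c' where "c' = 1 / (2 * (4 * D) ^ ?d * 3 ^ ?d * (4 * D)\<^sup>2)"
  have c': "0 < c'" using D by (simp add: c'_def)
  have "\<forall>\<^sub>F n in sequentially. \<exists>k. \<Delta> * ln (real n) \<le> real (growth TYPE('d) (Suc k)) \<and>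
      (\<forall>v\<in>(sources n :: (int ^ 'd) set).
        measure (law v) {y \<in> space fields. \<exists>s\<le>k. opt_value n s (v, y) \<le> 0} \<le> \<eta>)"
    if \<eta>: "0 < \<eta>" for \<eta>
  proof -
    \<comment> \<open>Chosen so that the Markov term for the large gains comes out as \<eta> /
      6.\<close>
    define \<delta> where "\<delta> = \<eta> * \<epsilon> / (12 * \<Delta>)"
    have \<delta>: "0 < \<delta>" using \<eta> \<epsilon> \<Delta> by (simp add: \<delta>_def)
    obtain K where K: "0 \<le> K" "(\<integral>\<^sup>+ x. ennreal (if log_gain x > K then log_gain x else 0) \<partial>Q\<^sub>1) \<le> ennreal \<delta>"
      using log_gain_truncation[OF kl \<delta>] by blast
    \<comment> \<open>This gives exp (\<theta> * K) <= 2; the added 1 avoids division by zero when K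
      = 0.\<close>
    define \<theta> where "\<theta> = ln 2 / (K + 1)"
    have \<theta>: "0 < \<theta>" using K by (simp add: \<theta>_def)
    have "\<theta> * K \<le> ln 2" using K by (simp add: \<theta>_def field_simps)
    then have \<theta>K: "exp (\<theta> * K) \<le> 2" by (metis exp_le_cancel_iff exp_ln zero_less_numeral)
    have \<eta>6: "0 < \<eta> / 6" and t1: "0 < \<theta> * \<epsilon> / 4" and t3: "0 < 1 - \<epsilon>" and t4: "(0::real) < 4"
      and t5: "0 < 1 / D" and t6: "0 < 1 / (4 * D)" using \<eta> \<theta> \<epsilon> D by auto
    \<comment> \<open>\<eta> is shared out in six parts: two for the log gains, one each for the
      outer likelihoods, the two boxes and the predicted variance.\<close>
    from eventually_ge_at_top[of 1] eventually_ln_ge[of 1] eventually_ln_ge[of "2 / \<Delta>"]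
      poly_exp_decay_ln[OF t1 \<eta>6, of 1 0] poly_exp_decay_ln[OF \<epsilon>(1) \<eta>6, of \<Delta> 1]
      poly_exp_decay_ln[OF t3 \<eta>6, of "4 * (4 * \<Delta>) ^ ?d * (4 * D) ^ ?d" ?d]
      poly_exp_decay_ln[OF t4 \<eta>6, of "\<Delta> * 3 ^ ?d * (3 ^ ?d * 4)" 1]
      poly_exp_decay_ln[OF t5 c', of "1 + (2 * \<tau> + 3) ^ ?d" ?d]
      poly_exp_decay_ln[OF t5 t6, of 1 0]
    show ?thesis
    proof eventually_elim
      case (elim n)
      define L where "L = ln (real n)"
      note E = elim[folded L_def]
      have n: "1 \<le> n" and L1: "1 \<le> L" and L\<Delta>: "2 \<le> \<Delta> * L" using E(1-3) \<Delta> by (auto simp: field_simps)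
      have nL: "real n = exp L" using n by (simp add: L_def)
      \<comment> \<open>The first time with growth at least \<Delta> * L. It is not 0, since
        \<open>growth\<close> starts at 1; its predecessor k is the last time to be
        excluded.\<close>
      define j where "j = (LEAST j. \<Delta> * L \<le> real (growth TYPE('d) j))"
      have ex: "\<Delta> * L \<le> real (growth TYPE('d) (nat \<lceil>\<Delta> * L\<rceil>))"
        using growth_ge_Suc[where 'd='d, of "nat \<lceil>\<Delta> * L\<rceil>"] by linarith
      have j: "\<Delta> * L \<le> real (growth TYPE('d) j)"
        unfolding j_def by (rule LeastI[of "\<lambda>j. \<Delta> * L \<le> real (growth TYPE('d) j)", OF ex])
      have "j \<noteq> 0"
      proof
        assume "j = 0"
        then have "\<Delta> * L \<le> 1" using j growth_le[where 'd='d, of 0] by simp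
        with L\<Delta> show False by simp
      qed
      then obtain k where k: "j = Suc k" by (cases j) auto
      define N where "N = real (growth TYPE('d) k)"
      have "k < j" by (simp add: k)
      from not_less_Least[OF this[unfolded j_def]] have N: "N \<le> \<Delta> * L" by (simp add: N_def)
      have kN: "real (Suc k) \<le> \<Delta> * L"
        using growth_ge_Suc[where 'd='d, of k] N unfolding N_def by linarith
      define t where "t = nat \<lceil>\<tau> * L\<rceil>"
      have t: "\<tau> * L \<le> real t" "real t \<le> \<tau> * L + 1" using \<tau> L1 by (auto simp: t_def)
      have "\<Delta> * L \<le> \<tau> * L" using \<Delta>\<tau> L1 by (intro mult_right_mono) auto
      with kN t(1) have kt: "k \<le> t" by linarith
      define r where "r = nat \<lfloor>root ?d (real n) / (2 * real ?d)\<rfloor>"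
      have root: "root ?d (real n) = exp (L / D)"
        by (rule real_root_pos_unique) (auto simp: nL D_def exp_of_nat_mult[symmetric])
      have "exp (- (L / D)) < 1 / (4 * D)" using E(9) by simp
      then have "4 * D < exp (L / D)" using D by (simp add: exp_minus field_simps)
      then have "2 \<le> exp (L / D) / (2 * D)" using D by (simp add: field_simps)
      moreover have "real r = real_of_int \<lfloor>exp (L / D) / (2 * D)\<rfloor>" unfolding r_def root D_def[symmetric] using D by simp
      moreover define x where "x = exp (L / D) / (2 * D)"
      \<comment> \<open>Rounding down a number that is at least 2 loses at most half of it.\<close>
      ultimately have "x / 2 \<le> real r" by linarith
      then have r: "exp (L / D) / (4 * D) \<le> real r" by (simp add: x_def)
      have r0: "0 < real r" using r D by (smt (verit) divide_pos_pos exp_gt_zero)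
      have rd: "exp L / (4 * D) ^ ?d \<le> real r ^ ?d"
      proof -
        have "(exp (L / D) / (4 * D)) ^ ?d \<le> real r ^ ?d" using r D by (intro power_mono) auto
        moreover have "exp (L / D) ^ ?d = exp L" using D by (simp add: exp_of_nat_mult[symmetric] D_def)
        ultimately show ?thesis by (simp add: power_divide)
      qed
      obtain G\<^sub>1 G\<^sub>2 :: "(int ^ 'd) set" where G: "G\<^sub>1 \<subseteq> sources n" "G\<^sub>2 \<subseteq> sources n"
        "\<And>u i. u \<in> G\<^sub>1 \<Longrightarrow> real r \<le> embed u $ i" "\<And>u i. u \<in> G\<^sub>2 \<Longrightarrow> embed u $ i \<le> - real r"
        and cG: "card G\<^sub>1 = r ^ ?d" "card G\<^sub>2 = r ^ ?d"
        unfolding r_def by (rule exists_boxes[where 'd='d, of n]) blast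
      have finG: "finite G\<^sub>1" "finite G\<^sub>2" using G(1,2) finite_subset[OF _ finite_sources] by auto
      have neG: "G\<^sub>1 \<noteq> {}" "G\<^sub>2 \<noteq> {}" using cG r0 by auto
      define b where "b = real r ^ ?d * p ^ growth TYPE('d) k"
      have pN: "exp (- (\<epsilon> * L)) \<le> p ^ growth TYPE('d) k"
      proof -
        have "ln (1 / p) * N \<le> lp * (\<Delta> * L)"
          using lp N by (intro mult_mono) (auto simp: N_def)
        also have "\<dots> \<le> \<epsilon> * L" using \<Delta>p L1 by (simp add: mult.assoc[symmetric] mult_right_mono)
        finally show ?thesis by (subst power_eq_exp_ln[OF p(1)]) (simp add: N_def)
      qed
      have b: "exp ((1 - \<epsilon>) * L) / (4 * D) ^ ?d \<le> b"
      proof -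
        have "exp L / (4 * D) ^ ?d * exp (- (\<epsilon> * L)) \<le> b"
          unfolding b_def using rd pN r0 by (intro mult_mono) auto
        then show ?thesis by (simp add: algebra_simps exp_diff exp_minus divide_inverse)
      qed
      have b0: "0 < b" using r0 p by (simp add: b_def)
      let ?c = "real (card (sources n :: (int ^ 'd) set))"
      have c: "?c \<le> 3 ^ ?d * exp L" using card_sources_le[where 'd='d, OF n] by (simp add: nL)
      have c0: "0 < ?c" using card_sources_pos[where 'd='d, of n] by simp
      define A where "A = exp (\<epsilon> * L) * ?c"
      have large: "1 + real (ball_size TYPE('d) t) \<le> (b / 2) / (A * exp (\<epsilon> * L)) * (real r)\<^sup>2"
      proof -
        have "real (ball_size TYPE('d) t) \<le> real ((2 * t + 1) ^ ?d)" using ball_size_le[where 'd='d, of t] by (subst of_nat_le_iff)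
        also have "\<dots> = (2 * real t + 1) ^ ?d" by (simp add: add.commute)
        also have "\<dots> \<le> ((2 * \<tau> + 3) * L) ^ ?d" using t L1 by (intro power_mono) (auto simp: algebra_simps)
        finally have "1 + real (ball_size TYPE('d) t) \<le> L ^ ?d + (2 * \<tau> + 3) ^ ?d * L ^ ?d"
          using one_le_power[OF L1, of ?d] by (simp add: power_mult_distrib)
        also have "\<dots> = (1 + (2 * \<tau> + 3) ^ ?d) * L ^ ?d" by (simp add: algebra_simps)
        also have "\<dots> \<le> c' * exp (L / D)"
          using E(8) by (simp add: exp_minus field_simps)
        \<comment> \<open>The three losses of \<epsilon> consume one of the two factors
          \<open>exp (L / D)\<close> in the squared distance; the other remains to beat the
          polylogarithmic cost.\<close>
        also have "\<dots> = (exp ((1 - \<epsilon>) * L) / (4 * D) ^ ?d / 2) / (exp (\<epsilon> * L) * (3 ^ ?d * exp L) * exp (\<epsilon> * L)) * (exp (L / D) / (4 * D))\<^sup>2"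
        proof -
          have "exp ((1 - \<epsilon>) * L) * (exp (L / D))\<^sup>2 = exp (L / D) * (exp (\<epsilon> * L) * exp L * exp (\<epsilon> * L))"
          proof -
            have LD: "L / D = 3 * (\<epsilon> * L)" using \<epsilon>(3) by (simp add: mult.assoc[symmetric])
            have "(1 - \<epsilon>) * L + 2 * (L / D) = L / D + (\<epsilon> * L + L + \<epsilon> * L)"
              unfolding LD by (simp add: algebra_simps)
            then show ?thesis by (simp add: exp_add[symmetric] power2_eq_square)
          qed
          then show ?thesis unfolding c'_def using D by (simp add: field_simps power_divide)
        qed
        also have "\<dots> \<le> (b / 2) / (A * exp (\<epsilon> * L)) * (real r)\<^sup>2"
          unfolding A_def using b b0 c c0 r D
          by (intro mult_mono frac_le power_mono mult_right_mono mult_left_mono divide_right_mono) auto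
        finally show ?thesis .
      qed
      have "measure (law v) {y \<in> space fields. \<exists>s\<le>k. opt_value n s (v, y) \<le> 0} \<le> \<eta>"
        if v: "v \<in> sources n" for v :: "int ^ 'd"
      proof -
        have P1: "measure (law v) {y \<in> space fields. \<epsilon> * L \<le> (\<Sum>i\<in>cone v k. log_gain (y i))} \<le> \<eta> / 6 + \<eta> / 6"
        proof -
          have a: "0 < \<epsilon> * L / 2" using \<epsilon> L1 by simp
          have "measure (law v) {y \<in> space fields. 2 * (\<epsilon> * L / 2) \<le> (\<Sum>i\<in>cone v k. log_gain (y i))}
              \<le> N * \<delta> / (\<epsilon> * L / 2) + exp (2 * \<theta> * m * N - \<theta> * (\<epsilon> * L / 2))"
            unfolding N_def using log_gain_sum_tail[OF m less_imp_le[OF \<delta>] K(2) \<theta> \<theta>K a] .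
          also have "N * \<delta> / (\<epsilon> * L / 2) \<le> (\<Delta> * L) * \<delta> / (\<epsilon> * L / 2)"
            using N \<delta> a by (intro divide_right_mono mult_right_mono) auto
          also have "\<dots> = \<eta> / 6" using L1 \<epsilon> \<Delta> by (simp add: \<delta>_def field_simps)
          \<comment> \<open>The moment term uses up half of the available exponent, because 8 * m *
            \<Delta> <= \<epsilon>.\<close>
          also have "exp (2 * \<theta> * m * N - \<theta> * (\<epsilon> * L / 2)) \<le> exp (- (\<theta> * \<epsilon> / 4 * L))"
          proof -
            have "2 * \<theta> * m * N \<le> 2 * \<theta> * m * (\<Delta> * L)" using N \<theta> m by (intro mult_left_mono) auto
            also have "\<dots> = \<theta> / 4 * (8 * m * \<Delta>) * L" by simp
            also have "\<dots> \<le> \<theta> / 4 * \<epsilon> * L" using \<Delta>m \<theta> L1 by (intro mult_right_mono mult_left_mono) auto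
            finally show ?thesis by simp
          qed
          also have "\<dots> \<le> \<eta> / 6" using E(4) by simp
          finally show ?thesis by simp
        qed
        have P2: "measure (law v) {y \<in> space fields. \<exists>s\<le>k. A \<le> (\<Sum>u\<in>sources n. outer_lik s v u y)} \<le> \<eta> / 6"
        proof -
          have "measure (law v) {y \<in> space fields. \<exists>s\<le>k. A \<le> (\<Sum>u\<in>sources n. outer_lik s v u y)} \<le> real (Suc k) / exp (\<epsilon> * L)"
            unfolding A_def by (rule outer_lik_sum_tail) simp
          also have "\<dots> \<le> \<Delta> * L / exp (\<epsilon> * L)" using kN by (intro divide_right_mono) auto
          also have "\<dots> \<le> \<eta> / 6" using E(5) by (simp add: exp_minus inverse_eq_divide)
          finally show ?thesis .
        qed
        have P34: "measure (law v) {y \<in> space fields. (\<Sum>u\<in>G. indicator (lucky k u) y) \<le> b / 2} \<le> \<eta> / 6"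
          if "finite G" "G \<noteq> {}" "card G = r ^ ?d" for G
        proof -
          have "measure (law v) {y \<in> space fields. (\<Sum>u\<in>G. indicator (lucky k u) y) \<le> b / 2} \<le> 4 * (4 * real k + 1) ^ ?d / b"
            using lucky_count_tail[OF p that(1,2), where t = k and v = v] that(3) by (simp add: b_def)
          also have "\<dots> \<le> 4 * (4 * \<Delta> * L) ^ ?d / (exp ((1 - \<epsilon>) * L) / (4 * D) ^ ?d)"
          proof (intro frac_le mult_left_mono power_mono)
            show "4 * real k + 1 \<le> 4 * \<Delta> * L" using kN by simp
            show "exp ((1 - \<epsilon>) * L) / (4 * D) ^ ?d \<le> b" by (rule b)
          qed (use D \<Delta> L1 in auto)
          also have "\<dots> = 4 * (4 * \<Delta>) ^ ?d * (4 * D) ^ ?d * L ^ ?d * exp (- ((1 - \<epsilon>) * L))"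
            by (simp add: power_mult_distrib exp_minus inverse_eq_divide mult_ac)
          also have "\<dots> \<le> \<eta> / 6" using E(6) by simp
          finally show ?thesis .
        qed
        have P5: "measure (law v) {y \<in> space fields. \<exists>s\<le>k. 1 \<le> real_cond_exp (joint n)
          (obs n s) (\<lambda>\<omega>. pvar q n t (snd \<omega>)) (v, y)} \<le> \<eta> / 6"
        proof -
          define x where "x = 3 ^ ?d * 4 * real n ^ 3 * \<rho> ^ t"
          have x0: "0 \<le> x" using \<rho> by (simp add: x_def)
          have "(\<integral>\<^sup>+ y. ennreal (pvar q n t y) \<partial>law w) \<le> ennreal x" if "w \<in> sources n" for w :: "int ^ 'd"
            unfolding x_def
            by (rule order.trans[OF nn_integral_pvar_le[OF \<rho> that] ennreal_leI[OF sum_pvar_bound_crude[OF \<rho>(1,2) that n]]])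
          from cond_pvar_tail[OF v x0 this, of k]
          have "measure (law v) {y \<in> space fields. \<exists>s\<le>k. 1 \<le> real_cond_exp (joint n)
            (obs n s) (\<lambda>\<omega>. pvar q n t (snd \<omega>)) (v, y)} \<le> real (Suc k) * ?c * x" .
          also have "\<dots> \<le> (\<Delta> * L) * (3 ^ ?d * exp L) * (3 ^ ?d * 4 * exp (3 * L) * exp (- (8 * L)))"
          proof (intro mult_mono kN c)
            have "ln (1 / \<rho>) * (\<tau> * L) \<le> ln (1 / \<rho>) * real t" using t l\<rho> by (intro mult_left_mono) auto
            then have "8 * L \<le> ln (1 / \<rho>) * real t" using l\<rho> by (simp add: \<tau>_def)
            then have "\<rho> ^ t \<le> exp (- (8 * L))" by (subst power_eq_exp_ln[OF \<rho>(1)]) simp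
            moreover have "real n ^ 3 = exp (3 * L)" by (simp add: nL exp_of_nat_mult[symmetric])
            ultimately show "x \<le> 3 ^ ?d * 4 * exp (3 * L) * exp (- (8 * L))"
              unfolding x_def by (auto intro!: mult_left_mono)
          qed (use x0 \<Delta> L1 in auto)
          also have "\<dots> = \<Delta> * 3 ^ ?d * (3 ^ ?d * 4) * L ^ 1 * exp (- (4 * L))"
          proof -
            have "exp L * (exp (3 * L) * exp (- (8 * L))) = exp (- (4 * L))" by (simp add: exp_add[symmetric])
            then show ?thesis by (simp add: mult_ac)
          qed
          also have "\<dots> \<le> \<eta> / 6" using E(7) by simp
          finally show ?thesis .
        qed
        have "0 \<le> b / 2" using b0 by simp
        from opt_value_nonpos_prob[OF v kt G(1,2) G(3,4) _ this large] r0 P1 P2 P34[OF finG(1) neG(1) cG(1)] P34[OF finG(2) neG(2) cG(2)] P5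
        show ?thesis by simp
      qed
      with j show ?case unfolding k L_def by blast
    qed
  qed
  with \<Delta> that show ?thesis by blast
qed

end

section \<open>Reduction of the hypotheses to a positive density\<close>

text \<open>The Radon-Nikodym derivative is reset to 1 where it vanishes or is infinite. With base
  \<open>exp 1\<close> the entropy density is the natural logarithm of the derivative.\<close>

lemma signal_model_exists:
  fixes Q\<^sub>0 Q\<^sub>1 :: "'b measure"
  assumes "prob_space Q\<^sub>0" and "prob_space Q\<^sub>1" and sets: "sets Q\<^sub>0 = sets Q\<^sub>1"
    and ac: "absolutely_continuous Q\<^sub>0 Q\<^sub>1" and ac': "absolutely_continuous Q\<^sub>1 Q\<^sub>0"
    and kl: "integrable Q\<^sub>1 (entropy_density (exp 1) Q\<^sub>0 Q\<^sub>1)"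
  obtains q where "signal_model Q\<^sub>0 Q\<^sub>1 q" "integrable Q\<^sub>1 (\<lambda>x. max 0 (ln (q x)))"
proof -
  interpret Q0: prob_space Q\<^sub>0 by fact
  interpret Q1: prob_space Q\<^sub>1 by fact
  let ?R = "RN_deriv Q\<^sub>0 Q\<^sub>1"
  have dens: "density Q\<^sub>0 ?R = Q\<^sub>1" by (rule Q0.density_RN_deriv[OF ac sets[symmetric]])
  have fin: "AE x in Q\<^sub>0. ?R x \<noteq> \<infinity>"
    by (rule Q0.RN_deriv_finite[OF _ ac sets[symmetric]]) unfold_locales
  \<comment> \<open>The zero set of the derivative is null for \<open>Q\<^sub>1\<close> by
    construction, and then for \<open>Q\<^sub>0\<close> by the reverse absolute continuity.\<close>
  define Z where "Z = {x \<in> space Q\<^sub>0. ?R x = 0}"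
  have Z: "Z \<in> sets Q\<^sub>0" unfolding Z_def by measurable
  have "emeasure Q\<^sub>1 Z = (\<integral>\<^sup>+ x. ?R x * indicator Z x \<partial>Q\<^sub>0)"
    using Z by (subst dens[symmetric]) (simp add: emeasure_density)
  also have "\<dots> = (\<integral>\<^sup>+ x. 0 \<partial>Q\<^sub>0)" by (intro nn_integral_cong) (auto simp: Z_def indicator_def)
  finally have "Z \<in> null_sets Q\<^sub>1" using Z sets by (auto simp: null_sets_def)
  then have "Z \<in> null_sets Q\<^sub>0" using ac' by (auto simp: absolutely_continuous_def)
  then have pos: "AE x in Q\<^sub>0. ?R x \<noteq> 0"
    by (rule AE_I') (auto simp: Z_def)
  define q where "q x = (if enn2real (?R x) > 0 then enn2real (?R x) else 1)" for x
  have qM: "q \<in> borel_measurable Q\<^sub>0" unfolding q_def by measurable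
  have AEq: "AE x in Q\<^sub>0. q x = enn2real (?R x) \<and> ?R x = ennreal (q x)"
    using fin pos
  proof eventually_elim
    case (elim x)
    then have "0 < enn2real (?R x)" by (simp add: enn2real_positive_iff less_top zero_less_iff_neq_zero)
    with elim show ?case by (simp add: q_def less_top)
  qed
  have "density Q\<^sub>0 ?R = density Q\<^sub>0 (\<lambda>x. ennreal (q x))"
  proof (rule density_cong)
    show "(\<lambda>x. ennreal (q x)) \<in> borel_measurable Q\<^sub>0" using qM by measurable
    show "AE x in Q\<^sub>0. ?R x = ennreal (q x)" using AEq by eventually_elim (rule conjunct2)
  qed simp
  then have Q1_eq: "Q\<^sub>1 = density Q\<^sub>0 (\<lambda>x. ennreal (q x))" using dens by simp
  have 1: "signal_model Q\<^sub>0 Q\<^sub>1 q"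
    by (rule signal_model.intro[OF assms(1,2) qM _ Q1_eq]) (simp add: q_def)
  have AEq1: "AE x in Q\<^sub>1. q x = enn2real (?R x)"
  proof (rule absolutely_continuous_AE[OF sets[symmetric] ac])
    show "AE x in Q\<^sub>0. q x = enn2real (?R x)" using AEq by eventually_elim (rule conjunct1)
  qed
  have qM1: "q \<in> borel_measurable Q\<^sub>1" using qM measurable_cong_sets[OF sets refl] by blast
  have "integrable Q\<^sub>1 (\<lambda>x. max 0 (entropy_density (exp 1) Q\<^sub>0 Q\<^sub>1 x))" using kl by simp
  then have "integrable Q\<^sub>1 (\<lambda>x. max 0 (ln (q x)))"
  proof (rule integrable_cong_AE_imp)
    show "(\<lambda>x. max 0 (ln (q x))) \<in> borel_measurable Q\<^sub>1" using qM1 by measurable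
    show "AE x in Q\<^sub>1. max 0 (entropy_density (exp 1) Q\<^sub>0 Q\<^sub>1 x) = max 0 (ln (q x))"
      using AEq1 by eventually_elim (simp add: entropy_density_def log_def)
  qed
  with 1 that show ?thesis by blast
qed

context signal_model
begin

lemma integrable_q: "integrable Q\<^sub>0 q" and integral_q: "(\<integral>x. q x \<partial>Q\<^sub>0) = 1"
proof -
  show "integrable Q\<^sub>0 q"
    using nn_integral_q less_imp_le[OF q_pos] by (intro integrableI_nonneg) auto
  from nn_integral_eq_integral[OF this] nn_integral_q less_imp_le[OF q_pos]
  have "ennreal (\<integral>x. q x \<partial>Q\<^sub>0) = ennreal 1" by simp
  then show "(\<integral>x. q x \<partial>Q\<^sub>0) = 1"
    by (subst (asm) ennreal_inj) (auto intro!: integral_nonneg_AE less_imp_le[OF q_pos])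
qed

text \<open>The mean of (1 - sqrt q)^2 is 2 minus twice the affinity. Affinity at least 1 would
  force q = 1 almost everywhere, hence equal laws.\<close>

lemma hellinger_affinity_less_1:
  assumes "Q\<^sub>0 \<noteq> Q\<^sub>1"
  obtains \<rho> where "0 < \<rho>" "\<rho> < 1" "(\<integral>\<^sup>+ x. ennreal (sqrt (q x)) \<partial>Q\<^sub>0) \<le> ennreal \<rho>"
proof -
  interpret Q0: prob_space Q\<^sub>0 by (rule Q0)
  let ?s = "\<lambda>x. sqrt (q x)"
  have sM: "?s \<in> borel_measurable Q\<^sub>0" by measurable
  have s0: "0 \<le> ?s x" for x using q_pos[of x] by simp
  have sq: "(1 - ?s x)\<^sup>2 = 1 + q x - 2 * ?s x" for x
    using q_pos[of x] by (simp add: power2_diff)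
  have sint: "integrable Q\<^sub>0 ?s"
  proof (rule Bochner_Integration.integrable_bound[OF _ sM])
    show "integrable Q\<^sub>0 (\<lambda>x. 1 + q x)" using integrable_q by simp
    show "AE x in Q\<^sub>0. norm (?s x) \<le> norm (1 + q x)"
    proof (rule AE_I2)
      fix x
      have "0 \<le> (1 - ?s x)\<^sup>2" by simp
      then show "norm (?s x) \<le> norm (1 + q x)" unfolding sq using s0[of x] q_pos[of x] by simp
    qed
  qed
  have int: "integrable Q\<^sub>0 (\<lambda>x. (1 - ?s x)\<^sup>2)"
    unfolding sq using sint integrable_q by simp
  have val: "(\<integral>x. (1 - ?s x)\<^sup>2 \<partial>Q\<^sub>0) = 2 - 2 * (\<integral>x. ?s x \<partial>Q\<^sub>0)"
    unfolding sq using sint integrable_q by (simp add: integral_q Q0.prob_space)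
  have "(\<integral>x. ?s x \<partial>Q\<^sub>0) < 1"
  proof (rule ccontr)
    assume "\<not> ?thesis"
    moreover have "0 \<le> (\<integral>x. (1 - ?s x)\<^sup>2 \<partial>Q\<^sub>0)" by (intro integral_nonneg_AE) simp
    ultimately have "(\<integral>x. (1 - ?s x)\<^sup>2 \<partial>Q\<^sub>0) = 0" unfolding val by simp
    then have "AE x in Q\<^sub>0. (1 - ?s x)\<^sup>2 = 0"
      using integral_nonneg_eq_0_iff_AE[OF int] by simp
    then have "AE x in Q\<^sub>0. ennreal (q x) = 1"
      by eventually_elim simp
    then have "density Q\<^sub>0 (\<lambda>x. ennreal (q x)) = density Q\<^sub>0 (\<lambda>_. 1)"
      by (intro density_cong) measurable
    then show False using assms Q1_eq by (simp add: density_1)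
  qed
  \<comment> \<open>The maximum with 1/2 makes positivity of \<rho> immediate.\<close>
  show ?thesis
  proof (rule that[of "max (1 / 2) (\<integral>x. ?s x \<partial>Q\<^sub>0)"])
    show "max (1 / 2) (\<integral>x. ?s x \<partial>Q\<^sub>0) < 1" using \<open>(\<integral>x. ?s x \<partial>Q\<^sub>0) < 1\<close> by simp
    have "(\<integral>\<^sup>+ x. ennreal (?s x) \<partial>Q\<^sub>0) = ennreal (\<integral>x. ?s x \<partial>Q\<^sub>0)"
      by (rule nn_integral_eq_integral[OF sint]) (simp add: less_imp_le[OF q_pos])
    also have "\<dots> \<le> ennreal (max (1 / 2) (\<integral>x. ?s x \<partial>Q\<^sub>0))" by (intro ennreal_leI) simp
    finally show "(\<integral>\<^sup>+ x. ennreal (?s x) \<partial>Q\<^sub>0) \<le> ennreal (max (1 / 2) (\<integral>x. ?s x \<partial>Q\<^sub>0))" .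
  qed simp
qed

text \<open>A density of mean one cannot be below 1 almost everywhere. On the set where it is at
  least 1 the law \<open>Q\<^sub>1\<close> dominates \<open>Q\<^sub>0\<close>, so the smaller mass
  serves both.\<close>

lemma ratio_ge_1_positive:
  obtains p where "0 < p" "p \<le> measure Q\<^sub>0 {x \<in> space Q\<^sub>0. 1 \<le> q x}" "p \<le> measure Q\<^sub>1 {x \<in> space Q\<^sub>0. 1 \<le> q x}"
proof -
  interpret Q0: prob_space Q\<^sub>0 by (rule Q0)
  interpret Q1: prob_space Q\<^sub>1 by (rule Q1)
  let ?A = "{x \<in> space Q\<^sub>0. 1 \<le> q x}"
  have A: "?A \<in> sets Q\<^sub>0" by measurable
  have "measure Q\<^sub>0 ?A \<noteq> 0"
  proof
    assume "measure Q\<^sub>0 ?A = 0"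
    then have "?A \<in> null_sets Q\<^sub>0" using A by (simp add: null_sets_def Q0.emeasure_eq_measure)
    then have less: "AE x in Q\<^sub>0. q x < 1"
      by (rule AE_I') (auto simp: not_less)
    have int: "integrable Q\<^sub>0 (\<lambda>x. 1 - q x)" using integrable_q by simp
    have "(\<integral>x. 1 - q x \<partial>Q\<^sub>0) = 0" using integrable_q by (simp add: integral_q Q0.prob_space)
    moreover have "AE x in Q\<^sub>0. 0 \<le> 1 - q x" using less by eventually_elim simp
    ultimately have "AE x in Q\<^sub>0. 1 - q x = 0" using integral_nonneg_eq_0_iff_AE[OF int] by simp
    with less have "AE x in Q\<^sub>0. False" by eventually_elim simp
    then show False by simp
  qed
  then have pos: "0 < measure Q\<^sub>0 ?A" by (simp add: zero_less_measure_iff)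
  have "emeasure Q\<^sub>0 ?A = (\<integral>\<^sup>+ x. indicator ?A x \<partial>Q\<^sub>0)" using A by simp
  also have "\<dots> \<le> (\<integral>\<^sup>+ x. ennreal (q x) * indicator ?A x \<partial>Q\<^sub>0)"
    by (intro nn_integral_mono) (auto simp: indicator_def)
  also have "\<dots> = emeasure Q\<^sub>1 ?A" using A by (subst Q1_eq) (simp add: emeasure_density)
  finally have "measure Q\<^sub>0 ?A \<le> measure Q\<^sub>1 ?A" by (simp add: Q0.emeasure_eq_measure Q1.emeasure_eq_measure)
  with pos that show ?thesis by blast
qed

section \<open>Combination of the two bounds\<close>

text \<open>Since \<open>T_opt\<close> never exceeds \<open>T_plus\<close> almost surely, the lower
  bound for the former and the upper bound for the latter confine both on the same good event. Off
  the event B1 the value is positive through time k, so stopping occurs at \<open>Suc k\<close> or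
  later.\<close>

lemma source_prob_between_ge:
  fixes v :: "int ^ 'd::finite"
  assumes v: "v \<in> sources n"
    and low: "z\<^sub>1 \<le> real (growth TYPE('d) (Suc k))"
      "measure (law v) {y \<in> space fields. \<exists>s\<le>k. opt_value n s (v, y) \<le> 0} \<le> \<eta>\<^sub>1"
    and up: "real (growth TYPE('d) s) \<le> z\<^sub>2"
      "measure (law v) {y \<in> space fields. 1 \<le> pvar q n s y} \<le> \<eta>\<^sub>2"
  shows "1 - (\<eta>\<^sub>1 + \<eta>\<^sub>2) \<le> source_prob Q\<^sub>0 Q\<^sub>1 n v (\<lambda>\<omega>. between_H TYPE('d) z\<^sub>1 z\<^sub>2 (T_opt Q\<^sub>0 Q\<^sub>1 n \<omega>))"
    and "1 - (\<eta>\<^sub>1 + \<eta>\<^sub>2) \<le> source_prob Q\<^sub>0 Q\<^sub>1 n v (\<lambda>\<omega>. between_H TYPE('d) z\<^sub>1 z\<^sub>2 (T_plus Q\<^sub>0 Q\<^sub>1 n \<omega>))"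
proof -
  let ?K = "law v"
  interpret K: prob_space ?K by (rule prob_space_signal)
  define B1 where "B1 = {y \<in> space fields. \<exists>s\<le>k. opt_value n s (v, y) \<le> 0}"
  define B2 :: "((int ^ 'd) \<times> nat \<Rightarrow> 'b) set" where "B2 = {y \<in> space fields. 1 \<le> pvar q n s y}"
  have "B1 = (\<Union>s\<le>k. {y \<in> space fields. opt_value n s (v, y) \<le> 0})" by (auto simp: B1_def)
  also have "\<dots> \<in> sets ?K"
  proof (intro sets.finite_UN)
    fix s
    have "opt_value n s \<in> borel_measurable (count_space UNIV \<Otimes>\<^sub>M fields)"
      using opt_value_measurable[of n s] measurable_cong_sets[OF sets_cascade refl] by blast
    from measurable_compose[OF measurable_Pair_signal this]
    have "(\<lambda>y. opt_value n s (v, y)) \<in> borel_measurable ?K" .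
    then show "{y \<in> space fields. opt_value n s (v, y) \<le> 0} \<in> sets ?K"
      unfolding space_signal[of v, symmetric] by (intro borel_measurable_le borel_measurable_const)
  qed simp
  finally have S1: "B1 \<in> sets ?K" .
  have S2: "B2 \<in> sets ?K"
    unfolding B2_def sets_signal by (intro borel_measurable_le borel_measurable_const pvar_measurable)
  have key: "1 - (\<eta>\<^sub>1 + \<eta>\<^sub>2) \<le> source_prob Q\<^sub>0 Q\<^sub>1 n v (\<lambda>\<omega>. between_H TYPE('d) z\<^sub>1 z\<^sub>2 (T \<omega>))"
    if TM: "T \<in> joint n \<rightarrow>\<^sub>M count_space UNIV"
      and T: "AE y in ?K. y \<notin> B1 \<longrightarrow> y \<notin> B2 \<longrightarrow> enat (Suc k) \<le> T (v, y) \<and> T (v, y) \<le> enat s"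
    for T :: "('d, 'b) outcome \<Rightarrow> enat"
  proof -
    let ?E = "\<lambda>\<omega>. between_H TYPE('d) z\<^sub>1 z\<^sub>2 (T \<omega>)"
    have "T -` {x. between_H TYPE('d) z\<^sub>1 z\<^sub>2 x} \<inter> space (joint n) \<in> sets (joint n)"
      by (rule measurable_sets[OF TM]) simp
    also have "T -` {x. between_H TYPE('d) z\<^sub>1 z\<^sub>2 x} \<inter> space (joint n)
        = {\<omega> \<in> space (joint n). ?E \<omega>}" by auto
    finally have EM: "{\<omega> \<in> space (joint n). ?E \<omega>} \<in> sets (joint n)" .
    then have EM': "{\<omega> \<in> space (joint n). ?E \<omega>} \<in> sets (count_space UNIV \<Otimes>\<^sub>M fields)"
      unfolding sets_cascade .
    have "Pair v -` {\<omega> \<in> space (joint n). ?E \<omega>} \<inter> space ?K \<in> sets ?K"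
      by (rule measurable_sets[OF measurable_Pair_signal EM'])
    also have "Pair v -` {\<omega> \<in> space (joint n). ?E \<omega>} \<inter> space ?K = {y \<in> space fields. ?E (v, y)}"
      unfolding space_cascade space_signal by blast
    finally have EK: "{y \<in> space fields. ?E (v, y)} \<in> sets ?K" .
    have "AE y in ?K. y \<in> space ?K - (B1 \<union> B2) \<longrightarrow> y \<in> {y \<in> space fields. ?E (v, y)}"
      using T
    proof eventually_elim
      case (elim y)
      show ?case
      proof
        assume y: "y \<in> space ?K - (B1 \<union> B2)"
        with elim have le: "enat (Suc k) \<le> T (v, y)" "T (v, y) \<le> enat s" by auto
        then obtain t where t: "T (v, y) = enat t" by (cases "T (v, y)") auto
        with le have "growth TYPE('d) (Suc k) \<le> growth TYPE('d) t" "growth TYPE('d) t \<le> growth TYPE('d) s"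
          by (auto intro!: growth_mono)
        then have "z\<^sub>1 \<le> real (growth TYPE('d) t)" "real (growth TYPE('d) t) \<le> z\<^sub>2"
          using low(1) up(1) by linarith+
        with t y show "y \<in> {y \<in> space fields. ?E (v, y)}" by (simp add: between_H_def space_signal)
      qed
    qed
    then have "measure ?K (space ?K - (B1 \<union> B2)) \<le> measure ?K {y \<in> space fields. ?E (v, y)}"
      using EK by (rule K.finite_measure_mono_AE)
    moreover have "measure ?K (space ?K - (B1 \<union> B2)) = 1 - measure ?K (B1 \<union> B2)"
      using S1 S2 by (intro K.prob_compl) auto
    moreover have "measure ?K (B1 \<union> B2) \<le> measure ?K B1 + measure ?K B2" by (rule measure_Un_le[OF S1 S2])
    moreover have "source_prob Q\<^sub>0 Q\<^sub>1 n v ?E = measure ?K {y \<in> space fields. ?E (v, y)}"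
      by (rule source_prob_eq[OF v EM])
    ultimately show ?thesis using low(2) up(2) unfolding B1_def[symmetric] B2_def[symmetric] by linarith
  qed
  have AE: "AE y in ?K. y \<notin> B1 \<longrightarrow> y \<notin> B2 \<longrightarrow> enat (Suc k) \<le> T_opt Q\<^sub>0 Q\<^sub>1 n (v, y)
      \<and> T_opt Q\<^sub>0 Q\<^sub>1 n (v, y) \<le> T_plus Q\<^sub>0 Q\<^sub>1 n (v, y) \<and> T_plus Q\<^sub>0 Q\<^sub>1 n (v, y) \<le> enat s"
    using AE_cascade_source[OF v T_opt_le_T_plus] AE_cascade_source[OF v T_plus_le] AE_space
  proof (eventually_elim, intro impI)
    case (elim y)
    assume nB: "y \<notin> B1" "y \<notin> B2"
    have y: "y \<in> space fields" using elim(3) by (simp add: space_signal)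
    have pos: "\<forall>s\<le>k. 0 < opt_value n s (v, y)"
    proof (intro allI impI, rule ccontr)
      fix s assume "s \<le> k" "\<not> 0 < opt_value n s (v, y)"
      then have "y \<in> B1" using y unfolding B1_def by (auto simp: not_less)
      with nB show False by simp
    qed
    have "pvar q n s y \<le> 1" using nB(2) y by (simp add: B2_def)
    moreover from pos have "enat (Suc k) \<le> T_opt Q\<^sub>0 Q\<^sub>1 n (v, y)" by (intro T_opt_ge) simp
    ultimately show "enat (Suc k) \<le> T_opt Q\<^sub>0 Q\<^sub>1 n (v, y)
      \<and> T_opt Q\<^sub>0 Q\<^sub>1 n (v, y) \<le> T_plus Q\<^sub>0 Q\<^sub>1 n (v, y) \<and> T_plus Q\<^sub>0 Q\<^sub>1 n (v, y) \<le> enat s"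
      using elim(1,2) by simp
  qed
  show "1 - (\<eta>\<^sub>1 + \<eta>\<^sub>2) \<le> source_prob Q\<^sub>0 Q\<^sub>1 n v (\<lambda>\<omega>. between_H TYPE('d) z\<^sub>1 z\<^sub>2 (T_opt Q\<^sub>0 Q\<^sub>1 n \<omega>))"
    by (rule key[OF T_opt_measurable]) (use AE in \<open>eventually_elim, auto intro: order_trans\<close>)
  show "1 - (\<eta>\<^sub>1 + \<eta>\<^sub>2) \<le> source_prob Q\<^sub>0 Q\<^sub>1 n v (\<lambda>\<omega>. between_H TYPE('d) z\<^sub>1 z\<^sub>2 (T_plus Q\<^sub>0 Q\<^sub>1 n \<omega>))"
    by (rule key[OF T_plus_measurable]) (use AE in \<open>eventually_elim, auto intro: order_trans\<close>)
qed

text \<open>E need not be measurable, as monotonicity requires only the larger event to be; if v is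
  not a source, the quotient has the default value 0.\<close>

lemma source_prob_le_1: "source_prob Q\<^sub>0 Q\<^sub>1 n v E \<le> 1"
proof -
  interpret prob_space "joint n" by (rule prob_space_cascade)
  have "{\<omega> \<in> space (joint n). fst \<omega> \<in> {v}} \<in> sets (joint n)" by measurable
  then have "measure (joint n) {\<omega> \<in> space (joint n). E \<omega> \<and> fst \<omega> = v}
      \<le> measure (joint n) {\<omega> \<in> space (joint n). fst \<omega> = v}"
    by (intro finite_measure_mono) auto
  then show ?thesis unfolding source_prob_def cond_prob_def
    by (intro divide_le_eq_1[THEN iffD2]) (auto simp: less_le)
qed

end

text \<open>The estimates hold for all large n and thus pass to the smaller filter of admissible
  sizes.\<close>

lemma tendsto_MIN_source_prob:
  fixes Q\<^sub>0 Q\<^sub>1 :: "'b measure" and E :: "nat \<Rightarrow> ('d::finite, 'b) outcome \<Rightarrow> bool"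
  assumes "signal_model Q\<^sub>0 Q\<^sub>1 q"
    and ev: "\<And>\<eta>. 0 < \<eta> \<Longrightarrow> \<forall>\<^sub>F n in sequentially. \<forall>v\<in>sources n. 1 - \<eta> \<le> source_prob Q\<^sub>0 Q\<^sub>1 n v (E n)"
  shows "((\<lambda>n. MIN v\<in>(sources n :: (int ^ 'd) set). source_prob Q\<^sub>0 Q\<^sub>1 n v (E n)) \<longlongrightarrow> 1) (sizes_at_top TYPE('d))"
proof (rule tendstoI)
  interpret signal_model Q\<^sub>0 Q\<^sub>1 q by fact
  fix e :: real assume "0 < e"
  then have "\<forall>\<^sub>F n in sequentially. \<forall>v\<in>sources n. 1 - e / 2 \<le> source_prob Q\<^sub>0 Q\<^sub>1 n v (E n)" by (intro ev) simp
  then have "\<forall>\<^sub>F n in sizes_at_top TYPE('d). \<forall>v\<in>sources n. 1 - e / 2 \<le> source_prob Q\<^sub>0 Q\<^sub>1 n v (E n)"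
    by (rule filter_leD[rotated]) (simp add: sizes_at_top_def)
  then show "\<forall>\<^sub>F n in sizes_at_top TYPE('d). dist (MIN v\<in>(sources n :: (int ^ 'd) set). source_prob Q\<^sub>0 Q\<^sub>1 n v (E n)) 1 < e"
  proof eventually_elim
    case (elim n)
    let ?S = "(\<lambda>v. source_prob Q\<^sub>0 Q\<^sub>1 n v (E n)) ` (sources n :: (int ^ 'd) set)"
    have "1 - e / 2 \<le> Min ?S" using elim by (intro Min.boundedI) auto
    moreover have "Min ?S \<le> 1"
    proof -
      have "Min ?S \<in> ?S" by (rule Min_in) auto
      then obtain v where "Min ?S = source_prob Q\<^sub>0 Q\<^sub>1 n v (E n)" by blast
      then show ?thesis by (simp only: source_prob_le_1)
    qed
    ultimately show ?case using \<open>0 < e\<close> unfolding dist_real_def by linarith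
  qed
qed

theorem theorem3:
  fixes Q\<^sub>0 Q\<^sub>1 :: "'b measure"
  assumes "prob_space Q\<^sub>0" and "prob_space Q\<^sub>1"
    and "sets Q\<^sub>0 = sets Q\<^sub>1"
    and "absolutely_continuous Q\<^sub>0 Q\<^sub>1" and "absolutely_continuous Q\<^sub>1 Q\<^sub>0"
    and "Q\<^sub>0 \<noteq> Q\<^sub>1"
    and "integrable Q\<^sub>1 (entropy_density (exp 1) Q\<^sub>0 Q\<^sub>1)"
  shows "\<exists>\<Delta>\<^sub>1 \<Delta>\<^sub>2 :: real. 0 < \<Delta>\<^sub>1 \<and> \<Delta>\<^sub>1 \<le> \<Delta>\<^sub>2 \<and>
    ((\<lambda>n. MIN v\<in>(sources n :: (int ^ 'd::finite) set).
        source_prob Q\<^sub>0 Q\<^sub>1 n v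
          (\<lambda>\<omega>. between_H TYPE('d) (\<Delta>\<^sub>1 * ln (real n)) (\<Delta>\<^sub>2 * ln (real n)) (T_opt Q\<^sub>0 Q\<^sub>1 n \<omega>)))
      \<longlongrightarrow> 1) (sizes_at_top TYPE('d)) \<and>
    ((\<lambda>n. MIN v\<in>(sources n :: (int ^ 'd) set).
        source_prob Q\<^sub>0 Q\<^sub>1 n v
          (\<lambda>\<omega>. between_H TYPE('d) (\<Delta>\<^sub>1 * ln (real n)) (\<Delta>\<^sub>2 * ln (real n)) (T_plus Q\<^sub>0 Q\<^sub>1 n \<omega>)))
      \<longlongrightarrow> 1) (sizes_at_top TYPE('d))"
proof -
  obtain q where model: "signal_model Q\<^sub>0 Q\<^sub>1 q" and kl: "integrable Q\<^sub>1 (\<lambda>x. max 0 (ln (q x)))"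
    using signal_model_exists[OF assms(1-5) assms(7)] .
  interpret signal_model Q\<^sub>0 Q\<^sub>1 q by (rule model)
  have kl: "integrable Q\<^sub>1 log_gain" using kl by (simp add: log_gain_def[abs_def])
  obtain \<rho> where \<rho>: "0 < \<rho>" "\<rho> < 1" "(\<integral>\<^sup>+ x. ennreal (sqrt (q x)) \<partial>Q\<^sub>0) \<le> ennreal \<rho>"
    using hellinger_affinity_less_1[OF assms(6)] .
  obtain p where p: "0 < p" "p \<le> measure Q\<^sub>0 {x \<in> space Q\<^sub>0. 1 \<le> q x}" "p \<le> measure Q\<^sub>1 {x \<in> space Q\<^sub>0. 1 \<le> q x}"
    using ratio_ge_1_positive .
  obtain \<Delta>\<^sub>1 :: real where \<Delta>1: "0 < \<Delta>\<^sub>1" and low: "\<forall>\<eta>>0. \<forall>\<^sub>F n in sequentially. \<exists>k. \<Delta>\<^sub>1 * ln (real n) \<le> real (growth TYPE('d) (Suc k)) \<and>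
      (\<forall>v\<in>(sources n :: (int ^ 'd) set). measure (law v) {y \<in> space fields. \<exists>s\<le>k. opt_value n s (v, y) \<le> 0} \<le> \<eta>)"
    using lower_bound[OF \<rho> p kl, where 'd = 'd] .
  obtain \<Delta> :: real where up: "\<forall>\<eta>>0. \<forall>\<^sub>F n in sequentially. \<exists>s. real (growth TYPE('d) s) \<le> \<Delta> * ln (real n) \<and>
      (\<forall>v\<in>(sources n :: (int ^ 'd) set). measure (law v) {y \<in> space fields. 1 \<le> pvar q n s y} \<le> \<eta>)"
    using upper_bound[OF \<rho>, where 'd = 'd] .
  \<comment> \<open>The maximum ensures the order of the constants; enlarging the upper one is
    harmless because \<open>ln n\<close> is nonnegative for n at least 1.\<close>
  define \<Delta>\<^sub>2 where "\<Delta>\<^sub>2 = max \<Delta>\<^sub>1 \<Delta>"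
  have both: "\<forall>\<^sub>F n in sequentially. \<forall>v\<in>(sources n :: (int ^ 'd) set).
      1 - \<eta> \<le> source_prob Q\<^sub>0 Q\<^sub>1 n v (\<lambda>\<omega>. between_H TYPE('d) (\<Delta>\<^sub>1 * ln (real n)) (\<Delta>\<^sub>2 * ln (real n)) (T_opt Q\<^sub>0 Q\<^sub>1 n \<omega>)) \<and>
      1 - \<eta> \<le> source_prob Q\<^sub>0 Q\<^sub>1 n v (\<lambda>\<omega>. between_H TYPE('d) (\<Delta>\<^sub>1 * ln (real n)) (\<Delta>\<^sub>2 * ln (real n)) (T_plus Q\<^sub>0 Q\<^sub>1 n \<omega>))"
    if "0 < \<eta>" for \<eta>
  proof -
    have \<eta>2: "0 < \<eta> / 2" using that by simp
    from low[rule_format, OF \<eta>2] up[rule_format, OF \<eta>2] eventually_ge_at_top[of 1] show ?thesis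
    proof eventually_elim
      case (elim n)
      from elim(1) obtain k where k: "\<Delta>\<^sub>1 * ln (real n) \<le> real (growth TYPE('d) (Suc k))"
        "\<And>v :: int ^ 'd. v \<in> sources n \<Longrightarrow> measure (law v) {y \<in> space fields. \<exists>s\<le>k. opt_value n s (v, y) \<le> 0} \<le> \<eta> / 2" by blast
      from elim(2) obtain s where s: "real (growth TYPE('d) s) \<le> \<Delta> * ln (real n)"
        "\<And>v :: int ^ 'd. v \<in> sources n \<Longrightarrow> measure (law v) {y \<in> space fields. 1 \<le> pvar q n s y} \<le> \<eta> / 2" by blast
      have "\<Delta> * ln (real n) \<le> \<Delta>\<^sub>2 * ln (real n)"
        using elim(3) by (intro mult_right_mono) (auto simp: \<Delta>\<^sub>2_def)
      with s(1) have s1: "real (growth TYPE('d) s) \<le> \<Delta>\<^sub>2 * ln (real n)" by simp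
      show ?case
        using source_prob_between_ge[OF _ k(1) k(2) s1 s(2)] by simp
    qed
  qed
  show ?thesis
  proof (intro exI conjI)
    show "0 < \<Delta>\<^sub>1" by (rule \<Delta>1)
    show "\<Delta>\<^sub>1 \<le> \<Delta>\<^sub>2" by (simp add: \<Delta>\<^sub>2_def)
    show "((\<lambda>n. MIN v\<in>(sources n :: (int ^ 'd) set). source_prob Q\<^sub>0 Q\<^sub>1 n v
          (\<lambda>\<omega>. between_H TYPE('d) (\<Delta>\<^sub>1 * ln (real n)) (\<Delta>\<^sub>2 * ln (real n)) (T_opt Q\<^sub>0 Q\<^sub>1 n \<omega>))) \<longlongrightarrow> 1) (sizes_at_top TYPE('d))"
      by (rule tendsto_MIN_source_prob[OF model]) (rule eventually_mono[OF both], auto)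
    show "((\<lambda>n. MIN v\<in>(sources n :: (int ^ 'd) set). source_prob Q\<^sub>0 Q\<^sub>1 n v
          (\<lambda>\<omega>. between_H TYPE('d) (\<Delta>\<^sub>1 * ln (real n)) (\<Delta>\<^sub>2 * ln (real n)) (T_plus Q\<^sub>0 Q\<^sub>1 n \<omega>))) \<longlongrightarrow> 1) (sizes_at_top TYPE('d))"
      by (rule tendsto_MIN_source_prob[OF model]) (rule eventually_mono[OF both], auto)
  qed
qed

end
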